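(* Let $p\le 7$ be a prime and let $G$ be a $p$-group of maximal class. Then the Quadratic Conjecture holds for $G$, that is: for every faithful $\mathbb{F}_p[G]$-module $V$ which is an F-module for $G$, there is an element of $\Omega_1(Z(G))$ that is quadratic on $V$.
   Context: All groups are finite. A $p$-group $G$ of order $p^n$ ($n\ge 2$) is of maximal class if its nilpotency class is $n-1$. $\Omega_1(Z(G))$ is the subgroup of the centre $Z(G)$ generated by the elements of order $p$. Modules $V$ are finite. A faithful $\mathbb{F}_p[G]$-module $V$ is an F-module for $G$ if there exists a non-trivial elementary abelian subgroup $E$ of $G$ with $|E|\cdot|C_V(E)|\ge |V|$, where $C_V(E)$ is the set of vectors of $V$ fixed by $E$. An element $g\in G$ is quadratic on $V$ if the minimal polynomial of its action on $V$ is $(X-1)^2$. *)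

theory Defs
  imports "HOL-Algebra.Algebra" "HOL-Number_Theory.Residues"
begin

section \<open>\<open>p\<close>-groups of maximal class\<close>

text \<open>Indexing starts at 0: \<open>lower_central_series G k\<close> is $\gamma_{k+1}(G)$.\<close>

primrec lower_central_series :: "('a, 'b) monoid_scheme \<Rightarrow> nat \<Rightarrow> 'a set" where
  "lower_central_series G 0 = carrier G"
| "lower_central_series G (Suc k) =
     generate G (\<Union>x\<in>lower_central_series G k. \<Union>y\<in>carrier G.
       {x \<otimes>\<^bsub>G\<^esub> y \<otimes>\<^bsub>G\<^esub> inv\<^bsub>G\<^esub> x \<otimes>\<^bsub>G\<^esub> inv\<^bsub>G\<^esub> y})"

definition has_nilpotency_class :: "('a, 'b) monoid_scheme \<Rightarrow> nat \<Rightarrow> bool" where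
  "has_nilpotency_class G c \<longleftrightarrow>
     lower_central_series G c = {\<one>\<^bsub>G\<^esub>} \<and> (\<forall>k<c. lower_central_series G k \<noteq> {\<one>\<^bsub>G\<^esub>})"

definition maximal_class :: "nat \<Rightarrow> ('a, 'b) monoid_scheme \<Rightarrow> bool" where
  "maximal_class p G \<longleftrightarrow>
     group G \<and> (\<exists>n\<ge>2. order G = p ^ n \<and> has_nilpotency_class G (n - 1))"

section \<open>Distinguished subgroups\<close>

definition center :: "('a, 'b) monoid_scheme \<Rightarrow> 'a set" where
  "center G = {z \<in> carrier G. \<forall>x\<in>carrier G. z \<otimes>\<^bsub>G\<^esub> x = x \<otimes>\<^bsub>G\<^esub> z}"

definition Omega1_center :: "nat \<Rightarrow> ('a, 'b) monoid_scheme \<Rightarrow> 'a set" where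
  "Omega1_center p G = generate G {z \<in> center G. group.ord G z = p}"

definition elementary_abelian_subgroup :: "nat \<Rightarrow> 'a set \<Rightarrow> ('a, 'b) monoid_scheme \<Rightarrow> bool" where
  "elementary_abelian_subgroup p E G \<longleftrightarrow>
     subgroup E G \<and> comm_group (G\<lparr>carrier := E\<rparr>) \<and> (\<forall>x\<in>E. x [^]\<^bsub>G\<^esub> p = \<one>\<^bsub>G\<^esub>)"

section \<open>Modules for a group\<close>

text \<open>An \<open>R[G]\<close>-module is given as an \<open>R\<close>-module \<open>V\<close> together with an \<open>R\<close>-linear action
  \<open>\<rho>\<close> of \<open>G\<close> on \<open>V\<close>.\<close>

locale group_module = act: group_action G "carrier V" \<rho> + V: module R V
  for R :: "('r, 'm) ring_scheme" and G :: "('g, 'b) monoid_scheme"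
    and V :: "('r, 'v, 'n) module_scheme" and \<rho> :: "'g \<Rightarrow> 'v \<Rightarrow> 'v" +
  assumes act_add: "\<lbrakk>g \<in> carrier G; v \<in> carrier V; w \<in> carrier V\<rbrakk>
      \<Longrightarrow> \<rho> g (v \<oplus>\<^bsub>V\<^esub> w) = \<rho> g v \<oplus>\<^bsub>V\<^esub> \<rho> g w"
    and act_smult: "\<lbrakk>g \<in> carrier G; a \<in> carrier R; v \<in> carrier V\<rbrakk>
      \<Longrightarrow> \<rho> g (a \<odot>\<^bsub>V\<^esub> v) = a \<odot>\<^bsub>V\<^esub> \<rho> g v"

locale faithful_group_module = group_module R G V \<rho> + faithful_action G "carrier V" \<rho>
  for R :: "('r, 'm) ring_scheme" and G :: "('g, 'b) monoid_scheme"
    and V :: "('r, 'v, 'n) module_scheme" and \<rho> :: "'g \<Rightarrow> 'v \<Rightarrow> 'v"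

definition fixed_vectors ::
  "('r, 'v, 'n) module_scheme \<Rightarrow> ('g \<Rightarrow> 'v \<Rightarrow> 'v) \<Rightarrow> 'g set \<Rightarrow> 'v set" where
  "fixed_vectors V \<rho> E = {v \<in> carrier V. \<forall>g\<in>E. \<rho> g v = v}"

definition F_module :: "nat \<Rightarrow> ('g, 'b) monoid_scheme \<Rightarrow> (int, 'v, 'n) module_scheme
    \<Rightarrow> ('g \<Rightarrow> 'v \<Rightarrow> 'v) \<Rightarrow> bool" where
  "F_module p G V \<rho> \<longleftrightarrow>
     faithful_group_module (residue_ring (int p)) G V \<rho> \<and> finite (carrier V) \<and>
     (\<exists>E. elementary_abelian_subgroup p E G \<and> E \<noteq> {\<one>\<^bsub>G\<^esub>} \<and>
          card E * card (fixed_vectors V \<rho> E) \<ge> card (carrier V))"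

section \<open>Minimal polynomials and quadratic elements\<close>

text \<open>Polynomials are the coefficient lists (leading coefficient first) of
  \<^theory>\<open>HOL-Algebra.Polynomials\<close>; the following is the analogue of \<^const>\<open>ring.eval\<close>, computing
  $q(T)(v)$ for a self-map $T$ of a module.\<close>

primrec endo_eval ::
  "('r, 'v, 'n) module_scheme \<Rightarrow> ('v \<Rightarrow> 'v) \<Rightarrow> 'r list \<Rightarrow> 'v \<Rightarrow> 'v" where
  "endo_eval V T [] v = \<zero>\<^bsub>V\<^esub>"
| "endo_eval V T (a # q) v = (a \<odot>\<^bsub>V\<^esub> (T ^^ length q) v) \<oplus>\<^bsub>V\<^esub> endo_eval V T q v"

definition annihilates ::
  "('r, 'v, 'n) module_scheme \<Rightarrow> ('v \<Rightarrow> 'v) \<Rightarrow> 'r list \<Rightarrow> bool" where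
  "annihilates V T q \<longleftrightarrow> (\<forall>v\<in>carrier V. endo_eval V T q v = \<zero>\<^bsub>V\<^esub>)"

text \<open>The zero polynomial is \<open>[]\<close>; the condition \<open>m \<noteq> []\<close> makes the leading coefficient
  meaningful.\<close>

definition is_minimal_polynomial :: "('r, 'm) ring_scheme \<Rightarrow> ('r, 'v, 'n) module_scheme
    \<Rightarrow> ('v \<Rightarrow> 'v) \<Rightarrow> 'r list \<Rightarrow> bool" where
  "is_minimal_polynomial R V T m \<longleftrightarrow>
     m \<in> carrier (poly_ring R) \<and> m \<noteq> [] \<and> lead_coeff m = \<one>\<^bsub>R\<^esub> \<and> annihilates V T m \<and>
     (\<forall>q\<in>carrier (poly_ring R). q \<noteq> [] \<and> annihilates V T q \<longrightarrow> degree m \<le> degree q)"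

definition quadratic_on :: "('r, 'm) ring_scheme \<Rightarrow> ('r, 'v, 'n) module_scheme
    \<Rightarrow> ('g \<Rightarrow> 'v \<Rightarrow> 'v) \<Rightarrow> 'g \<Rightarrow> bool" where
  "quadratic_on R V \<rho> g \<longleftrightarrow>
     is_minimal_polynomial R V (\<rho> g)
       ((X\<^bsub>R\<^esub> \<ominus>\<^bsub>poly_ring R\<^esub> \<one>\<^bsub>poly_ring R\<^esub>) [^]\<^bsub>poly_ring R\<^esub> (2::nat))"

end

theory Submission
  imports Defs "HOL-Library.Function_Division" "HOL-Library.Function_Algebras" "HOL-Library.Numeral_Type"
begin

text \<open>The case \<open>p = 2\<close> is immediate: a central involution \<open>z\<close> satisfies
$(z-1)^2 = 2(1-z) = 0$ on \<open>V\<close>. If \<open>|G| = p\<^sup>2\<close>, then \<open>G\<close> is abelian and the replacement theorem below,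
applied to the offender itself, yields a quadratic element. So let \<open>p\<close> be odd and \<open>|G| = p\<^sup>n\<close> with
\<open>n \<ge> 3\<close>, and write \<open>L\<^sub>j\<close> for the \<open>j\<close>-th term of the lower central series, with \<open>L\<^sub>1 = G\<close>; the centre is
\<open>L\<^bsub>n-1\<^esub>\<close>, of order \<open>p\<close>.

Among the subgroups of an elementary abelian offender \<open>E\<close>, Timmesfeld's replacement argument
(\<open>timmesfeld\<close>, \<open>offender_in_abelian_normal\<close>) finds an offender \<open>Q\<close> all of whose elements are quadratic. If
the ambient elementary abelian group is normal in \<open>G\<close>, the quadratic offender can be taken normal as well,
and every nontrivial normal subgroup contains the centre. Hence one is done as soon as \<open>Q\<close> lies in an
abelian normal subgroup \<open>N\<close>: replace \<open>E\<close> by the elements of order dividing \<open>p\<close> in \<open>N\<close>. The normal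
closures of single elements form almost a chain, so \<open>Q\<close> lies in the normal closure of one of its elements
unless some \<open>e \<in> Q\<close> has a nonabelian normal closure \<open>N\<close>.

That remaining case (\<open>nonabelian_closure\<close>) is where \<open>p \<le> 7\<close> enters. Let \<open>L\<^sub>m\<close> be the largest term of the
series centralised by \<open>N\<close>, and \<open>x \<in> L\<^bsub>m-1\<^esub>\<close> an element that \<open>N\<close> does not centralise. Then \<open>y \<mapsto> [y, x]\<close> is a
homomorphism from \<open>N\<close> to the centre of \<open>N\<close>, and \<open>c = [e, x]\<close> is nontrivial. The conjugates \<open>e, ec, ec\<^sup>2\<close> of
\<open>e\<close> are quadratic and commute, and this forces \<open>c\<close> to be quadratic (\<open>quad_progression_2\<close>). Counting the kernel
and the image of the homomorphism shows that if \<open>c\<close> has level \<open>n - t\<close> and \<open>e\<close> has level \<open>i\<close>, then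
\<open>2t + 1 \<le> n - i\<close>. For \<open>t = 1\<close>, \<open>c\<close> is central. For \<open>t = 2\<close> the same argument with a conjugate of \<open>c\<close>
descends once more. For \<open>t \<ge> 3\<close>, \<open>e\<close> has order \<open>p\<close>, and the theory of groups of maximal
class gives \<open>n - i \<le> p \<le> 7\<close>; so \<open>t = 3\<close> and \<open>p \<ge> 5\<close>. The conjugates of \<open>c\<close> under powers of a suitable \<open>s\<close> are now
$c\,b^k z^{k(k-1)/2}$ with \<open>z\<close> central, and five consecutive quadratic terms of such a progression of
degree 2 force \<open>z\<close> to be quadratic (\<open>quad_progression_3\<close>).

The bound \<open>n - i \<le> p\<close> (\<open>order_p_at_level\<close>, \<open>order_p_at_level_1\<close>) needs two classical ingredients. Blackburn's
theorem (\<open>blackburn\<close>) says that the two-step centralisers $C_G(L_j/L_{j+2})$ with \<open>2 \<le> j \<le> n - 3\<close> all coincide, so that some \<open>s\<close>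
avoids all two-step centralisers and commutation with \<open>s\<close> moves every layer onto the next one. For such
\<open>s\<close> the Hall--Petrescu congruence (\<open>power_iter_com\<close>) computes \<open>a\<^sup>p\<close> as the inverse of the \<open>(p-1)\<close>-fold
commutator \<open>[a, s, \<dots>, s]\<close> up to deeper terms; thus taking \<open>p\<close>-th powers moves an element exactly \<open>p - 1\<close> layers
down, as long as such a layer exists.

Groups are handled as subsets of a type with group operations and \<open>V\<close> as an additive subset of a
commutative ring in which \<open>p\<close> kills it, because this makes computations with elements short. The last part
transports the given structures there: \<open>G\<close> by its regular permutation representation, and \<open>V\<close> by a choice
of coordinates over \<open>\<int>/p\<close>.\<close>

section \<open>Group elements, commutators and conjugates\<close>

text \<open>The operations are written multiplicatively, which makes powers \<open>x ^ k\<close> and pointwise operations on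
sequences available; associativity together with the cancellation rules below lets the simplifier decide
identities between commutators.\<close>

class mgroup = monoid_mult + inverse +
  assumes mg_left_inverse [simp]: "inverse a * a = 1"
begin

lemma mg_left_cancel [simp]: "inverse a * (a * b) = b"
  by (simp flip: mult.assoc)

lemma mg_right_inverse [simp]: "a * inverse a = 1"
  by (metis mg_left_cancel mult.assoc mult.left_neutral mult.right_neutral mg_left_inverse)

lemma mg_right_cancel [simp]: "a * (inverse a * b) = b"
  by (simp flip: mult.assoc)

lemma mg_inverse_unique: "a * b = 1 \<Longrightarrow> inverse a = b"
  by (metis mg_left_cancel mult.right_neutral)

lemma mg_inverse_inverse [simp]: "inverse (inverse a) = a"
  by (simp add: mg_inverse_unique)

lemma mg_inverse_one [simp]: "inverse 1 = 1"
  by (simp add: mg_inverse_unique)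

lemma mg_inverse_mult [simp]: "inverse (a * b) = inverse b * inverse a"
  by (rule mg_inverse_unique) (simp add: mult.assoc)

lemma mg_left_mult_cancel [simp]: "a * b = a * c \<longleftrightarrow> b = c"
  by (metis mg_left_cancel)

lemma mg_right_mult_cancel [simp]: "b * a = c * a \<longleftrightarrow> b = c"
  by (metis mg_right_inverse mult.assoc mult.right_neutral)

lemma mg_inverse_power: "inverse (a ^ k) = inverse a ^ k"
  by (induction k) (simp_all add: power_commutes)

definition com :: "'a \<Rightarrow> 'a \<Rightarrow> 'a"
  where "com x y = inverse x * inverse y * x * y"

definition cj :: "'a \<Rightarrow> 'a \<Rightarrow> 'a"
  where "cj x g = inverse g * x * g"

lemma com_one [simp]: "com 1 y = 1" "com x 1 = 1" "com x x = 1"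
  by (simp_all add: com_def mult.assoc)

lemma inverse_com: "inverse (com x y) = com y x"
  by (simp add: com_def mult.assoc)

lemma com_eq_1_iff: "com x y = 1 \<longleftrightarrow> x * y = y * x"
  by (metis com_def mg_inverse_mult mg_left_inverse mg_left_mult_cancel mult.assoc)

lemma cj_com: "cj x g = x * com x g"
  by (simp add: com_def cj_def mult.assoc)

lemma cj_mult: "cj (x * y) g = cj x g * cj y g"
  by (simp add: cj_def mult.assoc)

lemma cj_one [simp]: "cj x 1 = x" "cj 1 g = 1"
  by (simp_all add: cj_def)

lemma cj_cj: "cj (cj x g) h = cj x (g * h)"
  by (simp add: cj_def mult.assoc)

lemma cj_power: "cj (x ^ k) g = cj x g ^ k"
  by (induction k) (simp_all add: cj_mult)

lemma cj_inverse: "cj (inverse x) g = inverse (cj x g)"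
  by (simp add: cj_def mult.assoc)

lemma cj_com_distrib: "cj (com x y) g = com (cj x g) (cj y g)"
  by (simp add: cj_def com_def mult.assoc)

lemma com_mult_left: "com (x * y) z = cj (com x z) y * com y z"
  by (simp add: cj_def com_def mult.assoc)

lemma com_mult_right: "com x (y * z) = com x z * cj (com x y) z"
  by (simp add: cj_def com_def mult.assoc)

end

instance "fun" :: (type, mgroup) mgroup
  by standard (simp add: fun_eq_iff inverse_fun_def)

lemma inverse_apply: "inverse f k = inverse (f k :: 'a :: inverse)"
  by (simp add: inverse_fun_def)

lemma com_apply: "com f g k = com (f k) (g k :: 'a :: mgroup)"
  by (simp add: com_def inverse_apply)

section \<open>Subgroups and central filtrations\<close>

definition sgrp :: "'a :: mgroup set \<Rightarrow> bool"
  where "sgrp H \<longleftrightarrow> 1 \<in> H \<and> (\<forall>x\<in>H. \<forall>y\<in>H. x * y \<in> H) \<and> (\<forall>x\<in>H. inverse x \<in> H)"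

lemma sgrpD:
  assumes "sgrp H"
  shows "1 \<in> H" "x \<in> H \<Longrightarrow> y \<in> H \<Longrightarrow> x * y \<in> H" "x \<in> H \<Longrightarrow> inverse x \<in> H"
  using assms by (auto simp: sgrp_def)

lemma sgrp_power: "sgrp H \<Longrightarrow> x \<in> H \<Longrightarrow> x ^ k \<in> H"
  by (induction k) (auto simp: sgrp_def)

lemma sgrp_com: "sgrp H \<Longrightarrow> x \<in> H \<Longrightarrow> y \<in> H \<Longrightarrow> com x y \<in> H"
  by (simp add: com_def sgrpD)

lemma sgrp_cj: "sgrp H \<Longrightarrow> x \<in> H \<Longrightarrow> y \<in> H \<Longrightarrow> cj x y \<in> H"
  by (simp add: cj_def sgrpD)

lemma sgrp_mult_cancel:
  assumes "sgrp H" "x \<in> H"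
  shows "x * y \<in> H \<longleftrightarrow> y \<in> H" "y * x \<in> H \<longleftrightarrow> y \<in> H"
proof -
  have "y \<in> H" if "x * y \<in> H"
    using sgrpD(2)[OF assms(1) sgrpD(3)[OF assms] that] by simp
  then show "x * y \<in> H \<longleftrightarrow> y \<in> H" using assms by (auto intro: sgrpD)
  have "y \<in> H" if "y * x \<in> H"
    using sgrpD(2)[OF assms(1) that sgrpD(3)[OF assms]] by (simp add: mult.assoc)
  then show "y * x \<in> H \<longleftrightarrow> y \<in> H" using assms by (auto intro: sgrpD)
qed

lemma sgrp_inverse_iff: "sgrp H \<Longrightarrow> inverse x \<in> H \<longleftrightarrow> x \<in> H"
  by (metis mg_inverse_inverse sgrpD(3))

lemma sgrp_com_swap: "sgrp H \<Longrightarrow> com x y \<in> H \<longleftrightarrow> com y x \<in> H"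
  by (metis inverse_com sgrpD(3))

lemma sgrp_cj_iff: "sgrp H \<Longrightarrow> x \<in> H \<Longrightarrow> cj x g \<in> H \<longleftrightarrow> com x g \<in> H"
  by (simp add: cj_com sgrp_mult_cancel)

text \<open>The filtration starts at weight 0, and elements of weight 0 need only normalise the later terms. Along such a
filtration commutators behave as in a graded Lie ring.\<close>

definition filtration :: "(nat \<Rightarrow> 'a :: mgroup set) \<Rightarrow> bool" where
  "filtration \<Phi> \<longleftrightarrow> (\<forall>w. sgrp (\<Phi> w)) \<and> (\<forall>w. \<Phi> (Suc w) \<subseteq> \<Phi> w) \<and>
     (\<forall>w v. \<forall>x\<in>\<Phi> w. \<forall>y\<in>\<Phi> v. com x y \<in> \<Phi> (w + v))"

lemma filtrationD:
  assumes "filtration \<Phi>"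
  shows "sgrp (\<Phi> w)" "x \<in> \<Phi> w \<Longrightarrow> y \<in> \<Phi> v \<Longrightarrow> com x y \<in> \<Phi> (w + v)"
  using assms by (auto simp: filtration_def)

lemma filtration_mono:
  assumes "filtration \<Phi>" "w \<le> v"
  shows "\<Phi> v \<subseteq> \<Phi> w"
  using assms(2)
proof (induction v rule: dec_induct)
  case (step v)
  have "\<Phi> (Suc v) \<subseteq> \<Phi> v" using assms(1) by (simp add: filtration_def)
  with step.IH show ?case by blast
qed simp

lemma filtration_com:
  assumes "filtration \<Phi>" "x \<in> \<Phi> w" "y \<in> \<Phi> v" "u \<le> w + v"
  shows "com x y \<in> \<Phi> u"
  using filtrationD(2)[OF assms(1-3)] filtration_mono[OF assms(1,4)] by blast

lemma filtration_cj:
  assumes "filtration \<Phi>" "x \<in> \<Phi> w" "y \<in> \<Phi> v"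
  shows "cj x y \<in> \<Phi> w"
  using assms filtration_com[OF assms, of w] by (simp add: cj_com filtrationD(1) sgrpD)

text \<open>For the shift operator on sequences, \<open>inverse f * T f\<close> is the sequence of multiplicative differences of \<open>f\<close>.\<close>

definition derived_filtration :: "('a \<Rightarrow> 'a) \<Rightarrow> (nat \<Rightarrow> 'a :: mgroup set) \<Rightarrow> nat \<Rightarrow> 'a set" where
  "derived_filtration T \<Phi> w = {f \<in> \<Phi> w. inverse f * T f \<in> \<Phi> (Suc w)}"

text \<open>This is the inductive step of the theorem of Lazard and Leibman that polynomial sequences form a group. The
difference of a product or of a commutator is a product of conjugates of commutators of the differences, and
each of these gains one unit of weight.\<close>

lemma filtration_derived_filtration:
  fixes T :: "'a :: mgroup \<Rightarrow> 'a"
  assumes fil: "filtration \<Phi>" and T: "\<And>x y. T (x * y) = T x * T y"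
  shows "filtration (derived_filtration T \<Phi>)"
proof -
  note sg = filtrationD(1)[OF fil]
  have T1: "T 1 = 1"
    by (metis T mg_left_mult_cancel mult.right_neutral)
  have Ti: "T (inverse x) = inverse (T x)" for x
    by (metis T T1 mg_inverse_unique mg_right_inverse)
  define D where "D f = inverse f * T f" for f
  have TD: "T f = f * D f" for f by (simp add: D_def mult.assoc)
  have Tcom: "T (com x y) = com (T x) (T y)" for x y by (simp add: com_def T Ti)
  have "sgrp (derived_filtration T \<Phi> w)" for w
    unfolding sgrp_def
  proof (intro conjI ballI)
    show "1 \<in> derived_filtration T \<Phi> w" by (simp add: derived_filtration_def T1 sgrpD sg)
  next
    fix x y assume "x \<in> derived_filtration T \<Phi> w" "y \<in> derived_filtration T \<Phi> w"
    then have *: "x \<in> \<Phi> w" "y \<in> \<Phi> w" "D x \<in> \<Phi> (Suc w)" "D y \<in> \<Phi> (Suc w)"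
      by (auto simp: derived_filtration_def D_def)
    have "D (x * y) = cj (D x) y * D y" by (simp add: D_def T cj_def mult.assoc)
    then have "D (x * y) \<in> \<Phi> (Suc w)"
      using sgrpD(2)[OF sg filtration_cj[OF fil *(3,2)] *(4)] by simp
    then show "x * y \<in> derived_filtration T \<Phi> w" using * by (simp add: derived_filtration_def D_def sgrpD sg)
  next
    fix x assume "x \<in> derived_filtration T \<Phi> w"
    then have *: "x \<in> \<Phi> w" "D x \<in> \<Phi> (Suc w)" by (auto simp: derived_filtration_def D_def)
    have "D (inverse x) = cj (inverse (D x)) (inverse x)"
      by (simp add: D_def Ti cj_def mult.assoc)
    moreover have "cj (inverse (D x)) (inverse x) \<in> \<Phi> (Suc w)"
      by (rule filtration_cj[OF fil _ sgrpD(3)[OF sg *(1)]]) (simp add: sgrpD(3)[OF sg *(2)])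
    ultimately have "D (inverse x) \<in> \<Phi> (Suc w)" by simp
    then show "inverse x \<in> derived_filtration T \<Phi> w" using * by (simp add: derived_filtration_def D_def sgrpD sg)
  qed
  moreover have "derived_filtration T \<Phi> (Suc w) \<subseteq> derived_filtration T \<Phi> w" for w
    using filtration_mono[OF fil, of w "Suc w"] filtration_mono[OF fil, of "Suc w" "Suc (Suc w)"]
    by (auto simp: derived_filtration_def)
  moreover have "com x y \<in> derived_filtration T \<Phi> (w + v)" if "x \<in> derived_filtration T \<Phi> w" "y \<in> derived_filtration T \<Phi> v" for x y w v
  proof -
    from that have *: "x \<in> \<Phi> w" "y \<in> \<Phi> v" "D x \<in> \<Phi> (Suc w)" "D y \<in> \<Phi> (Suc v)"
      by (auto simp: derived_filtration_def D_def)
    let ?c = "com x y" and ?a = "D x" and ?b = "D y"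
    have c: "?c \<in> \<Phi> (w + v)" using * by (intro filtrationD[OF fil])
    note cjI = filtration_cj[OF fil]
    have 1: "com x ?b \<in> \<Phi> (Suc (w + v))" "com ?a y \<in> \<Phi> (Suc (w + v))" "com ?a ?b \<in> \<Phi> (Suc (w + v))"
      by (rule filtration_com[OF fil], use * in \<open>auto\<close>)+
    have 2: "com ?c (?b * ?a) \<in> \<Phi> (Suc (w + v))"
      unfolding com_mult_right
      using filtration_com[OF fil c *(3), of "Suc (w+v)"] filtration_com[OF fil c *(4), of "Suc (w+v)"]
      by (auto intro!: sgrpD(2)[OF sg] cjI[OF _ *(3)])
    have "com (x * ?a) (y * ?b) = cj (com x ?b) ?a * (?c * com ?c (?b * ?a)) * com ?a ?b * cj (com ?a y) ?b"
      by (simp add: com_def cj_def mult.assoc)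
    then have "D ?c = cj (cj (com x ?b) ?a) ?c * com ?c (?b * ?a) * com ?a ?b * cj (com ?a y) ?b"
      by (simp add: D_def[of ?c] Tcom TD[of x] TD[of y] cj_def mult.assoc)
    moreover have "\<dots> \<in> \<Phi> (Suc (w + v))"
      using 1 2 * c by (auto intro!: sgrpD(2)[OF sg] cjI)
    ultimately show ?thesis using c by (simp add: derived_filtration_def D_def)
  qed
  ultimately show ?thesis by (auto simp: filtration_def)
qed

section \<open>Polynomial sequences\<close>

definition shift :: "(nat \<Rightarrow> 'a) \<Rightarrow> nat \<Rightarrow> 'a"
  where "shift f k = f (Suc k)"

definition diffq :: "(nat \<Rightarrow> 'a :: mgroup) \<Rightarrow> nat \<Rightarrow> 'a"
  where "diffq f = inverse f * shift f"

lemma diffq_apply: "diffq f k = inverse (f k) * f (Suc k)"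
  by (simp add: diffq_def shift_def inverse_apply)

fun poly_seq_upto :: "(nat \<Rightarrow> 'a :: mgroup set) \<Rightarrow> nat \<Rightarrow> nat \<Rightarrow> (nat \<Rightarrow> 'a) set" where
  "poly_seq_upto \<Phi> 0 = (\<lambda>w. {f. \<forall>k. f k \<in> \<Phi> w})"
| "poly_seq_upto \<Phi> (Suc n) = derived_filtration shift (poly_seq_upto \<Phi> n)"

text \<open>Polynomial sequences in the sense of Leibman: taking one difference raises the weight by one.\<close>

definition poly_seq :: "(nat \<Rightarrow> 'a :: mgroup set) \<Rightarrow> nat \<Rightarrow> (nat \<Rightarrow> 'a) set"
  where "poly_seq \<Phi> w = {f. \<forall>n k. (diffq ^^ n) f k \<in> \<Phi> (w + n)}"

lemma poly_seq_upto_iff: "f \<in> poly_seq_upto \<Phi> n w \<longleftrightarrow> (\<forall>j\<le>n. \<forall>k. (diffq ^^ j) f k \<in> \<Phi> (w + j))"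
proof (induction n arbitrary: f w)
  case (Suc n)
  have "f \<in> poly_seq_upto \<Phi> (Suc n) w \<longleftrightarrow> f \<in> poly_seq_upto \<Phi> n w \<and> diffq f \<in> poly_seq_upto \<Phi> n (Suc w)"
    by (simp add: derived_filtration_def diffq_def)
  also have "\<dots> \<longleftrightarrow> (\<forall>j\<le>n. \<forall>k. (diffq ^^ j) f k \<in> \<Phi> (w + j)) \<and>
      (\<forall>j\<le>n. \<forall>k. (diffq ^^ (Suc j)) f k \<in> \<Phi> (w + Suc j))"
    by (simp add: Suc.IH funpow_swap1)
  also have "\<dots> \<longleftrightarrow> (\<forall>j\<le>Suc n. \<forall>k. (diffq ^^ j) f k \<in> \<Phi> (w + j))"
    by (metis Suc_le_mono le_Suc_eq not0_implies_Suc le0)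
  finally show ?case .
qed simp

lemma filtration_poly_seq_upto: "filtration \<Phi> \<Longrightarrow> filtration (poly_seq_upto \<Phi> n)"
proof (induction n)
  case 0
  then show ?case
    unfolding filtration_def sgrp_def by (auto simp: inverse_apply com_apply) blast
next
  case (Suc n)
  then show ?case by (auto intro!: filtration_derived_filtration simp: shift_def fun_eq_iff)
qed

lemma poly_seq_poly_seq_upto: "poly_seq \<Phi> w = (\<Inter>n. poly_seq_upto \<Phi> n w)"
  by (rule Set.set_eqI) (simp add: poly_seq_def poly_seq_upto_iff, blast)

lemma filtration_poly_seq: "filtration \<Phi> \<Longrightarrow> filtration (poly_seq \<Phi>)"
proof -
  assume "filtration \<Phi>"
  then have fil: "filtration (poly_seq_upto \<Phi> n)" for n by (rule filtration_poly_seq_upto)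
  note sg = filtrationD(1)[OF fil]
  have "sgrp (poly_seq \<Phi> w)" for w
    unfolding poly_seq_poly_seq_upto using sg by (simp add: sgrp_def)
  moreover have "poly_seq \<Phi> (Suc w) \<subseteq> poly_seq \<Phi> w" for w
    unfolding poly_seq_poly_seq_upto using filtration_mono[OF fil, of w "Suc w"] by fastforce
  moreover have "com x y \<in> poly_seq \<Phi> (w + v)" if "x \<in> poly_seq \<Phi> w" "y \<in> poly_seq \<Phi> v" for x y w v
    using that filtrationD(2)[OF fil] unfolding poly_seq_poly_seq_upto by auto
  ultimately show ?thesis by (simp add: filtration_def)
qed

lemma poly_diffq:
  assumes "f \<in> poly_seq \<Phi> w"
  shows "f k \<in> \<Phi> w" "diffq f \<in> poly_seq \<Phi> (Suc w)"
  using assms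
   apply (auto simp: poly_seq_def simp flip: funpow_swap1 dest: spec[of _ 0])
  by (metis add_Suc_right funpow.simps(2) o_apply)

lemma poly_seqI:
  assumes "\<And>k. f k \<in> \<Phi> w" "diffq f \<in> poly_seq \<Phi> (Suc w)"
  shows "f \<in> poly_seq \<Phi> w"
  unfolding poly_seq_def
proof safe
  fix n k
  show "(diffq ^^ n) f k \<in> \<Phi> (w + n)"
    using assms by (cases n) (auto simp: poly_seq_def funpow_swap1)
qed

lemma poly_seq_const: 
  assumes "filtration \<Phi>" "g \<in> \<Phi> w"
  shows "(\<lambda>_. g) \<in> poly_seq \<Phi> w"
proof -
  have "(diffq ^^ n) (\<lambda>_. g) = (if n = 0 then \<lambda>_. g else 1)" for n
    by (induction n) (auto simp: fun_eq_iff diffq_apply)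
  then show ?thesis using assms filtrationD(1)[OF assms(1)] by (auto simp: poly_seq_def sgrpD)
qed

lemma diffq_binomial: "diffq (\<lambda>k. g ^ (k choose Suc j)) = (\<lambda>k. g ^ (k choose j))"
proof
  fix k
  have "g ^ (Suc k choose Suc j) = g ^ (k choose Suc j) * g ^ (k choose j)"
    by (simp add: add.commute[of "k choose j"] power_add)
  then show "diffq (\<lambda>k. g ^ (k choose Suc j)) k = g ^ (k choose j)"
    by (simp only: diffq_apply mg_left_cancel)
qed

lemma diffq_binomial_0: "diffq (\<lambda>k. g ^ (k choose 0)) = (\<lambda>_. 1)"
  by (auto simp: fun_eq_iff diffq_apply)

lemma diffq_one: "diffq (\<lambda>_. 1) = (\<lambda>_. 1)"
  by (auto simp: fun_eq_iff diffq_apply)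

lemma diffq_iter_poly_seq:
  assumes "f \<in> poly_seq \<Phi> w"
  shows "(diffq ^^ n) f \<in> poly_seq \<Phi> (w + n)"
proof (induction n)
  case (Suc n)
  then show ?case using poly_diffq(2)[OF Suc] by simp
qed (use assms in simp)

lemma poly_seq_one: "filtration \<Phi> \<Longrightarrow> 1 \<in> poly_seq \<Phi> w"
  using filtration_poly_seq[of \<Phi>] by (simp add: filtration_def sgrp_def)

text \<open>The binomial sequences play the role of the monomials: their differences are again binomial sequences.\<close>

lemma poly_seq_binomial:
  assumes "filtration \<Phi>" "g \<in> \<Phi> (w + j)"
  shows "(\<lambda>k. g ^ (k choose j)) \<in> poly_seq \<Phi> w"
  using assms(2)
proof (induction j arbitrary: w)
  case 0
  then show ?case using poly_seq_const[OF assms(1), of g w] by simp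
next
  case (Suc j)
  have g: "g \<in> \<Phi> w" using Suc.prems filtration_mono[OF assms(1), of w "w + Suc j"] by auto
  show ?case
  proof (rule poly_seqI)
    show "g ^ (k choose Suc j) \<in> \<Phi> w" for k
      by (rule sgrp_power[OF filtrationD(1)[OF assms(1)] g])
    show "diffq (\<lambda>k. g ^ (k choose Suc j)) \<in> poly_seq \<Phi> (Suc w)"
      unfolding diffq_binomial by (rule Suc.IH) (use Suc.prems in simp)
  qed
qed

lemma iter_diffq_binomial: "q < n \<Longrightarrow> (diffq ^^ n) (\<lambda>k. g ^ (k choose q)) = (\<lambda>_. 1)"
proof (induction q arbitrary: n)
  case 0
  have "(diffq ^^ m) (\<lambda>_. 1) = (\<lambda>_. 1 :: 'a)" for m by (induction m) (auto simp: diffq_one)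
  with 0 show ?case
    by (cases n) (simp_all add: funpow_swap1 diffq_binomial_0 del: funpow.simps(2) binomial_n_0 add: funpow_Suc_right)
next
  case (Suc q)
  then show ?case
    by (cases n) (simp_all add: funpow_Suc_right diffq_binomial del: funpow.simps(2))
qed

lemma diffq_mult: "diffq (f * g) = cj (diffq f) g * diffq g"
  by (auto simp: fun_eq_iff diffq_apply cj_def mult.assoc inverse_apply)

text \<open>modulo one further step of the filtration, differences are additive\<close>

lemma iter_diffq_mult:
  assumes fil: "filtration \<Phi>" and f: "f \<in> poly_seq \<Phi> w" and g: "g \<in> poly_seq \<Phi> w" and w: "w \<ge> 1"
  shows "\<exists>e\<in>poly_seq \<Phi> (Suc (w + n)). (diffq ^^ n) (f * g) = (diffq ^^ n) f * (diffq ^^ n) g * e"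
proof (induction n)
  case 0
  show ?case using poly_seq_one[OF fil] by (intro bexI[of _ 1]) auto
next
  case (Suc n)
  then obtain e where e: "e \<in> poly_seq \<Phi> (Suc (w + n))"
    and eq: "(diffq ^^ n) (f * g) = (diffq ^^ n) f * (diffq ^^ n) g * e" by blast
  define x y where "x = (diffq ^^ n) f" and "y = (diffq ^^ n) g"
  have xy: "x \<in> poly_seq \<Phi> (w + n)" "y \<in> poly_seq \<Phi> (w + n)"
    using diffq_iter_poly_seq f g by (auto simp: x_def y_def)
  note fp = filtration_poly_seq[OF fil] 
  have Dx: "diffq x \<in> poly_seq \<Phi> (Suc (w + n))" and Dy: "diffq y \<in> poly_seq \<Phi> (Suc (w + n))"
    and De: "diffq e \<in> poly_seq \<Phi> (Suc (Suc (w + n)))"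
    using poly_diffq(2) xy e by blast+
  define E where "E = cj (com (diffq x) y) (diffq y) * com (cj (diffq x) y * diffq y) e * diffq e"
  have "diffq (x * y * e) = diffq x * diffq y * E" (is ?eq)
    by (simp add: diffq_mult E_def cj_def com_def mult.assoc)
  moreover have "E \<in> poly_seq \<Phi> (Suc (Suc (w + n)))"
  proof -
    have 1: "com (diffq x) y \<in> poly_seq \<Phi> (Suc (Suc (w + n)))"
      by (rule filtration_com[OF fp Dx xy(2)]) (use w in auto)
    have 2: "cj (diffq x) y * diffq y \<in> poly_seq \<Phi> (Suc (w + n))"
      using filtration_cj[OF fp Dx xy(2)] Dy filtrationD(1)[OF fp] by (simp add: sgrpD)
    have 3: "com (cj (diffq x) y * diffq y) e \<in> poly_seq \<Phi> (Suc (Suc (w + n)))"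
      by (rule filtration_com[OF fp 2 e]) auto
    show ?thesis unfolding E_def
      using filtration_cj[OF fp 1 Dy] 3 De filtrationD(1)[OF fp] by (simp add: sgrpD)
  qed
  moreover have "(diffq ^^ Suc n) (f * g) = (diffq ^^ Suc n) f * (diffq ^^ Suc n) g * E" if ?eq
    using that by (simp only: funpow.simps o_apply eq x_def y_def)
  ultimately have "(diffq ^^ Suc n) (f * g) = (diffq ^^ Suc n) f * (diffq ^^ Suc n) g * E"
    "E \<in> poly_seq \<Phi> (Suc (w + Suc n))" by (blast, simp)
  then show ?case by blast
qed

text \<open>While a sequence vanishes, its differences do too, so the first nontrivial value is its own top difference.\<close>

lemma poly_seq_first_value:
  assumes "F \<in> poly_seq \<Phi> w" "\<And>k. k < q \<Longrightarrow> F k = 1"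
  shows "(diffq ^^ q) F 0 = F q"
proof -
  have gen: "(diffq ^^ j) F i = (if i + j < q then 1 else F q)" if "i + j \<le> q" for j i
    using that
  proof (induction j arbitrary: i)
    case 0
    then show ?case using assms(2) by auto
  next
    case (Suc j)
    then show ?case by (simp add: diffq_apply)
  qed
  show ?thesis using gen[of 0 q] by simp
qed

section \<open>The Hall--Petrescu congruence\<close>

text \<open>Starting from a polynomial sequence with \<open>F 0 = 1\<close>, its values at \<open>1, 2, \<dots>, p - 1\<close> are made trivial one at a time
by splitting off the factor $F(q)^{\binom{k}{q}}$. This does not disturb the \<open>p\<close>-th difference, as \<open>q < p\<close>, and
it changes the value at \<open>p\<close> only by a power of $F(q)^p$, since \<open>p\<close> divides $\binom{p}{q}$; for \<open>q \<ge> 2\<close> that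
power is deep by the assumption on \<open>p\<close>-th powers. In the end \<open>F p\<close> is its own \<open>p\<close>-th difference.\<close>

lemma hall_petrescu_aux:
  assumes fil: "filtration \<Phi>" and v: "v \<ge> 1" and p: "Factorial_Ring.prime p"
    and pow: "\<And>x. x \<in> \<Phi> (v + 2) \<Longrightarrow> x ^ p \<in> \<Phi> (v + p + 1)"
    and F: "F \<in> poly_seq \<Phi> v" and q: "1 \<le> q" "q \<le> p" and F0: "\<And>k. k < q \<Longrightarrow> F k = 1"
  shows "inverse (if q = 1 then F 1 ^ p else 1) * F p * inverse ((diffq ^^ p) F 0) \<in> \<Phi> (v + p + 1)"
  using F q F0
proof (induction "p - q" arbitrary: F q)
  case 0
  then have "q = p" "p \<noteq> 1" using p by (auto simp: prime_nat_iff)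
  then show ?case using 0 poly_seq_first_value[of F \<Phi> v p] filtrationD(1)[OF fil]
    by (auto simp: sgrpD)
next
  case (Suc d)
  note sg = filtrationD(1)[OF fil]
  let ?K = "\<Phi> (v + p + 1)"
  have qp: "q < p" using Suc by auto
  define g where "g = F q"
  define B where "B = (\<lambda>k. inverse g ^ (k choose q))"
  define F' where "F' = B * F"
  have g: "g \<in> \<Phi> (v + q)"
  proof -
    have "(diffq ^^ q) F 0 \<in> \<Phi> (v + q)" using Suc.prems(1) by (auto simp: poly_seq_def)
    then show ?thesis using poly_seq_first_value[OF Suc.prems(1), of q] Suc.prems(4) by (simp add: g_def)
  qed
  have B: "B \<in> poly_seq \<Phi> v"
    unfolding B_def by (rule poly_seq_binomial[OF fil sgrpD(3)[OF sg g]])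
  have F': "F' \<in> poly_seq \<Phi> v"
    unfolding F'_def using B Suc.prems(1) filtrationD(1)[OF filtration_poly_seq[OF fil]] by (simp add: sgrpD)
  have F'0: "F' k = 1" if "k < Suc q" for k
  proof (cases "k = q")
    case True then show ?thesis by (simp add: F'_def B_def g_def)
  next
    case False then show ?thesis using that Suc.prems(4)[of k] by (simp add: F'_def B_def binomial_eq_0)
  qed
  have IH: "F' p * inverse ((diffq ^^ p) F' 0) \<in> ?K"
    using Suc.hyps(1)[OF _ F', of "Suc q"] Suc.hyps(2) F'0 qp Suc.prems(2) by auto
  obtain e where e: "e \<in> poly_seq \<Phi> (Suc (v + p))" and eq: "(diffq ^^ p) F' = (diffq ^^ p) B * (diffq ^^ p) F * e"
    using iter_diffq_mult[OF fil B Suc.prems(1) v, of p] by (auto simp: F'_def)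
  have "(diffq ^^ p) B = (\<lambda>_. 1)" unfolding B_def by (rule iter_diffq_binomial[OF qp])
  then have dF: "(diffq ^^ p) F' 0 = (diffq ^^ p) F 0 * e 0" by (simp add: eq)
  have e0: "e 0 \<in> ?K" using poly_diffq(1)[OF e, of 0] by simp
  have "(F' p * inverse ((diffq ^^ p) F' 0)) * cj (e 0) (inverse ((diffq ^^ p) F 0)) = F' p * inverse ((diffq ^^ p) F 0)"
    by (simp add: dF cj_def mult.assoc)
  moreover have "cj (e 0) (inverse ((diffq ^^ p) F 0)) \<in> ?K"
    using Suc.prems(1) by (intro filtration_cj[OF fil e0 sgrpD(3)[OF sg], of _ "v + p"]) (auto simp: poly_seq_def)
  ultimately have main: "F' p * inverse ((diffq ^^ p) F 0) \<in> ?K"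
    using IH sg by (metis sgrpD(2))
  obtain c where c: "p choose q = p * c"
    using dvd_choose_prime[of q p] p qp Suc.prems(2) by (auto simp: dvd_def)
  have F'p: "F' p = (inverse g ^ p) ^ c * F p" by (simp add: F'_def B_def c power_mult)
  show ?case
  proof (cases "q = 1")
    case True
    then have "c = 1" using c p by (simp add: prime_gt_0_nat)
    then show ?thesis using main True F'p by (simp add: g_def mg_inverse_power)
  next
    case False
    then have "g \<in> \<Phi> (v + 2)" using g filtration_mono[OF fil, of "v + 2" "v + q"] Suc.prems(2) by auto
    then have "(inverse g ^ p) ^ c \<in> ?K"
      using sgrp_power[OF sg pow[OF sgrpD(3)[OF sg]]] by blast
    then have "F p * inverse ((diffq ^^ p) F 0) \<in> ?K"
      using main F'p sgrp_mult_cancel[OF sg, of "(inverse g ^ p) ^ c"] by (simp add: mult.assoc)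
    then show ?thesis using False by simp
  qed
qed

lemma hall_petrescu:
  assumes "filtration \<Phi>" "v \<ge> 1" "Factorial_Ring.prime p"
    and "\<And>x. x \<in> \<Phi> (v + 2) \<Longrightarrow> x ^ p \<in> \<Phi> (v + p + 1)"
    and "F \<in> poly_seq \<Phi> v" "F 0 = 1"
  shows "inverse (F 1 ^ p) * F p * inverse ((diffq ^^ p) F 0) \<in> \<Phi> (v + p + 1)"
  using hall_petrescu_aux[OF assms(1-5), of 1] assms(3,6) prime_gt_0_nat[of p] by auto

section \<open>Powers and iterated commutators\<close>

text \<open>This is the product of the conjugates of \<open>a\<close> by \<open>1, s, \<dots>, s\<^bsup>k-1\<^esup>\<close>, written as a quotient of two \<open>k\<close>-th powers.\<close>

definition twisted_norm :: "'a :: mgroup \<Rightarrow> 'a \<Rightarrow> nat \<Rightarrow> 'a"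
  where "twisted_norm s a k = (a * inverse s) ^ k * s ^ k"

fun iter_com :: "'a :: mgroup \<Rightarrow> 'a \<Rightarrow> nat \<Rightarrow> 'a" where
  "iter_com a s 0 = a"
| "iter_com a s (Suc k) = com (iter_com a s k) s"

lemma twisted_norm_Suc: "twisted_norm s a (Suc k) = twisted_norm s a k * cj a (s ^ k)"
proof -
  have "(a * inverse s) ^ Suc k * s ^ Suc k = (a * inverse s) ^ k * (a * inverse s) * (s * s ^ k)"
    by (simp add: power_commutes)
  also have "\<dots> = (a * inverse s) ^ k * s ^ k * cj a (s ^ k)"
    by (simp add: cj_def mult.assoc)
  finally show ?thesis by (simp add: twisted_norm_def)
qed

lemma diffq_cj_power: "diffq (\<lambda>k. cj a (s ^ k)) = (\<lambda>k. cj (com a s) (s ^ k))"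
proof
  fix k
  have "cj a (s ^ Suc k) = cj (cj a s) (s ^ k)"
    by (simp add: cj_cj)
  also have "\<dots> = cj a (s ^ k) * cj (com a s) (s ^ k)"
    unfolding cj_com[of a s] cj_mult ..
  finally show "diffq (\<lambda>k. cj a (s ^ k)) k = cj (com a s) (s ^ k)"
    by (simp only: diffq_apply mg_left_cancel)
qed

lemma iter_diffq_cj_power: "(diffq ^^ n) (\<lambda>k. cj a (s ^ k)) = (\<lambda>k. cj (iter_com a s n) (s ^ k))"
  by (induction n) (simp_all add: diffq_cj_power)

lemma iter_com_filtration:
  assumes "filtration \<Phi>" "s \<in> \<Phi> d" "a \<in> \<Phi> w"
  shows "iter_com a s n \<in> \<Phi> (w + d * n)"
proof (induction n)
  case (Suc n)
  then show ?case using filtrationD(2)[OF assms(1) Suc assms(2)] by (simp add: algebra_simps)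
qed (use assms in simp)

text \<open>The sequence \<open>k \<mapsto> twisted_norm s a k\<close> has first differences \<open>cj a (s ^ k)\<close>, and the further differences are
conjugates of the iterated commutators of \<open>a\<close> with \<open>s\<close>. So it is polynomial and the Hall--Petrescu congruence
applies to it.\<close>

lemma twisted_norm_cong:
  assumes fil: "filtration \<Phi>" and s: "s \<in> \<Phi> 1" and a: "a \<in> \<Phi> w" and w: "w \<ge> 2" and p: "Factorial_Ring.prime p"
    and pow: "\<And>x. x \<in> \<Phi> (Suc w) \<Longrightarrow> x ^ p \<in> \<Phi> (w + p)"
  shows "inverse (a ^ p) * twisted_norm s a p * inverse (iter_com a s (p - 1)) \<in> \<Phi> (w + p)"
proof -
  obtain v where v: "w = Suc v" "v \<ge> 1" using w by (cases w) auto
  define F where "F = twisted_norm s a"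
  have DF: "diffq F = (\<lambda>k. cj a (s ^ k))"
    by (auto simp: fun_eq_iff diffq_apply F_def twisted_norm_Suc)
  note sg = filtrationD(1)[OF fil]
  have sk: "s ^ k \<in> \<Phi> 1" for k using s sg by (simp add: sgrp_power)
  have f: "(\<lambda>k. cj a (s ^ k)) \<in> poly_seq \<Phi> w"
    using iter_com_filtration[OF fil s a] filtration_cj[OF fil _ sk]
    by (auto simp: poly_seq_def iter_diffq_cj_power)
  have Fv: "F k \<in> \<Phi> w" for k
    by (induction k) (use a sg filtration_cj[OF fil a sk] in \<open>auto simp: F_def twisted_norm_Suc sgrpD twisted_norm_def[of _ _ 0]\<close>)
  then have "F k \<in> \<Phi> v" for k using filtration_mono[OF fil, of v w] v by auto
  then have F: "F \<in> poly_seq \<Phi> v" by (rule poly_seqI) (use f DF v in simp)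
  have F1: "F 1 = a" "F 0 = 1" by (simp_all add: F_def twisted_norm_def mult.assoc)
  have "(diffq ^^ p) F 0 = (diffq ^^ (p - 1)) (diffq F) 0"
    using prime_gt_0_nat[OF p] by (cases p) (simp_all add: funpow_swap1)
  also have "\<dots> = iter_com a s (p - 1)" by (simp add: DF iter_diffq_cj_power)
  finally have "inverse (F 1 ^ p) * F p * inverse (iter_com a s (p - 1)) \<in> \<Phi> (v + p + 1)"
    using hall_petrescu[OF fil v(2) p _ F F1(2)] pow v by simp
  then show ?thesis using v F1 by (simp add: F_def)
qed

text \<open>If all twisted norms lie in the last term \<open>Q\<close>, the congruence for twisted norms expresses \<open>a\<^sup>p\<close> through the
iterated commutator. The hypothesis on \<open>p\<close>-th powers in that congruence is supplied by induction, starting at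
the bottom of the filtration.\<close>

lemma power_iter_com:
  assumes fil: "filtration \<Phi>" and s: "s \<in> \<Phi> 1" and p: "Factorial_Ring.prime p"
    and bot: "\<And>w. w \<ge> W \<Longrightarrow> \<Phi> w = Q"
    and nrm: "\<And>a. a \<in> \<Phi> 2 \<Longrightarrow> twisted_norm s a p \<in> Q"
    and a: "a \<in> \<Phi> w" and w: "w \<ge> 2"
  shows "a ^ p * iter_com a s (p - 1) \<in> \<Phi> (w + p)" "a ^ p \<in> \<Phi> (w + p - 1)"
proof -
  note sg = filtrationD(1)[OF fil]
  have Q: "Q \<subseteq> \<Phi> w" for w
    using bot[of "max w W"] filtration_mono[OF fil, of w "max w W"] by auto
  have main: "a ^ p \<in> \<Phi> (w + p - 1) \<and> a ^ p * iter_com a s (p - 1) \<in> \<Phi> (w + p)" if "a \<in> \<Phi> w" "w \<ge> 2" for a w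
    using that
  proof (induction "W - w" arbitrary: a w rule: less_induct)
    case less
    have pow: "x ^ p \<in> \<Phi> (w + p)" if "x \<in> \<Phi> (Suc w)" for x
    proof (cases "w < W")
      case True
      then show ?thesis using less.hyps[of "Suc w" x] that less.prems by auto
    next
      case False
      then show ?thesis using that bot[of "Suc w"] bot[of "w + p"] sg by (metis le_add1 le_SucI linorder_not_less sgrp_power trans_le_add1)
    qed
    have ic: "iter_com a s (p - 1) \<in> \<Phi> (w + p - 1)"
      using iter_com_filtration[OF fil s less.prems(1), of "p - 1"] prime_gt_0_nat[OF p] by simp
    have sub: "\<Phi> (w + p) \<subseteq> \<Phi> (w + p - 1)" by (rule filtration_mono[OF fil]) auto
    define u where "u = twisted_norm s a p"
    have u: "u \<in> \<Phi> (w + p)"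
      using nrm[of a] less.prems Q filtration_mono[OF fil, of 2 w] by (auto simp: u_def)
    have *: "inverse (a ^ p) * u * inverse (iter_com a s (p - 1)) \<in> \<Phi> (w + p)"
      unfolding u_def by (rule twisted_norm_cong[OF fil s less.prems p pow])
    have "cj (inverse (inverse (a ^ p) * u * inverse (iter_com a s (p - 1)))) (inverse (a ^ p)) =
        a ^ p * iter_com a s (p - 1) * inverse u"
      by (simp add: cj_def mult.assoc)
    moreover have "cj (inverse (inverse (a ^ p) * u * inverse (iter_com a s (p - 1)))) (inverse (a ^ p)) \<in> \<Phi> (w + p)"
      by (rule filtration_cj[OF fil sgrpD(3)[OF sg *] sgrpD(3)[OF sg sgrp_power[OF sg less.prems(1)]]])
    ultimately have "a ^ p * iter_com a s (p - 1) * inverse u \<in> \<Phi> (w + p)" by simp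
    then have 1: "a ^ p * iter_com a s (p - 1) \<in> \<Phi> (w + p)"
      using sgrp_mult_cancel(2)[OF sg, of "inverse u"] u sgrpD(3)[OF sg] by auto
    then have "a ^ p \<in> \<Phi> (w + p - 1)"
      using sgrp_mult_cancel(2)[OF sg ic, of "a ^ p"] sub by auto
    with 1 show ?case by blast
  qed
  show "a ^ p * iter_com a s (p - 1) \<in> \<Phi> (w + p)" "a ^ p \<in> \<Phi> (w + p - 1)"
    using main[OF a w] by auto
qed

section \<open>Finite subgroups\<close>

lemma sgrp_Int: "sgrp H \<Longrightarrow> sgrp K \<Longrightarrow> sgrp (H \<inter> K)"
  by (simp add: sgrp_def)

lemma sgrp_card_dvd:
  fixes H K :: "'a :: mgroup set"
  assumes "sgrp H" "sgrp K" "H \<subseteq> K" "finite K"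
  shows "card H dvd card K"
proof -
  define M :: "'a monoid" where "M = \<lparr>carrier = K, monoid.mult = (*), one = 1\<rparr>"
  interpret M: group M
  proof (rule groupI)
    fix x assume "x \<in> carrier M"
    then show "\<exists>y\<in>carrier M. y \<otimes>\<^bsub>M\<^esub> x = \<one>\<^bsub>M\<^esub>"
      using assms by (intro bexI[of _ "inverse x"]) (auto simp: M_def sgrpD)
  qed (use assms in \<open>auto simp: M_def sgrpD mult.assoc\<close>)
  have inv: "inv\<^bsub>M\<^esub> x = inverse x" if "x \<in> K" for x
    by (rule M.inv_equality) (use that assms in \<open>auto simp: M_def sgrpD\<close>)
  have "subgroup H M"
    using assms inv by unfold_locales (auto simp: M_def sgrpD inv[unfolded M_def])
  then have "card (rcosets\<^bsub>M\<^esub> H) * card H = order M"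
    by (rule M.lagrange)
  then show ?thesis by (simp add: M_def order_def) (metis dvd_triv_right)
qed

text \<open>Left multiplication by an element is injective, hence a permutation of the finite set; this produces inverses.\<close>

lemma sgrp_of_finite_closed:
  fixes S :: "'a :: mgroup set"
  assumes "finite S" "S \<noteq> {}" "\<And>x y. x \<in> S \<Longrightarrow> y \<in> S \<Longrightarrow> x * y \<in> S"
  shows "sgrp S"
proof -
  have surj: "\<exists>y\<in>S. z = x * y" if "x \<in> S" "z \<in> S" for x z
  proof -
    have "inj_on ((*) x) S" by (auto simp: inj_on_def)
    then have "(*) x ` S = S" using assms that by (intro endo_inj_surj) auto
    then show ?thesis using that by (metis imageE)
  qed
  have one: "1 \<in> S"
  proof -
    obtain x where x: "x \<in> S" using assms(2) by auto
    then obtain y where "y \<in> S" "x = x * y" using surj by blast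
    then show ?thesis by (metis mg_left_mult_cancel mult.right_neutral)
  qed
  have "inverse x \<in> S" if "x \<in> S" for x
    using surj[OF that one] mg_inverse_unique by metis
  then show ?thesis using one assms(3) by (auto simp: sgrp_def)
qed

definition normalised :: "'a :: mgroup set \<Rightarrow> 'a set \<Rightarrow> bool"
  where "normalised G K \<longleftrightarrow> (\<forall>u\<in>K. \<forall>v\<in>G. cj u v \<in> K)"

lemma normalisedD: "normalised G K \<Longrightarrow> u \<in> K \<Longrightarrow> v \<in> G \<Longrightarrow> cj u v \<in> K"
  by (simp add: normalised_def)

lemma hall_witt:
  "cj (com (com x (inverse y)) z) y * cj (com (com y (inverse z)) x) z * cj (com (com z (inverse x)) y) x = (1 :: 'a :: mgroup)"
  by (simp add: cj_def com_def mult.assoc)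

text \<open>By the Hall--Witt identity the product of three conjugates of such commutators is trivial, so if two of them lie in
a normal subgroup, then so does the third.\<close>

lemma three_subgroup:
  assumes K: "sgrp K" and nrm: "normalised G K" and G: "sgrp G"
    and xyz: "x \<in> G" "g \<in> G" "y \<in> G"
    and "com (com (inverse g) (inverse y)) x \<in> K" "com (com y (inverse x)) (inverse g) \<in> K"
  shows "com (com x g) y \<in> K"
proof -
  define A where "A = cj (com (com x g) y) (inverse g)"
  define B where "B = cj (com (com (inverse g) (inverse y)) x) y"
  define C where "C = cj (com (com y (inverse x)) (inverse g)) x"
  have "A * (B * C) = 1" using hall_witt[of x "inverse g" y] by (simp add: A_def B_def C_def mult.assoc)
  moreover have "B * C \<in> K" using assms by (simp add: B_def C_def sgrpD normalisedD)
  ultimately have "A \<in> K" by (metis K sgrpD(1) sgrp_mult_cancel(2))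
  then have "cj A g \<in> K" using normalisedD[OF nrm] xyz by blast
  then show ?thesis by (simp add: A_def cj_cj)
qed

text \<open>When \<open>K\<close> is normal, this is the centraliser in \<open>G\<close> of the image of \<open>Y\<close> modulo \<open>K\<close>.\<close>

definition rel_centraliser :: "'a :: mgroup set \<Rightarrow> 'a set \<Rightarrow> 'a set \<Rightarrow> 'a set"
  where "rel_centraliser G K Y = {g \<in> G. \<forall>x\<in>Y. com x g \<in> K}"

lemma sgrp_rel_centraliser:
  assumes K: "sgrp K" and nrm: "normalised G K" and G: "sgrp G"
  shows "sgrp (rel_centraliser G K Y)"
  unfolding sgrp_def
proof (intro conjI ballI)
  show "1 \<in> rel_centraliser G K Y" using K G by (simp add: rel_centraliser_def sgrpD)
  show "x * y \<in> rel_centraliser G K Y" if "x \<in> rel_centraliser G K Y" "y \<in> rel_centraliser G K Y" for x y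
    using that assms by (auto simp: rel_centraliser_def com_mult_right sgrpD normalisedD)
  show "inverse x \<in> rel_centraliser G K Y" if "x \<in> rel_centraliser G K Y" for x
  proof -
    have "com u (inverse x) = cj (inverse (com u x)) (inverse x)" for u
      by (simp add: com_def cj_def mult.assoc)
    then show ?thesis using that assms by (auto simp: rel_centraliser_def sgrpD normalisedD)
  qed
qed

section \<open>Groups of maximal class\<close>

text \<open>The series \<open>L\<close> is the lower central series in the customary numbering, where \<open>L 2\<close> is the derived subgroup and
\<open>L 1\<close> is the whole group; \<open>L 0\<close> is set to \<open>G\<close> so that it is a filtration with weights starting at 0.
\<open>L (Suc j)\<close> is described as the least subgroup containing the commutators. The last two assumptions say that
the nilpotency class is \<open>n - 1\<close>.\<close>

locale max_class =
  fixes G :: "'a :: mgroup set" and p n :: nat and L :: "nat \<Rightarrow> 'a set"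
  assumes p: "Factorial_Ring.prime p" and finG: "finite G" and sgrpG: "sgrp G"
    and cardG: "card G = p ^ n" and L0: "L 0 = G" and L1: "L 1 = G"
    and sgrpL: "\<And>j. sgrp (L j)" and LSuc: "\<And>j. L (Suc j) \<subseteq> L j"
    and comL: "\<And>x g j. j \<ge> 1 \<Longrightarrow> x \<in> L j \<Longrightarrow> g \<in> G \<Longrightarrow> com x g \<in> L (Suc j)"
    and leastL: "\<And>K j. j \<ge> 1 \<Longrightarrow> sgrp K \<Longrightarrow> (\<And>x g. x \<in> L j \<Longrightarrow> g \<in> G \<Longrightarrow> com x g \<in> K) \<Longrightarrow> L (Suc j) \<subseteq> K"
    and n: "n \<ge> 3" and Ln: "L n = {1}" and Ln1: "L (n - 1) \<noteq> {1}"
begin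

lemma Lmono: "i \<le> j \<Longrightarrow> L j \<subseteq> L i"
proof (induction j rule: dec_induct)
  case (step j)
  then show ?case using LSuc[of j] by blast
qed simp

lemma LG: "L j \<subseteq> G"
  using Lmono[of 0 j] L0 by simp

lemma LinG: "x \<in> L j \<Longrightarrow> x \<in> G"
  using LG by blast

lemma finL: "finite (L j)"
  using LG finG finite_subset by blast

lemma Lnormal: "x \<in> L j \<Longrightarrow> g \<in> G \<Longrightarrow> cj x g \<in> L j"
proof (cases j)
  case 0
  then show "x \<in> L j \<Longrightarrow> g \<in> G \<Longrightarrow> cj x g \<in> L j" using L0 sgrpG sgrp_cj by auto
next
  case (Suc i)
  then show "x \<in> L j \<Longrightarrow> g \<in> G \<Longrightarrow> cj x g \<in> L j"
    using comL[of j x g] LSuc[of j] by (auto simp: cj_com intro: sgrpD(2)[OF sgrpL])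
qed

lemma normalisedL: "normalised G (L j)"
  by (simp add: normalised_def Lnormal)

lemma comL': "x \<in> L j \<Longrightarrow> g \<in> G \<Longrightarrow> j \<ge> 1 \<Longrightarrow> k \<le> Suc j \<Longrightarrow> com x g \<in> L k"
  using comL[of j x g] Lmono[of k "Suc j"] by auto

lemma p2: "p \<ge> 2" using p prime_ge_2_nat by blast

lemma L_strict: assumes "1 \<le> j" "j < n" shows "L (Suc j) \<noteq> L j"
proof
  assume eq: "L (Suc j) = L j"
  have "L k = L j" if "j \<le> k" for k
    using that
  proof (induction k rule: dec_induct)
    case (step k)
    have "L (Suc j) \<subseteq> L (Suc k)"
      using assms step by (intro leastL sgrpL) (auto intro: comL)
    then show ?case using eq LSuc[of k] step by auto
  qed simp
  from this[of n] this[of "n - 1"] show False using Ln Ln1 assms by auto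
qed

lemma card_sgrp:
  assumes "sgrp H" "H \<subseteq> G"
  obtains i where "i \<le> n" "card H = p ^ i"
  using sgrp_card_dvd[OF assms(1) sgrpG assms(2) finG] cardG p divides_primepow_nat by metis

lemma card_proper:
  assumes "sgrp H" "sgrp K" "H \<subset> K" "K \<subseteq> G" "card K = p ^ Suc i"
  shows "card H \<le> p ^ i"
proof -
  have "H \<subseteq> G" using assms by auto
  then obtain j where j: "card H = p ^ j" using card_sgrp[OF assms(1)] by metis
  have "card H < card K" using assms finG finite_subset psubset_card_mono by metis
  then have lt: "p ^ j < p ^ Suc i" using j assms by metis
  have "j < Suc i" by (rule power_less_imp_less_exp[OF _ lt]) (use p2 in simp)
  then show ?thesis using j p2 by (simp add: power_increasing)
qed

text \<open>The cosets \<open>a ^ i * H\<close> form a subgroup strictly above \<open>H\<close>, and there is no room between \<open>H\<close> and \<open>K\<close> as the index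
is prime.\<close>

lemma cyclic_quotient:
  assumes H: "sgrp H" and K: "sgrp K" "K \<subseteq> G" and HK: "H \<subseteq> K" and c: "card K = p * card H"
    and a: "a \<in> K" "a \<notin> H" and nrm: "\<And>h. h \<in> H \<Longrightarrow> cj h a \<in> H" and y: "y \<in> K"
  obtains i h where "h \<in> H" "y = a ^ i * h"
proof -
  define S where "S = {a ^ i * h | i h. h \<in> H}"
  have nrm': "cj h (a ^ i) \<in> H" if "h \<in> H" for h i
    using that
  proof (induction i arbitrary: h)
    case (Suc i)
    then show ?case using nrm by (simp flip: cj_cj)
  qed simp
  have SK: "S \<subseteq> K" using a HK K(1) by (auto simp: S_def intro!: sgrpD(2) sgrp_power)
  have finK: "finite K" using K finG finite_subset by blast
  have S: "sgrp S"
  proof (rule sgrp_of_finite_closed)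
    show "finite S" using SK finK finite_subset by blast
    show "S \<noteq> {}" using sgrpD(1)[OF H] by (auto simp: S_def)
    fix x y assume "x \<in> S" "y \<in> S"
    then obtain i h j k where *: "x = a ^ i * h" "y = a ^ j * k" "h \<in> H" "k \<in> H" by (auto simp: S_def)
    then have "x * y = a ^ (i + j) * (cj h (a ^ j) * k)"
      by (simp add: power_add cj_def mult.assoc)
    then show "x * y \<in> S" using nrm'[OF *(3)] * H unfolding S_def by (blast intro: sgrpD(2))
  qed
  have HS: "H \<subseteq> S" unfolding S_def by (auto intro!: exI[of _ 0])
  have aS: "a \<in> S" unfolding S_def using sgrpD(1)[OF H] by (auto intro!: exI[of _ 1])
  have "card H dvd card S" by (rule sgrp_card_dvd) (use H S HS SK finK finite_subset in auto)
  then obtain m where m: "card S = card H * m" by (auto simp: dvd_def)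
  have "card S dvd card K" by (rule sgrp_card_dvd) (use K S SK finK in auto)
  then have mp: "m dvd p" using m c
    by (metis H HK card_gt_0_iff dvd_mult_cancel1 empty_iff finK finite_subset mult.commute nat_mult_dvd_cancel_disj neq0_conv sgrpD(1))
  have "card H < card S" using HS aS a by (intro psubset_card_mono) (use SK finK finite_subset in auto)
  then have "m \<noteq> 1" using m by auto
  then have "m = p" using mp p by (metis prime_nat_iff)
  then have "card S = card K" using m c by (simp add: mult.commute)
  then have "S = K" using SK finK by (simp add: card_subset_eq)
  then show ?thesis using y that by (auto simp: S_def)
qed

lemma comG_bilinear:
  assumes K: "sgrp K" "normalised G K"
    and "x \<in> G" "y \<in> G" "z \<in> G"
  shows "com x z \<in> K \<Longrightarrow> com y z \<in> K \<Longrightarrow> com (x * y) z \<in> K"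
    and "com x y \<in> K \<Longrightarrow> com x z \<in> K \<Longrightarrow> com x (y * z) \<in> K"
    and "com x z \<in> K \<Longrightarrow> com (x ^ i) z \<in> K"
    and "com x z \<in> K \<Longrightarrow> com x (z ^ i) \<in> K"
proof -
  have 1: "com (x * y) z \<in> K" if "com x z \<in> K" "com y z \<in> K" "x \<in> G" "y \<in> G" "z \<in> G" for x y z
    using that K unfolding com_mult_left by (intro sgrpD(2)) (auto intro: normalisedD)
  have 2: "com x (y * z) \<in> K" if "com x y \<in> K" "com x z \<in> K" "x \<in> G" "y \<in> G" "z \<in> G" for x y z
    using that K unfolding com_mult_right by (intro sgrpD(2)) (auto intro: normalisedD)
  show "com x z \<in> K \<Longrightarrow> com y z \<in> K \<Longrightarrow> com (x * y) z \<in> K"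
    "com x y \<in> K \<Longrightarrow> com x z \<in> K \<Longrightarrow> com x (y * z) \<in> K" using 1 2 assms by auto
  show "com x z \<in> K \<Longrightarrow> com (x ^ i) z \<in> K"
    by (induction i) (use assms sgrpG in \<open>auto intro!: 1 sgrp_power simp: sgrpD\<close>)
  show "com x z \<in> K \<Longrightarrow> com x (z ^ i) \<in> K"
    by (induction i) (use assms sgrpG in \<open>auto intro!: 2 sgrp_power simp: sgrpD\<close>)
qed

text \<open>All \<open>n - 2\<close> factors \<open>L j / L (Suc j)\<close> with \<open>2 \<le> j\<close> are nontrivial, so it suffices that \<open>G / L 2\<close> has order at
least \<open>p\<^sup>2\<close>. If it had order \<open>p\<close>, then \<open>G\<close> would be cyclic modulo \<open>L 2\<close> and all commutators would lie in \<open>L 3\<close>.\<close>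

lemma card_L: "2 \<le> j \<Longrightarrow> j \<le> n \<Longrightarrow> card (L j) = p ^ (n - j)"
proof -
  have "\<exists>e. card (L j) = p ^ e" for j using card_sgrp[OF sgrpL LG] by metis
  then obtain e where e: "card (L j) = p ^ e j" for j by metis
  have estep: "e (Suc j) < e j" if "1 \<le> j" "j < n" for j
  proof -
    have "card (L (Suc j)) < card (L j)"
      using L_strict[OF that] LSuc[of j] by (intro psubset_card_mono finL) auto
    then show ?thesis using p2 by (simp add: e)
  qed
  have e1: "e 1 = n" using e[of 1] cardG L1 p2 by (metis Suc_1 Suc_le_lessD power_inject_exp)
  have e2: "e 2 \<noteq> n - 1"
  proof
    assume "e 2 = n - 1"
    then have c: "card G = p * card (L 2)" using e cardG n by (simp flip: power_Suc)
    have "L 2 \<noteq> G" using L_strict[of 1] n L1 by (simp add: numeral_2_eq_2)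
    then obtain a where a: "a \<in> G" "a \<notin> L 2" using LG by blast
    have L3: "sgrp (L 3)" "normalised G (L 3)" using sgrpL normalisedL by auto
    have "com x g \<in> L 3" if xg: "x \<in> G" "g \<in> G" for x g
    proof -
      obtain i h where h: "h \<in> L 2" "x = a ^ i * h"
        using cyclic_quotient[OF sgrpL sgrpG order.refl LG c a Lnormal[OF _ a(1)] xg(1)] by blast
      obtain j k where k: "k \<in> L 2" "g = a ^ j * k"
        using cyclic_quotient[OF sgrpL sgrpG order.refl LG c a Lnormal[OF _ a(1)] xg(2)] by blast
      have ai: "a ^ i \<in> G" "a ^ j \<in> G" using a sgrpG sgrp_power by auto
      have hk: "h \<in> G" "k \<in> G" using h k LinG by auto
      have 1: "com h g \<in> L 3" using comL[of 2 h g] h xg by (simp add: numeral_3_eq_3)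
      have "com k (a ^ i) \<in> L 3" using comL[of 2 k "a ^ i"] k ai by (simp add: numeral_3_eq_3)
      then have 2: "com (a ^ i) k \<in> L 3" using sgrp_com_swap[OF L3(1)] by blast
      have "com (a ^ i) (a ^ j) = 1" by (simp add: com_eq_1_iff flip: power_add add: add.commute)
      then have 3: "com (a ^ i) (a ^ j) \<in> L 3" using sgrpD(1)[OF L3(1)] by simp
      have "com (a ^ i) g \<in> L 3" unfolding k(2) by (rule comG_bilinear(2)[OF L3 ai hk(2) 3 2])
      then show ?thesis unfolding h(2) by (rule comG_bilinear(1)[OF L3 ai(1) hk(1) xg(2) _ 1])
    qed
    then have "L (Suc 1) \<subseteq> L 3" using L1 by (intro leastL L3) auto
    moreover have "L 3 \<subseteq> L 2" by (rule Lmono) simp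
    ultimately show False using L_strict[of 2] n by (simp add: numeral_2_eq_2 numeral_3_eq_3)
  qed
  have up: "e (2 + i) + i \<le> e 2" if "2 + i \<le> n" for i using that
  proof (induction i)
    case (Suc i)
    then show ?case using estep[of "2 + i"] by simp
  qed simp
  have low: "n - j \<le> e j" if "1 \<le> j" "j \<le> n" for j using that
  proof (induction "n - j" arbitrary: j)
    case (Suc d)
    have "n - Suc j \<le> e (Suc j)" by (rule Suc.hyps(1)) (use Suc in auto)
    moreover have "j < n" using Suc.hyps(2) by simp
    ultimately show ?case using estep[of j] Suc.prems by linarith
  qed simp
  assume j: "2 \<le> j" "j \<le> n"
  then have "e j + (j - 2) \<le> e 2" using up[of "j - 2"] by (simp del: add_2_eq_Suc)
  moreover have "e 2 \<le> n - 2" using e1 e2 estep[of 1] n by (simp add: numeral_2_eq_2)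
  ultimately have "e j = n - j" using low[of j] j n by linarith
  then show ?thesis by (simp add: e)
qed

lemma L_neq: "1 \<le> j \<Longrightarrow> j < n \<Longrightarrow> L (Suc j) \<subset> L j"
  using L_strict LSuc by blast

lemma layer_generator:
  assumes "2 \<le> j" "j < n" "a \<in> L j" "a \<notin> L (Suc j)" "y \<in> L j"
  obtains i h where "h \<in> L (Suc j)" "y = a ^ i * h"
proof -
  have c: "card (L j) = p * card (L (Suc j))" using assms by (simp add: card_L Suc_diff_Suc flip: power_Suc)
  have "cj h a \<in> L (Suc j)" if "h \<in> L (Suc j)" for h using that assms LinG Lnormal by blast
  from cyclic_quotient[OF sgrpL sgrpL LG LSuc c assms(3,4) this assms(5)] that show ?thesis by blast
qed

text \<open>Induction with the three subgroup lemma.\<close>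

lemma com_LL: "x \<in> L a \<Longrightarrow> y \<in> L b \<Longrightarrow> com x y \<in> L (a + b)"
proof (induction a arbitrary: x y b)
  case 0
  then have "com y x \<in> L b" using Lnormal[of y b x] L0 sgrp_cj_iff[OF sgrpL, of y b x] by auto
  then show ?case using sgrp_com_swap[OF sgrpL] by auto
next
  case (Suc a)
  show ?case
  proof (cases "a = 0 \<or> b = 0")
    case True
    then show ?thesis
    proof
      assume "b = 0"
      then show ?thesis using Suc.prems Lnormal[of x "Suc a" y] L0 sgrp_cj_iff[OF sgrpL, of x "Suc a" y] by auto
    next
      assume "a = 0"
      then have "com y x \<in> L (Suc b)" if "b \<ge> 1" using comL[OF that Suc.prems(2)] Suc.prems(1) L1 by auto
      moreover have "com y x \<in> L 1" if "b = 0" using that L0 L1 Suc.prems LinG sgrpG sgrp_com by (metis)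
      ultimately have "com y x \<in> L (Suc b)" by (cases "b = 0") auto
      then show ?thesis using sgrp_com_swap[OF sgrpL] \<open>a = 0\<close> by auto
    qed
  next
    case False
    let ?K = "L (Suc a + b)"
    have nrm: "normalised G ?K" by (rule normalisedL)
    have "L (Suc a) \<subseteq> rel_centraliser G ?K (L b)"
    proof (rule leastL)
      show "sgrp (rel_centraliser G ?K (L b))" by (rule sgrp_rel_centraliser[OF sgrpL nrm sgrpG])
      fix x g assume x: "x \<in> L a" and g: "g \<in> G"
      show "com x g \<in> rel_centraliser G ?K (L b)"
        unfolding rel_centraliser_def
      proof (intro CollectI conjI ballI)
        show "com x g \<in> G" using x g LinG sgrpG sgrp_com by blast
        fix y assume y: "y \<in> L b"
        have "com (com x g) y \<in> ?K"
        proof (rule three_subgroup[OF sgrpL nrm sgrpG])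
          show "x \<in> G" "g \<in> G" "y \<in> G" using x y g LinG by auto
          have "com (inverse y) (inverse g) \<in> L (Suc b)"
            using y g False sgrpG by (intro comL sgrpD(3)[OF sgrpL] sgrpD(3)) auto
          then have "com (inverse g) (inverse y) \<in> L (Suc b)"
            using sgrp_com_swap[OF sgrpL] by blast
          from Suc.IH[OF x this] show "com (com (inverse g) (inverse y)) x \<in> ?K"
            using sgrp_com_swap[OF sgrpL] by auto
          have "com (inverse x) y \<in> L (a + b)" using Suc.IH[OF sgrpD(3)[OF sgrpL x] y] .
          then have "com y (inverse x) \<in> L (a + b)" using sgrp_com_swap[OF sgrpL] by blast
          then show "com (com y (inverse x)) (inverse g) \<in> ?K"
            using comL[of "a + b" "com y (inverse x)" "inverse g"] False g sgrpD(3)[OF sgrpG] by auto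
        qed
        then show "com y (com x g) \<in> ?K" using sgrp_com_swap[OF sgrpL] by blast
      qed
    qed (use False in auto)
    then have "com y x \<in> ?K" using Suc.prems by (auto simp: rel_centraliser_def)
    then show ?thesis using sgrp_com_swap[OF sgrpL] by blast
  qed
qed

lemma com_LL': "x \<in> L a \<Longrightarrow> y \<in> L b \<Longrightarrow> k \<le> a + b \<Longrightarrow> com x y \<in> L k"
  using com_LL Lmono by blast

lemma filtration_L_trunc: "filtration (\<lambda>w. L (min w q))"
  unfolding filtration_def
proof (intro conjI allI ballI sgrpL)
  show "L (min (Suc w) q) \<subseteq> L (min w q)" for w by (rule Lmono) auto
  show "com x y \<in> L (min (w + v) q)" if "x \<in> L (min w q)" "y \<in> L (min v q)" for w v x y
    by (rule com_LL'[OF that]) auto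
qed

section \<open>Two-step centralisers\<close>

text \<open>The two-step centraliser of the layers \<open>j\<close> and \<open>j + 1\<close>, that is, $C_G(L_j/L_{j+2})$. For \<open>2 \<le> j \<le> n - 2\<close> it is a
maximal subgroup of \<open>G\<close> (\<open>card_cz\<close>), and it contains \<open>L 2\<close>.\<close>

definition cz :: "nat \<Rightarrow> 'a set"
  where "cz j = rel_centraliser G (L (j + 2)) (L j)"

lemma sgrp_cz: "sgrp (cz j)"
  unfolding cz_def by (rule sgrp_rel_centraliser[OF sgrpL normalisedL sgrpG])

lemma cz_G: "cz j \<subseteq> G" by (auto simp: cz_def rel_centraliser_def)

lemma czI: "g \<in> G \<Longrightarrow> (\<And>x. x \<in> L j \<Longrightarrow> com x g \<in> L (j + 2)) \<Longrightarrow> g \<in> cz j"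
  by (auto simp: cz_def rel_centraliser_def)

lemma czD: "g \<in> cz j \<Longrightarrow> x \<in> L j \<Longrightarrow> com x g \<in> L (j + 2)"
  by (auto simp: cz_def rel_centraliser_def)

lemma L2_cz: "L 2 \<subseteq> cz j"
  using com_LL LinG by (auto intro!: czI)

lemma czI1:
  assumes "g \<in> G" "2 \<le> j" "j < n" "b \<in> L j" "b \<notin> L (Suc j)" "com b g \<in> L (j + 2)"
  shows "g \<in> cz j"
proof (rule czI)
  fix x assume "x \<in> L j"
  then obtain i h where h: "h \<in> L (Suc j)" "x = b ^ i * h" using layer_generator assms by metis
  have bi: "com (b ^ i) g \<in> L (j + 2)"
    using assms LinG by (intro comG_bilinear(3)[OF sgrpL normalisedL, of b g g]) auto
  have "com h g \<in> L (j + 2)" using comL[of "Suc j" h g] h assms by auto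
  then show "com x g \<in> L (j + 2)"
    unfolding h(2) using bi assms h LinG sgrp_power[OF sgrpG]
    by (intro comG_bilinear(1)[OF sgrpL normalisedL]) auto
qed (use assms in auto)

lemma cz_proper: assumes "2 \<le> j" "j + 2 \<le> n" shows "cz j \<subset> G"
proof -
  have "cz j \<noteq> G"
  proof
    assume eq: "cz j = G"
    have "L (Suc j) \<subseteq> L (j + 2)"
      using assms czD[of _ j] by (intro leastL sgrpL) (simp_all add: eq)
    then show False using L_neq[of "Suc j"] assms by auto
  qed
  then show ?thesis using cz_G by blast
qed

text \<open>The reason for calling an element uniserial when it avoids the two-step centralisers: commutation with it maps each layer onto
the next one.\<close>

lemma uniserial:
  assumes "s \<in> G" "s \<notin> cz j" "2 \<le> j" "j < n" "x \<in> L j" "x \<notin> L (Suc j)"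
  shows "com x s \<in> L (Suc j)" "com x s \<notin> L (Suc (Suc j))"
  using comL[of j x s] czI1[of s j x] assms by auto

lemma iter_com_level:
  assumes "s \<in> G" "2 \<le> i" "x \<in> L i" "x \<notin> L (Suc i)" "i + k \<le> n" "\<And>j. i \<le> j \<Longrightarrow> j < i + k \<Longrightarrow> s \<notin> cz j"
  shows "iter_com x s k \<in> L (i + k) \<and> iter_com x s k \<notin> L (Suc (i + k))"
  using assms(5,6)
proof (induction k)
  case (Suc k)
  then show ?case using uniserial[OF assms(1), of "i + k" "iter_com x s k"] assms(2) by auto
qed (use assms in auto)

text \<open>Counting the nonidentity elements of \<open>p\<close> proper subgroups gives at most \<open>p (p\<^bsup>n-1\<^esup> - 1) < p\<^sup>n - 1\<close>.\<close>

lemma avoid_subgroups: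
  assumes "finite \<H>" "card \<H> \<le> p" "\<And>H. H \<in> \<H> \<Longrightarrow> sgrp H \<and> H \<subset> G"
  obtains s where "s \<in> G" "\<And>H. H \<in> \<H> \<Longrightarrow> s \<notin> H"
proof -
  obtain m where m: "n = Suc m" using n by (cases n) auto
  have c: "card (H - {1}) \<le> p ^ m - 1" if "H \<in> \<H>" for H
    using card_proper[of H G m] assms(3)[OF that] sgrpG cardG m sgrpD(1)[of H] finG finite_subset[of H G]
    by (auto simp: card_Diff_singleton)
  have "card (\<Union>H\<in>\<H>. H - {1}) \<le> (\<Sum>H\<in>\<H>. card (H - {1}))" by (rule card_UN_le[OF assms(1)])
  also have "\<dots> \<le> (\<Sum>H\<in>\<H>. p ^ m - 1)" by (rule sum_mono[OF c])
  also have "\<dots> \<le> p * (p ^ m - 1)" using assms(2) by simp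
  also have "\<dots> < p ^ n - 1"
  proof -
    have "p * (p ^ m - 1) = p ^ n - p" by (simp add: m diff_mult_distrib2)
    moreover have "p \<le> p ^ n" using self_le_power[of p n] p2 n by simp
    ultimately show ?thesis using p2 by linarith
  qed
  also have "\<dots> = card (G - {1})" using cardG sgrpD(1)[OF sgrpG] finG by (simp add: card_Diff_singleton)
  finally have "\<not> G - {1} \<subseteq> (\<Union>H\<in>\<H>. H - {1})"
    using card_mono[of "\<Union>H\<in>\<H>. H - {1}" "G - {1}"] assms finG finite_subset
    by (metis (no_types, lifting) finite_Diff finite_UN_I leD psubset_imp_subset)
  then show ?thesis using that by blast
qed

end

lemma sgrp_pow_card:
  fixes K :: "'a :: mgroup set"
  assumes "sgrp K" "finite K" "x \<in> K"
  shows "x ^ card K = 1"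
proof -
  define M :: "'a monoid" where "M = \<lparr>carrier = K, monoid.mult = (*), one = 1\<rparr>"
  interpret M: group M
  proof (rule groupI)
    fix x assume "x \<in> carrier M"
    then show "\<exists>y\<in>carrier M. y \<otimes>\<^bsub>M\<^esub> x = \<one>\<^bsub>M\<^esub>"
      using assms by (intro bexI[of _ "inverse x"]) (auto simp: M_def sgrpD)
  qed (use assms in \<open>auto simp: M_def sgrpD mult.assoc\<close>)
  have "x [^]\<^bsub>M\<^esub> i = x ^ i" for i :: nat
    by (induction i) (simp_all add: M_def power_commutes)
  then show ?thesis using M.pow_order_eq_1[of x] assms by (simp add: M_def order_def)
qed

lemma normalised_rel_centraliser:
  assumes K: "normalised G K" and Y: "normalised G Y" and G: "sgrp G"
  shows "normalised G (rel_centraliser G K Y)"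
  unfolding normalised_def
proof (intro ballI)
  fix u v assume u: "u \<in> rel_centraliser G K Y" and v: "v \<in> G"
  have "com y (cj u v) = cj (com (cj y (inverse v)) u) v" for y
    by (simp add: com_def cj_def mult.assoc)
  then show "cj u v \<in> rel_centraliser G K Y"
    using u v K Y G by (auto simp: rel_centraliser_def normalisedD sgrpD sgrp_cj)
qed

context max_class
begin

lemma power_eq_in:
  assumes "sgrp H" "a \<in> G" "a ^ k \<in> H" "coprime k p"
  shows "a \<in> H"
proof (cases "k = 0")
  case True
  then show ?thesis using assms p2 by (simp add: coprime_0_left_iff)
next
  case False
  have "coprime k (p ^ n)" using assms(4) by simp
  then obtain x y where xy: "k * x = p ^ n * y + 1"
    using bezout_nat[OF False, of "p ^ n"] by auto
  have "a ^ (p ^ n) = 1" using sgrp_pow_card[OF sgrpG finG assms(2)] cardG by simp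
  then have "(a ^ k) ^ x = a" using xy by (metis mult.left_neutral power_add power_mult power_one power_one_right)
  then show ?thesis using sgrp_power[OF assms(1,3)] by metis
qed

lemma power_p_in:
  assumes H: "sgrp H" and K: "sgrp K" "K \<subseteq> G" and HK: "H \<subseteq> K" and c: "card K = p * card H"
    and a: "a \<in> K" and nrm: "\<And>h. h \<in> H \<Longrightarrow> cj h a \<in> H"
  shows "a ^ p \<in> H"
proof (rule ccontr)
  assume np: "a ^ p \<notin> H"
  have nrm': "cj h (a ^ i) \<in> H" if "h \<in> H" for h i
    using that by (induction i arbitrary: h) (use nrm in \<open>simp_all flip: cj_cj\<close>)
  obtain i h where h: "h \<in> H" "a = (a ^ p) ^ i * h"
    using cyclic_quotient[OF H K HK c sgrp_power[OF K(1) a] np nrm' a] by metis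
  have aH: "a \<notin> H" using np sgrp_power[OF H] by blast
  then have i: "i \<noteq> 0" using h by (metis mult.left_neutral power_0)
  have pi: "p * i \<ge> 1" using i p2 by simp
  have "a ^ (p * i) * h = a * 1" using h by (simp add: power_mult)
  also have "a ^ (p * i) = a * a ^ (p * i - 1)" using pi by (simp flip: power_Suc)
  finally have "a ^ (p * i - 1) * h = 1" by (simp only: mult.assoc mg_left_mult_cancel)
  then have "a ^ (p * i - 1) \<in> H" using h H by (metis sgrpD(1) sgrp_mult_cancel(2))
  moreover have "coprime (p * i - 1) p"
    using pi by (metis coprime_commute coprime_diff_one_right_nat coprime_mult_right_iff less_le_trans less_one not_less0 coprime_mult_left_iff zero_less_iff_neq_zero)
  ultimately show False using power_eq_in[OF H _ _] a K aH by blast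
qed

lemma L_pow_iff:
  assumes "2 \<le> j" "j < n" "a \<in> L j" "a \<notin> L (Suc j)"
  shows "a ^ i \<in> L (Suc j) \<longleftrightarrow> p dvd i"
proof -
  have c: "card (L j) = p * card (L (Suc j))" using assms by (simp add: card_L Suc_diff_Suc flip: power_Suc)
  have nrm: "cj h a \<in> L (Suc j)" if "h \<in> L (Suc j)" for h using that assms LinG Lnormal by blast
  have "a ^ p \<in> L (Suc j)" by (rule power_p_in[OF sgrpL sgrpL LG LSuc c assms(3) nrm])
  then have "a ^ i \<in> L (Suc j)" if "p dvd i" using that by (auto simp: dvd_def power_mult intro: sgrp_power[OF sgrpL])
  moreover have "p dvd i" if "a ^ i \<in> L (Suc j)"
    using power_eq_in[OF sgrpL _ that] assms LinG p by (metis coprime_commute prime_imp_coprime)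
  ultimately show ?thesis by blast
qed

text \<open>The layer \<open>L j / L (Suc j)\<close> is cyclic of order \<open>p\<close>; the exponent with respect to a generator is additive modulo \<open>p\<close>.
An integer-valued coordinate, with congruences instead of equations, avoids the type of residues.\<close>

lemma layer_coordinate:
  assumes "2 \<le> j" "j < n"
  obtains ex :: "'a \<Rightarrow> int" where
    "\<And>x y. x \<in> L j \<Longrightarrow> y \<in> L j \<Longrightarrow> int p dvd ex (x * y) - ex x - ex y"
    "\<And>x. x \<in> L j \<Longrightarrow> x \<in> L (Suc j) \<longleftrightarrow> int p dvd ex x"
proof -
  obtain b where b: "b \<in> L j" "b \<notin> L (Suc j)" using L_neq[of j] assms by auto
  define R where "R x i \<longleftrightarrow> (\<exists>h\<in>L (Suc j). x = b ^ i * h)" for x i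
  define ex where "ex x = (SOME i. R x i)" for x
  have R: "R x (ex x)" if "x \<in> L j" for x
    unfolding ex_def by (rule someI_ex) (use layer_generator[OF assms b that] R_def in metis)
  have uniq: "int p dvd int i - int k" if "R x i" "R x k" for x i k
  proof -
    have *: "int p dvd int i - int k" if "R x i" "R x k" "k \<le> i" for i k
    proof -
      obtain h h' where h: "h \<in> L (Suc j)" "h' \<in> L (Suc j)" "b ^ i * h = b ^ k * h'" using \<open>R x i\<close> \<open>R x k\<close> by (auto simp: R_def)
      have "b ^ i = b ^ k * b ^ (i - k)" using that(3) by (simp flip: power_add)
      then have "b ^ (i - k) * h = h'" using h by (simp add: mult.assoc)
      then have "b ^ (i - k) \<in> L (Suc j)" using h sgrp_mult_cancel(2)[OF sgrpL] by metis
      then have "p dvd i - k" using L_pow_iff[OF assms b] by simp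
      then show ?thesis using that(3) by (metis int_dvd_int_iff of_nat_diff)
    qed
    show ?thesis
    proof (cases "k \<le> i")
      case True then show ?thesis using * that by blast
    next
      case False then show ?thesis using *[of k i] that dvd_minus_iff[of "int p" "int i - int k"] by simp
    qed
  qed
  show ?thesis
  proof (rule that[of "\<lambda>x. int (ex x)"])
    fix x y assume xy: "x \<in> L j" "y \<in> L j"
    then obtain h h' where h: "h \<in> L (Suc j)" "x = b ^ ex x * h" "h' \<in> L (Suc j)" "y = b ^ ex y * h'"
      using R[of x] R[of y] by (auto simp: R_def)
    have "x * y = b ^ (ex x + ex y) * (cj h (b ^ ex y) * h')"
      by (subst h(2), subst h(4)) (simp add: power_add cj_def mult.assoc)
    moreover have "cj h (b ^ ex y) * h' \<in> L (Suc j)"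
      using h b LinG sgrp_power[OF sgrpG] Lnormal by (intro sgrpD(2)[OF sgrpL]) auto
    ultimately have "R (x * y) (ex x + ex y)" by (auto simp: R_def)
    from uniq[OF R this] show "int p dvd int (ex (x * y)) - int (ex x) - int (ex y)"
      using xy sgrpD(2)[OF sgrpL] by (simp add: algebra_simps)
  next
    fix x assume x: "x \<in> L j"
    then obtain h where h: "h \<in> L (Suc j)" "x = b ^ ex x * h" using R by (auto simp: R_def)
    have "x \<in> L (Suc j) \<longleftrightarrow> b ^ ex x \<in> L (Suc j)" using h sgrp_mult_cancel(2)[OF sgrpL h(1)] by metis
    then show "x \<in> L (Suc j) \<longleftrightarrow> int p dvd int (ex x)" using L_pow_iff[OF assms b] by simp
  qed
qed

text \<open>Let \<open>b\<close> generate the layer \<open>j\<close> and let \<open>g\<close> lie outside the centraliser. Modulo \<open>L (j + 2)\<close> the commutators \<open>com b (g ^ k)\<close> are the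
powers of \<open>com b g\<close> and exhaust the next layer. Hence every element of \<open>G\<close> can be moved into the
centraliser by one of \<open>p\<close> powers of \<open>g\<close>, and the index is at most \<open>p\<close>.\<close>

lemma card_cz:
  assumes "2 \<le> j" "j + 2 \<le> n"
  shows "card (cz j) = p ^ (n - 1)"
proof -
  obtain g where g: "g \<in> G" "g \<notin> cz j" using cz_proper[OF assms] by auto
  obtain b where b: "b \<in> L j" "b \<notin> L (Suc j)" using L_neq[of j] assms by auto
  have c: "com b g \<in> L (Suc j)" "com b g \<notin> L (Suc (Suc j))" using uniserial[OF g, of b] b assms by auto
  have bgk: "inverse (com b g ^ k) * com b (g ^ k) \<in> L (j + 2)" for k
  proof (induction k)
    case 0 then show ?case using sgrpD(1)[OF sgrpL] by simp
  next
    case (Suc k)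
    define w where "w = com b (g ^ k)"
    have gk: "g ^ k \<in> G" using g sgrpG sgrp_power by auto
    have w: "w \<in> L (Suc j)" unfolding w_def using b gk assms by (intro comL) auto
    have "com b (g ^ Suc k) = com b g * (w * com w g)"
      by (simp only: power_Suc2 com_mult_right cj_com w_def)
    moreover have "inverse (com b g ^ Suc k) = inverse (com b g ^ k) * inverse (com b g)"
      by simp
    ultimately have "inverse (com b g ^ Suc k) * com b (g ^ Suc k) = inverse (com b g ^ k) * w * com w g"
      by (simp only: mult.assoc mg_left_cancel)
    moreover have "com w g \<in> L (j + 2)" using comL[of "Suc j" w g] w g by simp
    ultimately show ?case using Suc sgrpD(2)[OF sgrpL] by (simp add: w_def)
  qed
  have gp: "g ^ p \<in> cz j"
  proof (rule czI1[OF sgrp_power[OF sgrpG g(1)] _ _ b])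
    have "com b g ^ p \<in> L (j + 2)" using L_pow_iff[OF _ _ c, of p] assms by simp
    then show "com b (g ^ p) \<in> L (j + 2)" using bgk[of p] sgrpD(2)[OF sgrpL] by (metis mg_right_cancel)
  qed (use assms in auto)
  have "G \<subseteq> (\<lambda>(x, k). x * g ^ k) ` (cz j \<times> {..<p})"
  proof
    fix h assume h: "h \<in> G"
    have "com b h \<in> L (Suc j)" using comL[of j b h] b h assms by auto
    then obtain k l where l: "l \<in> L (Suc (Suc j))" "com b h = com b g ^ k * l"
      using layer_generator[OF _ _ c] assms by (metis add_2_eq_Suc' le_SucI less_eq_Suc_le)
    define g' where "g' = inverse (g ^ k)"
    have g': "g' \<in> G" using g by (simp add: g'_def sgrp_power sgrpD sgrpG)
    have gk: "g ^ k \<in> G" using g by (simp add: sgrp_power sgrpG)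
    define z where "z = inverse (com b g ^ k) * com b (g ^ k)"
    have "com b (h * g') = com b g' * cj (com b h) g'" by (rule com_mult_right)
    also have "com b g' = cj (inverse (com b (g ^ k))) g'"
      by (simp add: g'_def com_def cj_def mult.assoc)
    also have "\<dots> * cj (com b h) g' = cj (inverse z * l) g'"
      by (simp add: cj_mult[symmetric] z_def l(2) mult.assoc)
    also have "\<dots> \<in> L (j + 2)" using bgk[of k] l g' by (intro Lnormal sgrpD[OF sgrpL]) (auto simp: z_def)
    finally have "h * g' \<in> cz j" using czI1[OF sgrpD(2)[OF sgrpG h g'] _ _ b] assms by simp
    then have x: "h * g' * (g ^ p) ^ (k div p) \<in> cz j" using gp sgrp_cz by (simp add: sgrpD sgrp_power)
    have "h * g' * (g ^ p) ^ (k div p) * g ^ (k mod p) = h * g' * g ^ (p * (k div p) + k mod p)"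
      by (simp only: power_add power_mult mult.assoc)
    also have "\<dots> = h" by (simp add: g'_def mult.assoc)
    finally show "h \<in> (\<lambda>(x, k). x * g ^ k) ` (cz j \<times> {..<p})"
      using x p2 by (intro image_eqI[of _ _ "(h * g' * (g ^ p) ^ (k div p), k mod p)"]) auto
  qed
  then have "card G \<le> card (cz j \<times> {..<p})"
    using finG cz_G finite_subset by (intro surj_card_le) blast+
  then have "p ^ n \<le> card (cz j) * p" using cardG by (simp add: card_cartesian_product)
  moreover obtain i where i: "card (cz j) = p ^ i" using card_sgrp[OF sgrp_cz cz_G] by metis
  ultimately have "n \<le> Suc i" using p2 by (simp add: mult.commute flip: power_Suc)
  moreover have "card (cz j) \<le> p ^ (n - 1)"
    using card_proper[OF sgrp_cz sgrpG cz_proper[OF assms], of "n - 1"] cardG n by simp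
  then have "i \<le> n - 1" using i p2 by simp
  ultimately have "i = n - 1" by simp
  then show ?thesis using i by simp
qed

lemma cz_normal: "normalised G (cz j)"
  unfolding cz_def by (rule normalised_rel_centraliser[OF normalisedL normalisedL sgrpG])

lemma cz_eqI: "2 \<le> i \<Longrightarrow> i + 2 \<le> n \<Longrightarrow> 2 \<le> j \<Longrightarrow> j + 2 \<le> n \<Longrightarrow> cz i \<subseteq> cz j \<Longrightarrow> cz i = cz j"
  using card_cz finite_subset[OF cz_G finG] by (intro card_subset_eq) auto

lemma cz_gen:
  assumes "2 \<le> j" "j + 2 \<le> n" "s \<in> G" "s \<notin> cz j" "x \<in> G"
  obtains i c where "c \<in> cz j" "x = s ^ i * c"
proof -
  have "card G = p * card (cz j)" using card_cz[of j] assms cardG by (simp flip: power_Suc)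
  from cyclic_quotient[OF sgrp_cz sgrpG order.refl cz_G this assms(3,4) normalisedD[OF cz_normal _ assms(3)] assms(5)]
  show ?thesis using that by blast
qed

lemma cz_gen2:
  assumes "2 \<le> j" "j + 2 \<le> n" "s \<in> cz j" "s \<notin> L 2" "x \<in> cz j"
  obtains i h where "h \<in> L 2" "x = s ^ i * h"
proof -
  have "card (cz j) = p * card (L 2)" using card_cz[of j] assms card_L[of 2] n
    by (simp flip: power_Suc add: Suc_diff_Suc numeral_2_eq_2)
  moreover have "cj h s \<in> L 2" if "h \<in> L 2" for h using that Lnormal assms cz_G by blast
  ultimately show ?thesis
    using cyclic_quotient[OF sgrpL sgrp_cz cz_G L2_cz _ assms(3,4) _ assms(5)] that by blast
qed

text \<open>\<open>G\<close> is generated by \<open>s\<close> and the maximal subgroup \<open>cz j\<close>, and \<open>s\<close> commutes with its powers; so modulo \<open>K\<close> the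
group is abelian.\<close>

lemma least_gen:
  assumes "2 \<le> j" "j + 2 \<le> n" "sgrp K" "normalised G K" "s \<in> G" "s \<notin> cz j"
    and "\<And>x g. x \<in> cz j \<Longrightarrow> g \<in> G \<Longrightarrow> com x g \<in> K"
  shows "L 2 \<subseteq> K"
proof -
  have "L (Suc 1) \<subseteq> K"
  proof (rule leastL)
    fix x g assume "x \<in> L 1" and g: "g \<in> G"
    then have x: "x \<in> G" using L1 by simp
    obtain i c where c: "c \<in> cz j" "x = s ^ i * c" using cz_gen[OF assms(1,2,5,6) x] .
    obtain k d where d: "d \<in> cz j" "g = s ^ k * d" using cz_gen[OF assms(1,2,5,6) g] .
    have s: "s ^ i \<in> G" "s ^ k \<in> G" using assms sgrp_power[OF sgrpG] by auto
    have cd: "c \<in> G" "d \<in> G" using c d cz_G by auto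
    have "com (s ^ i) (s ^ k) = 1" by (simp add: com_eq_1_iff flip: power_add add: add.commute)
    moreover have "com (s ^ i) d \<in> K" using assms(7)[OF d(1) s(1)] sgrp_com_swap[OF assms(3)] by blast
    ultimately have "com (s ^ i) g \<in> K"
      unfolding d(2) using comG_bilinear(2)[OF assms(3,4) s cd(2)] sgrpD(1)[OF assms(3)] by simp
    then show "com x g \<in> K"
      unfolding c(2) using comG_bilinear(1)[OF assms(3,4) s(1) cd(1) g] assms(7)[OF c(1) g] by simp
  qed (use assms in auto)
  then show ?thesis by (simp add: numeral_2_eq_2)
qed

text \<open>Otherwise \<open>s\<close> and \<open>c\<close>, which generate \<open>G\<close> modulo \<open>L 2\<close>, would commute modulo \<open>L 3\<close>.\<close>

lemma com_level1:
  assumes "2 \<le> j" "j + 2 \<le> n" "s \<in> G" "s \<notin> cz j" "c \<in> cz j" "c \<notin> L 2"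
  shows "com c s \<in> L 2" "com c s \<notin> L 3"
proof -
  have cG: "c \<in> G" using assms cz_G by auto
  show "com c s \<in> L 2" using comL[of 1 c s] cG assms L1 by (simp add: numeral_2_eq_2)
  show "com c s \<notin> L 3"
  proof
    assume 0: "com c s \<in> L 3"
    have s: "com x s \<in> L 3" if x: "x \<in> cz j" for x
    proof -
      obtain i h where h: "h \<in> L 2" "x = c ^ i * h" using cz_gen2[OF assms(1,2,5,6) x] .
      show ?thesis unfolding h(2)
        using comG_bilinear(1)[OF sgrpL normalisedL, of "c ^ i" h s]
          comG_bilinear(3)[OF sgrpL normalisedL, of c h s 3 i] 0 h comL[of 2 h s] cG LinG assms sgrp_power[OF sgrpG]
        by (simp add: numeral_3_eq_3 numeral_2_eq_2)
    qed
    have cc: "com x y \<in> L 3" if x: "x \<in> cz j" and y: "y \<in> cz j" for x y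
    proof -
      obtain i h where h: "h \<in> L 2" "x = c ^ i * h" using cz_gen2[OF assms(1,2,5,6) x] .
      obtain k l where l: "l \<in> L 2" "y = c ^ k * l" using cz_gen2[OF assms(1,2,5,6) y] .
      have ci: "c ^ i \<in> G" "c ^ k \<in> G" using cG sgrp_power[OF sgrpG] by auto
      have hl: "h \<in> G" "l \<in> G" "y \<in> G" using h l y LinG cz_G by auto
      have "com (c ^ i) (c ^ k) = 1" by (simp add: com_eq_1_iff flip: power_add add: add.commute)
      moreover have "com (c ^ i) l \<in> L 3"
        using comL[of 2 l "c ^ i"] l ci sgrp_com_swap[OF sgrpL] by (simp add: numeral_3_eq_3)
      ultimately have "com (c ^ i) y \<in> L 3"
        unfolding l(2) using comG_bilinear(2)[OF sgrpL normalisedL ci hl(2)] sgrpD(1)[OF sgrpL] by simp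
      moreover have "com h y \<in> L 3" using comL[of 2 h y] h hl by (simp add: numeral_3_eq_3)
      ultimately show ?thesis unfolding h(2) using comG_bilinear(1)[OF sgrpL normalisedL ci(1) hl(1,3)] by simp
    qed
    have "com x g \<in> L 3" if x: "x \<in> cz j" and g: "g \<in> G" for x g
    proof -
      obtain k d where d: "d \<in> cz j" "g = s ^ k * d" using cz_gen[OF assms(1-4) g] .
      have xG: "x \<in> G" "d \<in> G" "s ^ k \<in> G" using x d cz_G assms sgrp_power[OF sgrpG] by auto
      have "com x (s ^ k) \<in> L 3" using comG_bilinear(4)[OF sgrpL normalisedL xG(1) xG(1) assms(3) s[OF x]] .
      then show ?thesis unfolding d(2) using comG_bilinear(2)[OF sgrpL normalisedL xG(1,3,2)] cc[OF x d(1)] by simp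
    qed
    from least_gen[OF assms(1,2) sgrpL normalisedL assms(3,4) this] have "L 2 \<subseteq> L 3" by blast
    then show False using L_neq[of 2] n by (auto simp: numeral_3_eq_3 numeral_2_eq_2)
  qed
qed

section \<open>Powers of uniserial elements\<close>

text \<open>The element \<open>s\<^sup>p\<close> commutes with \<open>s\<close>, but commutation with \<open>s\<close> detects the level of an element: a nontrivial
\<open>s\<^sup>p\<close> of level below \<open>q\<close> would have a commutator with \<open>s\<close> of the next level exactly.\<close>

lemma uniserial_power:
  assumes "s \<in> G" "3 \<le> q" "q < n" "\<And>j. 2 \<le> j \<Longrightarrow> j < q \<Longrightarrow> s \<notin> cz j"
  shows "s ^ p \<in> L q"
proof -
  have s2: "s \<notin> cz 2" and n4: "2 + 2 \<le> n" using assms by auto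
  have "card G = p * card (cz 2)" using card_cz[of 2] n4 cardG by (simp flip: power_Suc)
  then have pc: "s ^ p \<in> cz 2"
    using power_p_in[OF sgrp_cz sgrpG order.refl cz_G _ assms(1)] normalisedD[OF cz_normal] assms(1) by blast
  have "s ^ p \<in> L 2"
  proof (rule ccontr)
    assume "s ^ p \<notin> L 2"
    then have "com (s ^ p) s \<notin> L 3" using com_level1[OF _ n4 assms(1) s2 pc] by simp
    moreover have "com (s ^ p) s = 1" by (simp add: com_eq_1_iff power_commutes)
    ultimately show False using sgrpD(1)[OF sgrpL] by simp
  qed
  then have "s ^ p \<in> L (2 + i)" if "2 + i \<le> q" for i
    using that
  proof (induction i)
    case (Suc i)
    then have "s ^ p \<in> L (2 + i)" by simp
    moreover have "com (s ^ p) s \<in> L (2 + i + 2)"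
      using sgrpD(1)[OF sgrpL] by (simp add: com_eq_1_iff[THEN iffD2] power_commutes)
    ultimately show ?case using czI1[OF assms(1), of "2 + i" "s ^ p"] assms(4)[of "2 + i"] Suc.prems assms(3)
      by (metis Suc_le_lessD add_Suc_right le_add1 less_trans)
  qed simp
  from this[of "q - 2"] show ?thesis using assms(2) by (simp del: add_2_eq_Suc)
qed

lemma twisted_norm_in:
  assumes "s \<in> G" "a \<in> G" "3 \<le> q" "q < n"
    and "\<And>j. 2 \<le> j \<Longrightarrow> j < q \<Longrightarrow> s \<notin> cz j" "\<And>j. 2 \<le> j \<Longrightarrow> j < q \<Longrightarrow> a * inverse s \<notin> cz j"
  shows "twisted_norm s a p \<in> L q"
  unfolding twisted_norm_def using assms
  by (intro sgrpD(2)[OF sgrpL] uniserial_power) (auto simp: sgrpD[OF sgrpG])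

text \<open>For \<open>a\<close> in the derived subgroup, \<open>a * inverse s\<close> avoids the same two-step centralisers as \<open>s\<close>, so the twisted norm
$(a s^{-1})^p s^p$ lies in \<open>L q\<close> and the congruence for \<open>p\<close>-th powers holds in the filtration truncated at \<open>q\<close>.\<close>

lemma filtration_L_iter_com:
  assumes "s \<in> G" "3 \<le> q" "q < n" "\<And>j. 2 \<le> j \<Longrightarrow> j < q \<Longrightarrow> s \<notin> cz j"
    and "a \<in> L w" "2 \<le> w"
  shows "a ^ p * iter_com a s (p - 1) \<in> L (min (w + p) q)" "a ^ p \<in> L (min (w + p - 1) q)"
proof -
  let ?\<Phi> = "\<lambda>w. L (min w q)"
  have nrm: "twisted_norm s a p \<in> L q" if "a \<in> ?\<Phi> 2" for a
  proof (rule twisted_norm_in)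
    have a2: "a \<in> L 2" using that assms(2) by (simp add: min_absorb1)
    then show "a \<in> G" using LinG by blast
    fix j assume j: "2 \<le> j" "j < q"
    have "a \<in> cz j" using a2 L2_cz by blast
    then show "a * inverse s \<notin> cz j"
      using assms(4)[OF j] sgrp_mult_cancel(1)[OF sgrp_cz] sgrp_inverse_iff[OF sgrp_cz] by metis
  qed (use assms in auto)
  have s: "s \<in> ?\<Phi> 1" using assms L1 by (simp add: min_absorb1)
  have a: "a \<in> ?\<Phi> w" using assms(5) Lmono[of "min w q" w] by auto
  have bot: "?\<Phi> v = L q" if "v \<ge> q" for v using that by (simp add: min_absorb2)
  show "a ^ p * iter_com a s (p - 1) \<in> L (min (w + p) q)" "a ^ p \<in> L (min (w + p - 1) q)"
    using power_iter_com[OF filtration_L_trunc[of q] s p bot nrm a assms(6)] by auto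
qed

section \<open>Blackburn's theorem\<close>

text \<open>Replacing \<open>L 1\<close> by the maximal subgroup \<open>cz 2\<close> turns the series into one with positive degree of commutativity.\<close>

definition \<Lambda> :: "nat \<Rightarrow> 'a set"
  where "\<Lambda> a = (if a = 1 then cz 2 else L a)"

lemma \<Lambda>_simps: "a \<ge> 2 \<Longrightarrow> \<Lambda> a = L a" "\<Lambda> 1 = cz 2" "\<Lambda> (Suc 0) = cz 2"
  by (auto simp: \<Lambda>_def)

lemma sgrp_\<Lambda>: "sgrp (\<Lambda> a)" and normalised_\<Lambda>: "normalised G (\<Lambda> a)" and \<Lambda>_L: "\<Lambda> a \<subseteq> L a"
  using sgrpL sgrp_cz cz_normal normalisedL cz_G L1 by (auto simp: \<Lambda>_def)

lemma com_\<Lambda>: "a \<ge> 1 \<Longrightarrow> x \<in> \<Lambda> a \<Longrightarrow> g \<in> G \<Longrightarrow> com x g \<in> L (Suc a)"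
  using comL \<Lambda>_L by blast

lemma least_\<Lambda>:
  assumes "4 \<le> n" "1 \<le> a" "sgrp K" "normalised G K" "\<And>x g. x \<in> \<Lambda> a \<Longrightarrow> g \<in> G \<Longrightarrow> com x g \<in> K"
  shows "L (Suc a) \<subseteq> K"
proof (cases "a = 1")
  case True
  obtain s where "s \<in> G" "s \<notin> cz 2" using cz_proper[of 2] assms(1) by auto
  then show ?thesis using least_gen[of 2 K s] assms True by (simp add: \<Lambda>_def numeral_2_eq_2)
next
  case False
  then show ?thesis using leastL[of a K] assms by (simp add: \<Lambda>_def)
qed

lemma cz_not_L2:
  assumes "2 \<le> j" "j + 2 \<le> n"
  obtains c where "c \<in> cz j" "c \<notin> L 2"
proof -
  have "p ^ (n - 2) < p ^ (n - 1)" using p2 n by (intro power_strict_increasing) auto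
  then have "card (L 2) < card (cz j)" using card_cz[OF assms] card_L[of 2] n by simp
  then have "\<not> cz j \<subseteq> L 2" using card_mono[OF finL, of "cz j" 2] by linarith
  then show ?thesis using that by blast
qed

lemma com_cz2: "4 \<le> n \<Longrightarrow> x \<in> cz 2 \<Longrightarrow> y \<in> cz 2 \<Longrightarrow> com x y \<in> L 4"
proof -
  assume n4: "4 \<le> n" and x: "x \<in> cz 2" and y: "y \<in> cz 2"
  obtain c where c: "c \<in> cz 2" "c \<notin> L 2" using cz_not_L2[of 2] n4 by auto
  obtain i h where h: "h \<in> L 2" "x = c ^ i * h" by (rule cz_gen2[OF _ _ c x]) (use n4 in auto)
  obtain k l where l: "l \<in> L 2" "y = c ^ k * l" by (rule cz_gen2[OF _ _ c y]) (use n4 in auto)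
  have ci: "c ^ i \<in> cz 2" "c ^ k \<in> cz 2" using c sgrp_power[OF sgrp_cz] by auto
  have G: "c ^ i \<in> G" "c ^ k \<in> G" "h \<in> G" "l \<in> G" "y \<in> G" using ci h l y LinG cz_G by auto
  have "com (c ^ i) (c ^ k) = 1" by (simp add: com_eq_1_iff flip: power_add add: add.commute)
  moreover have "com (c ^ i) l \<in> L 4" using czD[OF ci(1) l(1)] sgrp_com_swap[OF sgrpL] by simp
  ultimately have "com (c ^ i) y \<in> L 4"
    unfolding l(2) using comG_bilinear(2)[OF sgrpL normalisedL G(1,2,4)] sgrpD(1)[OF sgrpL] by simp
  moreover have "com h y \<in> L 4" using czD[OF y h(1)] by simp
  ultimately show ?thesis unfolding h(2) using comG_bilinear(1)[OF sgrpL normalisedL G(1,3,5)] by simp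
qed

text \<open>Positive degree of commutativity: as long as the two-step centralisers agree with \<open>cz 2\<close>, commutators gain one
more level than in the lower central series itself. The truncation at \<open>q\<close> records how far they are known to agree. Apart from the start at \<open>a = 1\<close>,
this is again the three subgroup lemma.\<close>

lemma com_\<Lambda>\<Lambda>:
  assumes n4: "4 \<le> n" and pos: "\<And>j. 2 \<le> j \<Longrightarrow> j + 2 \<le> q \<Longrightarrow> cz 2 \<subseteq> cz j"
  shows "1 \<le> a \<Longrightarrow> 1 \<le> b \<Longrightarrow> x \<in> \<Lambda> a \<Longrightarrow> y \<in> \<Lambda> b \<Longrightarrow> com x y \<in> L (min (a + b + 1) q)"
proof (induction a arbitrary: b x y rule: nat_induct_at_least)
  case base
  then have x: "x \<in> cz 2" by (simp add: \<Lambda>_def)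
  show ?case
  proof (cases "b = 1")
    case True
    have "L 4 \<subseteq> L (min (1 + b + 1) q)" by (rule Lmono) (use True in simp)
    moreover have "y \<in> cz 2" using True base by (simp add: \<Lambda>_def)
    ultimately show ?thesis using com_cz2[OF n4 x] by blast
  next
    case False
    then have b: "b \<ge> 2" and y: "y \<in> L b" using base by (auto simp: \<Lambda>_def)
    have "com y x \<in> L (min (1 + b + 1) q)"
    proof (cases "b + 2 \<le> q")
      case True
      then show ?thesis using pos[OF b True] x czD[of x b y] y by auto
    next
      case False
      then show ?thesis using comL[of b y x] b x y cz_G Lmono[of "min (1 + b + 1) q" "Suc b"] by auto
    qed
    then show ?thesis using sgrp_com_swap[OF sgrpL] by blast
  qed
next
  case (Suc a)
  let ?K = "L (min (Suc a + b + 1) q)"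
  have "L (Suc a) \<subseteq> rel_centraliser G ?K (\<Lambda> b)"
  proof (rule least_\<Lambda>[OF n4 Suc.hyps(1)])
    show "sgrp (rel_centraliser G ?K (\<Lambda> b))" by (rule sgrp_rel_centraliser[OF sgrpL normalisedL sgrpG])
    show "normalised G (rel_centraliser G ?K (\<Lambda> b))" by (rule normalised_rel_centraliser[OF normalisedL normalised_\<Lambda> sgrpG])
    fix x g assume x: "x \<in> \<Lambda> a" and g: "g \<in> G"
    have xG: "x \<in> G" using x \<Lambda>_L LinG by blast
    show "com x g \<in> rel_centraliser G ?K (\<Lambda> b)"
      unfolding rel_centraliser_def
    proof (intro CollectI conjI ballI)
      show "com x g \<in> G" using xG g sgrpG sgrp_com by blast
      fix y assume y: "y \<in> \<Lambda> b"
      have yG: "y \<in> G" using y \<Lambda>_L LinG by blast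
      have "com (com x g) y \<in> ?K"
      proof (rule three_subgroup[OF sgrpL normalisedL sgrpG xG g yG])
        have "com (inverse y) (inverse g) \<in> L (Suc b)"
          using y g Suc.prems(1) by (intro com_\<Lambda> sgrpD(3)[OF sgrp_\<Lambda>] sgrpD(3)[OF sgrpG])
        then have "com (inverse g) (inverse y) \<in> \<Lambda> (Suc b)"
          using sgrp_com_swap[OF sgrpL] Suc.prems(1) by (auto simp: \<Lambda>_def)
        from Suc.IH[OF _ x this] show "com (com (inverse g) (inverse y)) x \<in> ?K"
          using sgrp_com_swap[OF sgrpL] by auto
        have "com (inverse x) y \<in> L (min (a + b + 1) q)"
          using Suc.IH[OF Suc.prems(1) sgrpD(3)[OF sgrp_\<Lambda> x] y] .
        then have "com y (inverse x) \<in> L (min (a + b + 1) q)" using sgrp_com_swap[OF sgrpL] by blast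
        then show "com (com y (inverse x)) (inverse g) \<in> ?K"
          using g sgrpD(3)[OF sgrpG] Lnormal[of "com y (inverse x)" "min (a+b+1) q" "inverse g"]
            comL'[of "com y (inverse x)" "min (a+b+1) q" "inverse g" "min (Suc a + b + 1) q"]
            sgrp_cj_iff[OF sgrpL] L0
          by (cases "q = 0") auto
      qed
      then show "com y (com x g) \<in> ?K" using sgrp_com_swap[OF sgrpL] by blast
    qed
  qed
  moreover have "x \<in> L (Suc a)" using Suc.prems(2) \<Lambda>_L by blast
  ultimately have "com y x \<in> ?K" using Suc.prems by (auto simp: rel_centraliser_def)
  then show ?case using sgrp_com_swap[OF sgrpL] by blast
qed

text \<open>This is the Leibniz rule for the derivation \<open>v \<mapsto> [v, g]\<close> applied to \<open>[x, z]\<close>, including the quadratic term, with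
an error two levels deeper than the commutators themselves.\<close>

lemma com_com_expand:
  assumes m: "m \<ge> 1" and G: "x \<in> G" "z \<in> G" "g \<in> G"
    and A: "com x z \<in> L (m + 1)" "com x (com z g) \<in> L (m + 1)" "com (com x g) z \<in> L (m + 1)"
      "com (com x g) (com z g) \<in> L (m + 1)"
  shows "inverse (com x (com z g) * com (com x g) z * com (com x g) (com z g)) * com (com x z) g \<in> L (m + 3)"
proof -
  define y u where "y = com x g" and "u = com z g"
  have yu: "y \<in> L 2" "u \<in> L 2" using comL[of 1 x g] comL[of 1 z g] G L1 by (auto simp: y_def u_def numeral_2_eq_2)
  let ?K = "L (m + 3)" and ?A = "L (m + 1)"
  have A2: "v \<in> L 2" if "v \<in> ?A" for v using that Lmono[of 2 "m + 1"] m by auto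
  have sw: "com v w \<in> ?K" if "v \<in> ?A" "w \<in> L 2" for v w
    using com_LL'[OF that, of "m + 3"] by simp
  define a b c d where "a = com x z" and "b = com x u" and "c = com y z" and "d = com y u"
  have abcd: "a \<in> ?A" "b \<in> ?A" "c \<in> ?A" "d \<in> ?A" using A by (auto simp: a_def b_def c_def d_def y_def u_def)
  have ab2: "b * d \<in> L 2" "cj b y * d \<in> L 2"
    using abcd A2 yu LinG Lnormal[of b 2 y] by (auto intro: sgrpD(2)[OF sgrpL])
  have "a * com a g = cj a g" by (simp add: cj_com)
  also have "\<dots> = com (x * y) (z * u)" by (simp only: a_def y_def u_def cj_com[symmetric] cj_com_distrib)
  also have "\<dots> = cj b y * d * cj (cj a y * c) u"
    by (simp only: com_mult_right com_mult_left a_def b_def c_def d_def)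
  finally have eq: "a * com a g = b * com b y * d * (a * (com a y * c) * com (a * (com a y * c)) u)"
    by (simp only: cj_com mult.assoc)
  define k1 k2 k3 where "k1 = com b y" and "k2 = com a y" and "k3 = com (a * (com a y * c)) u"
  have k12: "k1 \<in> ?K" "k2 \<in> ?K" using sw abcd yu by (auto simp: k1_def k2_def)
  have "k2 \<in> ?A" using k12 Lmono[of "m + 1" "m + 3"] by auto
  then have k3: "k3 \<in> ?K" unfolding k3_def k2_def[symmetric]
    using abcd yu by (intro sw sgrpD(2)[OF sgrpL]) auto
  have G': "v \<in> L 2 \<Longrightarrow> v \<in> G" for v using LinG by blast
  define h where "h = cj k1 (d * a) * k2"
  have h: "h \<in> ?K" unfolding h_def using k12 abcd A2 G' sgrpD(2)[OF sgrpG] by (intro sgrpD(2)[OF sgrpL] Lnormal) auto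
  define e where "e = com a (b * d)"
  have e: "com (b * d) a \<in> ?K" using sw[OF abcd(1) ab2(1)] sgrp_com_swap[OF sgrpL] by blast
  have f: "com d c \<in> ?K" using sw[OF abcd(4)] A2[OF abcd(3)] .
  have "inverse a * (b * k1 * d * (a * (k2 * c) * k3)) = inverse a * (b * d * a) * (cj k1 (d * a) * k2) * c * k3"
    by (simp add: cj_def mult.assoc)
  also have "\<dots> = b * d * com (b * d) a * h * c * k3"
    by (simp add: com_def h_def mult.assoc)
  also have "\<dots> = b * c * d * (com d c * cj (com (b * d) a * h) c * k3)"
    by (simp add: com_def cj_def mult.assoc)
  finally have "com a g = b * c * d * (com d c * cj (com (b * d) a * h) c * k3)"
    using eq by (metis k1_def k2_def k3_def mg_left_cancel)
  then have "inverse (b * c * d) * com a g = com d c * cj (com (b * d) a * h) c * k3" by (simp only: mg_left_cancel)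
  moreover have "\<dots> \<in> ?K"
    using e f h k3 abcd A2 G' by (intro sgrpD(2)[OF sgrpL] Lnormal) auto
  ultimately show ?thesis by (simp add: a_def b_def c_def d_def y_def u_def)
qed

text \<open>Suppose that \<open>s\<close> lies in \<open>cz m\<close> but in none of the earlier centralisers, and let \<open>S a\<close> generate the layer \<open>a\<close>
for \<open>a \<le> m\<close>, where \<open>S (Suc a) = com (S a) s\<close>. Since \<open>[S a, S (m - a)]\<close> lies in \<open>L (m + 1)\<close>, the Leibniz rule shows that
\<open>w a = [S a, S (m + 1 - a)]\<close> changes sign modulo \<open>L (m + 2)\<close> when \<open>a\<close> grows by one. So one \<open>w a\<close> is trivial
there if and only if all are, and if all are, then \<open>S 1\<close> lies in \<open>cz m\<close>, which forces \<open>cz m = cz 2\<close>.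

For odd \<open>m\<close> the middle \<open>w a\<close> is a commutator of an element with itself. For even \<open>m\<close>, one goes to the next layer \<open>L (m + 2)\<close> and uses
\<open>k a = [S a, S (m + 2 - a)]\<close> and \<open>\<theta> a = [w a, s]\<close>. There \<open>\<theta>\<close> alternates in sign and \<open>k a + k (a + 1) = \<theta> a\<close> in
additive notation; as \<open>s \<in> cz m\<close> makes \<open>k 1\<close> trivial, \<open>k a = -(a - 1) \<theta> a\<close>. The middle value \<open>k (m/2 + 1)\<close> is trivial,
and \<open>m/2\<close> is prime to \<open>p\<close>, hence all \<open>\<theta> a\<close> and all \<open>k a\<close> with \<open>a \<ge> 2\<close> vanish. Then \<open>w 2\<close> is central modulo \<open>L (m + 3)\<close>, so it cannot
generate the layer \<open>m + 1\<close>.\<close>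

lemma blackburn_odd_or_small:
  assumes m: "3 \<le> m" "m + 3 \<le> n" and eq: "\<And>j. 2 \<le> j \<Longrightarrow> j < m \<Longrightarrow> cz j = cz 2"
    and small: "odd m \<or> m \<le> p"
  shows "cz m = cz 2"
proof (rule ccontr)
  assume ne: "cz m \<noteq> cz 2"
  have n4: "4 \<le> n" using m by simp
  have "\<not> cz m \<subseteq> cz 2" using cz_eqI[of m 2] ne m by auto
  then obtain s where s: "s \<in> cz m" "s \<notin> cz 2" by blast
  have sG: "s \<in> G" using s cz_G by blast
  obtain s1 where s1: "s1 \<in> cz 2" "s1 \<notin> L 2" using cz_not_L2[of 2] n4 by auto
  define S where "S a = iter_com s1 s (a - 1)" for a
  have S1: "S 1 = s1" "S (Suc 0) = s1" by (simp_all add: S_def)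
  have SSuc: "com (S a) s = S (Suc a)" if "a \<ge> 1" for a using that by (cases a) (auto simp: S_def)
  have Slev: "S a \<in> L a \<and> S a \<notin> L (Suc a)" if "2 \<le> a" "a \<le> m" for a
    using that
  proof (induction a rule: nat_induct_at_least)
    case base
    then show ?case using com_level1[of 2 s s1] n4 sG s s1 SSuc[of 1] S1 by (simp add: numeral_2_eq_2 numeral_3_eq_3)
  next
    case (Suc a)
    then show ?case using uniserial[OF sG, of a "S a"] eq[of a] s SSuc[of a] m by auto
  qed
  have S\<Lambda>: "S a \<in> \<Lambda> a" if "1 \<le> a" "a \<le> m" for a
    using that Slev[of a] s1 S1 by (cases "a = 1") (auto simp: \<Lambda>_def)
  have Sm1: "S (Suc m) \<in> L (m + 2)" using czD[OF s(1), of "S m"] Slev[of m] m SSuc[of m] by simp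
  have SL: "S a \<in> L a" if "1 \<le> a" "a \<le> m + 1" for a
    using that S\<Lambda>[of a] \<Lambda>_L Sm1 LSuc[of "Suc m"] by (cases "a = Suc m") auto
  have SG: "S a \<in> G" if "1 \<le> a" "a \<le> m + 1" for a using SL[OF that] LinG by blast
  let ?A = "L (m + 1)" and ?B = "L (m + 2)" and ?K = "L (m + 3)"
  have KB: "?K \<subseteq> ?B" "?B \<subseteq> ?A" by (auto intro: Lmono[THEN subsetD, rotated])
  define w where "w a = com (S a) (S (m + 1 - a))" for a
  define k where "k a = com (S a) (S (m + 2 - a))" for a
  define v where "v a = com (S a) (S (m - a))" for a
  define \<theta> where "\<theta> a = com (w a) s" for a
  have pos: "cz 2 \<subseteq> cz j" if "2 \<le> j" "j + 2 \<le> m + 1" for j using eq[of j] that by simp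
  have vA: "v a \<in> ?A" if "1 \<le> a" "a < m" for a
  proof -
    have "min (a + (m - a) + 1) (m + 1) = m + 1" using that by simp
    then show ?thesis using com_\<Lambda>\<Lambda>[where q = "m + 1" and a = a and b = "m - a" and x = "S a" and y = "S (m - a)", OF n4 pos] that S\<Lambda> by (simp add: v_def)
  qed
  have wA: "w a \<in> ?A" if "1 \<le> a" "a \<le> m" for a
    using com_LL[OF SL[of a] SL[of "m + 1 - a"]] that by (simp add: w_def)
  have kB: "k a \<in> ?B" if "1 \<le> a" "a \<le> m + 1" for a
    using com_LL[OF SL[of a] SL[of "m + 2 - a"]] that by (simp add: k_def)
  have \<theta>B: "\<theta> a \<in> ?B" if "1 \<le> a" "a \<le> m" for a
    using comL[of "m + 1" "w a" s] wA[OF that] sG by (simp add: \<theta>_def)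
  have ww: "w a * w (Suc a) \<in> ?B" if a: "1 \<le> a" "a < m" for a
  proof -
    have idx: "com (S (m - a)) s = S (m + 1 - a)" "com (S a) s = S (Suc a)"
      using SSuc[of "m - a"] SSuc[of a] a by (simp_all add: Suc_diff_le)
    have e: "inverse (w a * w (Suc a) * k (Suc a)) * com (v a) s \<in> ?K"
    proof -
      have "inverse (com (S a) (com (S (m - a)) s) * com (com (S a) s) (S (m - a)) * com (com (S a) s) (com (S (m - a)) s))
          * com (com (S a) (S (m - a))) s \<in> ?K"
      proof (rule com_com_expand)
        show "com (S a) (S (m - a)) \<in> ?A" using vA[OF a] by (simp add: v_def)
        show "com (S a) (com (S (m - a)) s) \<in> ?A" using wA[of a] a by (simp add: idx w_def)
        show "com (com (S a) s) (S (m - a)) \<in> ?A" using wA[of "Suc a"] a by (simp add: idx w_def)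
        show "com (com (S a) s) (com (S (m - a)) s) \<in> ?A" using kB[of "Suc a"] a KB by (auto simp add: idx k_def)
      qed (use a m sG SG in auto)
      then show ?thesis using a by (simp add: idx w_def k_def v_def Suc_diff_le)
    qed
    have c: "com (v a) s \<in> ?B" using comL[of "m + 1" "v a" s] vA[OF a] sG by simp
    have "inverse (w a * w (Suc a) * k (Suc a)) * com (v a) s \<in> ?B" using e KB by blast
    then have "w a * w (Suc a) * k (Suc a) \<in> ?B"
      using sgrp_mult_cancel(2)[OF sgrpL c] sgrp_inverse_iff[OF sgrpL] by blast
    then show ?thesis using sgrp_mult_cancel(2)[OF sgrpL kB[of "Suc a"]] a by simp
  qed
  have chain1: "w (Suc a) \<in> ?B \<longleftrightarrow> w a \<in> ?B" if "1 \<le> a" "a < m" for a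
    using ww[OF that] sgrp_mult_cancel[OF sgrpL] by metis
  have w1: "w a \<in> ?B \<Longrightarrow> w 1 \<in> ?B" if "1 \<le> a" "a \<le> m" for a
    using that
  proof (induction a rule: nat_induct_at_least)
    case (Suc a)
    then show ?case using chain1[of a] by simp
  qed simp
  have fin: False if w: "w 1 \<in> ?B"
  proof -
    have "com (S m) s1 \<in> ?B" using w sgrp_com_swap[OF sgrpL] by (auto simp: w_def S1)
    then have "s1 \<in> cz m" using czI1[of s1 m "S m"] s1 cz_G Slev[of m] m by auto
    have "cz 2 \<subseteq> cz m"
    proof
      fix x assume x: "x \<in> cz 2"
      obtain i h where h: "h \<in> L 2" "x = s1 ^ i * h" by (rule cz_gen2[OF _ _ s1 x]) (use n4 in auto)
      then show "x \<in> cz m" using \<open>s1 \<in> cz m\<close> sgrp_power[OF sgrp_cz] L2_cz sgrpD(2)[OF sgrp_cz] by blast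
    qed
    then show False using cz_eqI[of 2 m] ne m by simp
  qed
  show False
  proof (cases "odd m")
    case True
    then obtain c where c: "m = 2 * c + 1" by (auto elim: oddE)
    then have "w (c + 1) = 1" by (simp add: w_def)
    then show False using fin w1[of "c + 1"] c m sgrpD(1)[OF sgrpL] by simp
  next
    case False
    then obtain c where c: "m = 2 * c" by auto
    have m4: "4 \<le> m" using False m by (cases "m = 3") auto
    have cp: "0 < c" "c < p" using small False c m by auto
    obtain ex :: "'a \<Rightarrow> int" where
      ex: "\<And>x y. x \<in> ?B \<Longrightarrow> y \<in> ?B \<Longrightarrow> int p dvd ex (x * y) - ex x - ex y"
      and exK: "\<And>x. x \<in> ?B \<Longrightarrow> x \<in> L (Suc (m + 2)) \<longleftrightarrow> int p dvd ex x"
      using layer_coordinate[of "m + 2"] m by auto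
    have exK: "x \<in> ?B \<Longrightarrow> x \<in> ?K \<longleftrightarrow> int p dvd ex x" for x using exK by (simp add: eval_nat_numeral)
    have exmod: "int p dvd ex t - ex x - ex y" if "x \<in> ?B" "y \<in> ?B" "t \<in> ?B" "z \<in> ?K" "inverse (x * y * z) * t \<in> ?K" for x y z t
    proof -
      define r where "r = z * (inverse (x * y * z) * t)"
      have r: "r \<in> ?K" using that sgrpD(2)[OF sgrpL] by (simp add: r_def)
      have t: "t = (x * y) * r" by (simp add: r_def mult.assoc)
      have "int p dvd ex r" using exK[of r] r KB by auto
      moreover have "int p dvd ex t - ex (x * y) - ex r" unfolding t
        using that r KB sgrpD(2)[OF sgrpL] by (intro ex) auto
      moreover have "int p dvd ex (x * y) - ex x - ex y" using that by (intro ex)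
      ultimately have "int p dvd (ex t - ex (x * y) - ex r) + (ex (x * y) - ex x - ex y) + ex r" by (intro dvd_add)
      then show ?thesis by (simp add: algebra_simps)
    qed
    have E2: "int p dvd ex (\<theta> a) - ex (k a) - ex (k (Suc a))" if a: "1 \<le> a" "a \<le> m" for a
    proof (rule exmod)
      let ?z = "com (S (Suc a)) (S (m + 2 - a))"
      show "k a \<in> ?B" "k (Suc a) \<in> ?B" "\<theta> a \<in> ?B" using kB \<theta>B a by auto
      show z: "?z \<in> ?K" using com_LL[OF SL[of "Suc a"] SL[of "m + 2 - a"]] a by (simp add: eval_nat_numeral)
      have idx: "com (S (m + 1 - a)) s = S (m + 2 - a)" "com (S a) s = S (Suc a)"
        using SSuc[of "m + 1 - a"] SSuc[of a] a by (simp_all add: Suc_diff_le)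
      have "inverse (com (S a) (com (S (m + 1 - a)) s) * com (com (S a) s) (S (m + 1 - a)) * com (com (S a) s) (com (S (m + 1 - a)) s))
          * com (com (S a) (S (m + 1 - a))) s \<in> ?K"
      proof (rule com_com_expand)
        show "com (S a) (S (m + 1 - a)) \<in> ?A" using wA[OF a] by (simp add: w_def)
        show "com (S a) (com (S (m + 1 - a)) s) \<in> ?A" unfolding idx using kB[of a] a KB by (auto simp: k_def)
        show "com (com (S a) s) (S (m + 1 - a)) \<in> ?A" unfolding idx using kB[of "Suc a"] a KB by (auto simp: k_def)
        show "com (com (S a) s) (com (S (m + 1 - a)) s) \<in> ?A" unfolding idx using z KB by auto
      qed (use a m sG SG in auto)
      then show "inverse (k a * k (Suc a) * ?z) * \<theta> a \<in> ?K" unfolding idx by (simp add: w_def k_def \<theta>_def)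
    qed
    have TT: "int p dvd ex (\<theta> a) + ex (\<theta> (Suc a))" if a: "1 \<le> a" "a < m" for a
    proof -
      have t: "\<theta> a \<in> ?B" "\<theta> (Suc a) \<in> ?B" using \<theta>B a by auto
      have wG: "w (Suc a) \<in> G" using wA[of "Suc a"] a LinG by auto
      have "com (w a * w (Suc a)) s \<in> ?K" using comL[OF _ ww[OF a] sG] by (simp add: eval_nat_numeral)
      then have "cj (\<theta> a) (w (Suc a)) * \<theta> (Suc a) \<in> ?K" by (simp add: com_mult_left \<theta>_def)
      moreover have cB: "cj (\<theta> a) (w (Suc a)) \<in> ?B" using Lnormal t wG by blast
      ultimately have "int p dvd ex (cj (\<theta> a) (w (Suc a)) * \<theta> (Suc a))" using exK[OF sgrpD(2)[OF sgrpL cB t(2)]] by simp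
      moreover have "int p dvd ex (cj (\<theta> a) (w (Suc a)) * \<theta> (Suc a)) - ex (cj (\<theta> a) (w (Suc a))) - ex (\<theta> (Suc a))"
        by (rule ex[OF cB t(2)])
      moreover have "int p dvd ex (cj (\<theta> a) (w (Suc a))) - ex (\<theta> a) - ex (com (\<theta> a) (w (Suc a)))"
        unfolding cj_com using comL'[OF t(1) wG, of "m + 2"] by (intro ex t) auto
      moreover have "int p dvd ex (com (\<theta> a) (w (Suc a)))"
        using comL[OF _ t(1) wG] exK[of "com (\<theta> a) (w (Suc a))"] KB by (auto simp: eval_nat_numeral)
      moreover have "int p dvd r + r'" if "int p dvd c" "int p dvd c - d - r'" "int p dvd d - r - f" "int p dvd f"
        for c d r r' f :: int
        using dvd_diff[OF dvd_diff[OF dvd_diff[OF that(1,2)] that(3)] that(4)] by (simp add: algebra_simps)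
      ultimately show ?thesis by blast
    qed
    have k1: "int p dvd ex (k 1)"
    proof -
      have "com (S (Suc m)) s1 \<in> ?K" using comL[OF _ Sm1, of s1] s1 cz_G by (auto simp: eval_nat_numeral)
      then have "k 1 \<in> ?K" using sgrp_com_swap[OF sgrpL] by (auto simp: k_def S1)
      then show ?thesis using exK[OF kB[of 1]] by simp
    qed
    have slope: "int p dvd ex (k a) + (int a - 1) * ex (\<theta> a)" if "2 \<le> a" "a \<le> m" for a
      using that
    proof (induction a rule: nat_induct_at_least)
      case base
      have "int p dvd ex (\<theta> 1) + ex (\<theta> 2)" "int p dvd ex (\<theta> 1) - ex (k 1) - ex (k 2)"
        using TT[of 1] E2[of 1] m by (auto simp: numeral_2_eq_2)
      from dvd_diff[OF dvd_diff[OF this] k1] show ?case by (simp add: algebra_simps)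
    next
      case (Suc a)
      have "int p dvd int a * (ex (\<theta> a) + ex (\<theta> (Suc a)))" "int p dvd ex (\<theta> a) - ex (k a) - ex (k (Suc a))"
        "int p dvd ex (k a) + (int a - 1) * ex (\<theta> a)"
        using Suc TT[of a] E2[of a] by (auto intro: dvd_mult)
      from dvd_diff[OF dvd_diff[OF this(1,2)] this(3)] show ?case by (simp add: algebra_simps)
    qed
    have "k (c + 1) = 1" by (simp add: k_def c)
    then have "k (c + 1) \<in> ?K" using sgrpD(1)[OF sgrpL] by simp
    then have "int p dvd ex (k (c + 1))" using exK[OF kB[of "c + 1"]] c m by simp
    moreover have "int p dvd ex (k (c + 1)) + (int (c + 1) - 1) * ex (\<theta> (c + 1))" by (rule slope) (use c m in auto)
    ultimately have "int p dvd int c * ex (\<theta> (c + 1))" by (simp add: dvd_add_right_iff)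
    then have "int p dvd int c \<or> int p dvd ex (\<theta> (c + 1))" using p by (simp add: prime_dvd_mult_iff)
    then have tc: "int p dvd ex (\<theta> (c + 1))" using cp by (auto dest: dvd_imp_le)
    have step: "int p dvd ex (\<theta> (Suc a)) \<longleftrightarrow> int p dvd ex (\<theta> a)" if "1 \<le> a" "a < m" for a
      using TT[OF that] by (metis dvd_add_right_iff dvd_add_left_iff)
    have "int p dvd ex (\<theta> a) \<longleftrightarrow> int p dvd ex (\<theta> 1)" if "1 \<le> a" "a \<le> m" for a
      using that by (induction a rule: nat_induct_at_least) (auto simp: step)
    then have tall: "int p dvd ex (\<theta> a)" if "1 \<le> a" "a \<le> m" for a
      using tc that c m by (metis Suc_eq_plus1 add_leD2 le_add2 mult_2 nat_add_left_cancel_le Suc_leI cp(1))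
    have kK: "k a \<in> ?K" if "2 \<le> a" "a \<le> m" for a
    proof -
      have "int p dvd ex (k a)" using slope[OF that] tall[of a] that by (simp add: dvd_add_left_iff)
      then show ?thesis using exK[OF kB[of a]] that by simp
    qed
    have w2K: "com (w 2) g \<in> ?K" if g: "g \<in> G" for g
    proof -
      define y u where "y = com (S 2) g" and "u = com (S (m - 1)) g"
      have S2: "S 2 \<in> L 2" "S (m - 1) \<in> L (m - 1)" using SL[of 2] SL[of "m - 1"] m4 by auto
      have y: "y \<in> L 3" using comL[OF _ S2(1) g] by (simp add: y_def numeral_3_eq_3)
      have u: "u \<in> L m" using comL[OF _ S2(2) g] m4 by (simp add: u_def)
      obtain i h where h: "h \<in> L (Suc m)" "u = S m ^ i * h" by (rule layer_generator[of m "S m" u]) (use Slev[of m] m u in auto)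
      obtain i' h' where h': "h' \<in> L 4" "y = S 3 ^ i' * h'" by (rule layer_generator[of 3 "S 3" y]) (use Slev[of 3] m4 m y in auto)
      have G: "S 2 \<in> G" "S (m - 1) \<in> G" "S m \<in> G" "S 3 \<in> G" "h \<in> G" "h' \<in> G"
        using SG[of 2] SG[of "m - 1"] SG[of m] SG[of 3] h h' LinG m4 by auto
      have 1: "com (S 2) u \<in> ?K"
      proof -
        have "com (S 2) (S m ^ i) \<in> ?K" using kK[of 2] m4 by (intro comG_bilinear(4)[OF sgrpL normalisedL G(1,1,3)]) (simp add: k_def)
        moreover have "com (S 2) h \<in> ?K" using com_LL[OF S2(1) h(1)] by (simp add: eval_nat_numeral)
        ultimately show ?thesis unfolding h(2) using G sgrp_power[OF sgrpG]
          by (intro comG_bilinear(2)[OF sgrpL normalisedL]) auto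
      qed
      have 2: "com y (S (m - 1)) \<in> ?K"
      proof -
        have "com (S 3 ^ i') (S (m - 1)) \<in> ?K" using kK[of 3] m4 by (intro comG_bilinear(3)[OF sgrpL normalisedL G(4,4,2)]) (simp add: k_def)
        moreover have "com h' (S (m - 1)) \<in> ?K" using com_LL[OF h'(1) S2(2)] m4 by (simp add: add.commute)
        ultimately show ?thesis unfolding h'(2) using G sgrp_power[OF sgrpG]
          by (intro comG_bilinear(1)[OF sgrpL normalisedL]) auto
      qed
      have 3: "com y u \<in> ?K" using com_LL[OF y u] by (simp add: add.commute)
      have KA: "?K \<subseteq> ?A" using KB by blast
      have "inverse (com (S 2) u * com y (S (m - 1)) * com y u) * com (com (S 2) (S (m - 1))) g \<in> ?K"
        unfolding y_def u_def
      proof (rule com_com_expand)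
        show "com (S 2) (S (m - 1)) \<in> ?A" using wA[of 2] m4 by (simp add: w_def numeral_2_eq_2)
      qed (use 1 2 3 KA m G g in \<open>auto simp: y_def u_def\<close>)
      moreover have "inverse (com (S 2) u * com y (S (m - 1)) * com y u) \<in> ?K"
        using 1 2 3 sgrpD(2,3)[OF sgrpL] by blast
      ultimately have "com (com (S 2) (S (m - 1))) g \<in> ?K" using sgrp_mult_cancel(1)[OF sgrpL] by blast
      then show ?thesis by (simp add: w_def numeral_2_eq_2)
    qed
    have "w 2 \<in> ?B"
    proof (rule ccontr)
      assume nB: "w 2 \<notin> ?B"
      have w2: "w 2 \<in> L (Suc m)" "w 2 \<notin> L (Suc (Suc m))" using wA[of 2] m4 nB by auto
      have "L (Suc (Suc m)) \<subseteq> ?K"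
      proof (rule leastL[OF _ sgrpL])
        fix x g assume x: "x \<in> L (Suc m)" and g: "g \<in> G"
        obtain i h where h: "h \<in> L (Suc (Suc m))" "x = w 2 ^ i * h" by (rule layer_generator[OF _ _ w2 x]) (use m in auto)
        have "com h g \<in> ?K" using comL[OF _ h(1) g] by (simp add: eval_nat_numeral)
        then show "com x g \<in> ?K" unfolding h(2)
          using comG_bilinear(1)[OF sgrpL normalisedL _ _ g] comG_bilinear(3)[OF sgrpL normalisedL _ _ g w2K[OF g]]
            w2 h LinG sgrp_power[OF sgrpG] by metis
      qed simp
      then show False using L_neq[of "m + 2"] m by (auto simp: eval_nat_numeral)
    qed
    then show False using fin w1[of 2] m4 by simp
  qed
qed

text \<open>The congruence for \<open>p\<close>-th powers provides \<open>b = a\<^sup>p\<close> generating the layer \<open>m\<close>, with \<open>a\<close> of level \<open>j = m - p + 1\<close>. An element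
\<open>y\<close> of \<open>cz 2 = cz j\<close> satisfies \<open>x = [a, y] \<in> L (j + 2)\<close>. Therefore \<open>b\<close> and its conjugate \<open>(a x)\<^sup>p\<close> agree modulo
\<open>L (m + 2)\<close>, which means that \<open>y\<close> centralises the layer \<open>m\<close>.\<close>

lemma blackburn_large:
  assumes p3: "3 \<le> p" and m: "p + 1 \<le> m" "m + 3 \<le> n" and eq: "\<And>j. 2 \<le> j \<Longrightarrow> j < m \<Longrightarrow> cz j = cz 2"
  shows "cz m = cz 2"
proof -
  have m2: "2 \<le> m" using m p3 by simp
  have "\<And>H. H \<in> {cz 2, cz m, cz (m + 1)} \<Longrightarrow> sgrp H \<and> H \<subset> G"
    using sgrp_cz cz_proper[of 2] cz_proper[of m] cz_proper[of "m + 1"] m m2 by auto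
  moreover have "card {cz 2, cz m, cz (m + 1)} \<le> p"
    using p3 card_insert_le_m1[of 3 "{cz m, cz (m+1)}" "cz 2"] card_insert_le_m1[of 2 "{cz (m+1)}" "cz m"] by simp
  ultimately obtain s where s: "s \<in> G" "\<And>H. H \<in> {cz 2, cz m, cz (m + 1)} \<Longrightarrow> s \<notin> H"
    using avoid_subgroups[of "{cz 2, cz m, cz (m + 1)}"] by blast
  define q where "q = m + 2"
  have q: "3 \<le> q" "q < n" using m m2 by (auto simp: q_def)
  have sn: "s \<notin> cz j" if "2 \<le> j" "j < q" for j
  proof -
    have "j < m \<or> j = m \<or> j = m + 1" using that by (auto simp: q_def)
    then show ?thesis using s eq[of j] that by auto
  qed
  note pw = filtration_L_iter_com[OF s(1) q sn]
  \<comment> \<open>the level that \<open>p\<close>-th powers carry to level \<open>m\<close>\<close>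
  define j where "j = m - p + 1"
  have j: "2 \<le> j" "j + p = m + 1" "j < m" using m p3 by (auto simp: j_def)
  obtain a where a: "a \<in> L j" "a \<notin> L (Suc j)" using L_neq[of j] j m by auto
  define b where "b = a ^ p"
  have ic: "iter_com a s (p - 1) \<in> L m" "iter_com a s (p - 1) \<notin> L (Suc m)"
    using iter_com_level[OF s(1) j(1) a, of "p - 1"] sn j m p3 by (auto simp: q_def)
  have bi: "b * iter_com a s (p - 1) \<in> L (m + 1)"
    using pw(1)[OF _ _ a(1) j(1)] j by (simp add: b_def q_def)
  have b: "b \<in> L m" "b \<notin> L (Suc m)"
  proof -
    have "b * iter_com a s (p - 1) \<in> L m" using bi LSuc by auto
    then show "b \<in> L m" using sgrp_mult_cancel(2)[OF sgrpL ic(1)] by blast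
    show "b \<notin> L (Suc m)" using bi ic(2) sgrp_mult_cancel(1)[OF sgrpL, of b "Suc m"] by auto
  qed
  have "cz 2 \<subseteq> cz m"
  proof
    fix y assume y: "y \<in> cz 2"
    have yG: "y \<in> G" and aG: "a \<in> G" using y cz_G a LinG by auto
    define x where "x = com a y"
    have x: "x \<in> L (j + 2)" using czD[of y j a] y eq[of j] j a by (simp add: x_def)
    let ?\<Phi> = "\<lambda>w. L (min w q)"
    have jq: "j + 2 \<le> q" using j p3 by (simp add: q_def)
    have xa: "x \<in> ?\<Phi> (j + 2)" "inverse a \<in> ?\<Phi> 1" "inverse a \<in> ?\<Phi> 2"
      using x jq aG L1 q sgrpD(3)[OF sgrpL a(1)] Lmono[of 2 j] j sgrpD(3)[OF sgrpG]
      by (auto simp: min_absorb1)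
    define t where "t = twisted_norm (inverse a) x p"
    have tc: "inverse (x ^ p) * t * inverse (iter_com x (inverse a) (p - 1)) \<in> ?\<Phi> (j + 2 + p)"
      unfolding t_def
    proof (rule twisted_norm_cong[OF filtration_L_trunc xa(2,1) _ p])
      fix u assume u: "u \<in> ?\<Phi> (Suc (j + 2))"
      show "u ^ p \<in> ?\<Phi> (j + 2 + p)"
      proof (cases "j + 3 \<le> q")
        case True
        then have "u \<in> L (j + 3)" using u by (simp add: min_absorb1 eval_nat_numeral)
        from pw(2)[OF _ _ this] show ?thesis by (simp add: eval_nat_numeral)
      next
        case False
        then have "u \<in> L q" using u by (simp add: min_def split: if_splits)
        then show ?thesis using sgrp_power[OF sgrpL] Lmono[of "min (j + 2 + p) q" q] by auto
      qed
    qed simp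
    have "j + 2 + p \<ge> q" using j by (simp add: q_def)
    then have tc: "inverse (x ^ p) * t * inverse (iter_com x (inverse a) (p - 1)) \<in> L q"
      using tc by (simp add: min_absorb2)
    have xp: "x ^ p \<in> L q" using pw(2)[OF _ _ x] j by (simp add: q_def min_absorb2)
    have "iter_com x (inverse a) (p - 1) \<in> ?\<Phi> (j + 2 + 2 * (p - 1))"
      by (rule iter_com_filtration[OF filtration_L_trunc xa(3,1)])
    moreover have "j + 2 + 2 * (p - 1) \<ge> q" using j p3 by (simp add: q_def)
    ultimately have ix: "iter_com x (inverse a) (p - 1) \<in> L q" by (simp add: min_absorb2)
    have "inverse (x ^ p) * t \<in> L q" using tc sgrp_mult_cancel(2)[OF sgrpL sgrpD(3)[OF sgrpL ix]] by blast
    then have t: "t \<in> L q" using sgrp_mult_cancel(1)[OF sgrpL sgrpD(3)[OF sgrpL xp]] by blast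
    have xap: "(x * a) ^ p = t * b"
      by (simp add: t_def twisted_norm_def b_def mg_inverse_power[symmetric] mult.assoc)
    have "cj b y = (a * x) ^ p" by (simp only: b_def cj_power x_def cj_com[of a y])
    also have "a * x = cj (x * a) (inverse a)" by (simp add: cj_def mult.assoc)
    also have "\<dots> ^ p = cj (t * b) (inverse a)" by (simp only: cj_power[symmetric] xap)
    also have "\<dots> = cj t (inverse a) * b"
    proof -
      have "cj b (inverse a) = b" by (simp add: b_def cj_power) (simp add: cj_def mult.assoc)
      then show ?thesis by (simp add: cj_mult)
    qed
    also have "\<dots> = b * cj (cj t (inverse a)) b" by (simp add: cj_def mult.assoc)
    finally have "com b y = cj (cj t (inverse a)) b" by (simp add: cj_com)
    moreover have "cj (cj t (inverse a)) b \<in> L q"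
      using t aG b LinG sgrpD(3)[OF sgrpG] by (intro Lnormal) auto
    ultimately show "y \<in> cz m" using czI1[OF yG m2 _ b] m by (simp add: q_def)
  qed
  then show ?thesis using cz_eqI[of 2 m] m m2 by simp
qed

theorem blackburn:
  assumes "3 \<le> p" "2 \<le> m" "m + 3 \<le> n"
  shows "cz m = cz 2"
  using assms(2,3)
proof (induction m rule: less_induct)
  case (less m)
  have IH: "cz j = cz 2" if "2 \<le> j" "j < m" for j
    by (rule less.IH) (use that less.prems in linarith)+
  consider "m = 2" | "3 \<le> m" "m \<le> p" | "p + 1 \<le> m" using less.prems by linarith
  then show ?case
  proof cases
    case 2
    show ?thesis by (rule blackburn_odd_or_small[OF 2(1) less.prems(2) IH disjI2[OF 2(2)]])
  next
    case 3 show ?thesis by (rule blackburn_large[OF assms(1) 3 less.prems(2) IH])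
  qed simp
qed

section \<open>Levels of elements of order \<open>p\<close>\<close>

text \<open>If \<open>e\<^sup>p = 1\<close>, the congruence for \<open>p\<close>-th powers puts \<open>[e, s, \<dots>, s]\<close>, with \<open>p - 1\<close> factors \<open>s\<close>, into \<open>L (i + p)\<close>; but for
uniserial \<open>s\<close> it has level exactly \<open>i + p - 1\<close>. So this level is the last one or beyond.\<close>

lemma order_p_at_level:
  assumes p3: "3 \<le> p" and i: "2 \<le> i" "i < n" and e: "e \<in> L i" "e \<notin> L (Suc i)" "e ^ p = 1"
  shows "n \<le> i + p"
proof (rule ccontr)
  assume "\<not> n \<le> i + p"
  then have ip: "i + p \<le> n - 1" "4 \<le> n" using i p3 by auto
  have c2: "cz (n - 2) \<subset> G" by (rule cz_proper) (use ip in auto)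
  have "\<And>H. H \<in> {cz 2, cz (n - 2)} \<Longrightarrow> sgrp H \<and> H \<subset> G"
    using sgrp_cz cz_proper[of 2] c2 ip by auto
  moreover have "card {cz 2, cz (n - 2)} \<le> p"
    using p3 card_insert_le_m1[of 2 "{cz (n - 2)}" "cz 2"] by simp
  ultimately obtain s where s: "s \<in> G" "\<And>H. H \<in> {cz 2, cz (n - 2)} \<Longrightarrow> s \<notin> H"
    using avoid_subgroups[of "{cz 2, cz (n - 2)}"] by blast
  have sn: "s \<notin> cz j" if "2 \<le> j" "j < n - 1" for j
  proof -
    have "j + 3 \<le> n \<or> j = n - 2" using that by auto
    then show ?thesis using s blackburn[OF p3, of j] that by auto
  qed
  have "e ^ p * iter_com e s (p - 1) \<in> L (min (i + p) (n - 1))"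
    using filtration_L_iter_com(1)[where q = "n - 1", OF s(1) _ _ sn e(1) i(1)] ip by simp
  then have "iter_com e s (p - 1) \<in> L (i + p)" using e(3) ip by (simp add: min_absorb1)
  moreover have "iter_com e s (p - 1) \<notin> L (Suc (i + (p - 1)))"
  proof -
    have "i + (p - 1) \<le> n" using ip by linarith
    moreover have "s \<notin> cz j" if "i \<le> j" "j < i + (p - 1)" for j
      by (rule sn) (use that i ip in linarith)+
    ultimately show ?thesis using iter_com_level[OF s(1) i(1) e(1,2), of "p - 1"] by blast
  qed
  ultimately show False using p3 by simp
qed

lemma iter_com_Suc_shift: "iter_com a s (Suc k) = iter_com (com a s) s k"
  by (induction k) auto

text \<open>For an element of \<open>cz 2\<close> outside \<open>L 2\<close> the same argument is applied to a filtration in which \<open>s\<close> still has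
weight 1, while the weight of \<open>cz 2\<close> is raised to 2. It is a filtration because the series starting with
\<open>cz 2\<close> has positive degree of commutativity, which requires that also the last two-step
centraliser is \<open>cz 2\<close>.\<close>

lemma order_p_at_level_1:
  assumes p3: "3 \<le> p" and n4: "4 \<le> n" and e: "e \<in> cz 2" "e \<notin> L 2" "e ^ p = 1" and c: "cz 2 \<subseteq> cz (n - 2)"
  shows "n \<le> 1 + p"
proof (rule ccontr)
  assume "\<not> n \<le> 1 + p"
  then have pn: "p + 1 \<le> n - 1" by simp
  obtain s where s: "s \<in> G" "s \<notin> cz 2" using cz_proper[of 2] n4 by auto
  have cn: "cz (n - 2) = cz 2" using cz_eqI[OF _ _ _ _ c] n4 by simp
  have call: "cz j = cz 2" if "2 \<le> j" "j < n - 1" for j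
  proof -
    have "j + 3 \<le> n \<or> j = n - 2" using that by auto
    then show ?thesis using blackburn[OF p3, of j] cn that by auto
  qed
  \<comment> \<open>weights are shifted by one: \<open>cz 2\<close> has weight 2, and \<open>L (w - 1)\<close> has weight \<open>w\<close>\<close>
  define \<Phi> where "\<Phi> w = (if w \<le> 1 then G else \<Lambda> (min (w - 1) (n - 1)))" for w :: nat
  have \<Phi>G: "\<Phi> w \<subseteq> G" for w using \<Lambda>_L LG by (auto simp: \<Phi>_def)
  have \<Phi>L': "L k \<subseteq> \<Phi> w" if "2 \<le> k" "min (w - 1) (n - 1) \<le> k" for w k
  proof (cases "w \<le> 1 \<or> min (w - 1) (n - 1) = 1")
    case True
    then show ?thesis using LG L2_cz[of 2] Lmono[OF that(1)] by (auto simp: \<Phi>_def \<Lambda>_def)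
  next
    case False
    then show ?thesis using Lmono[OF that(2)] by (auto simp: \<Phi>_def \<Lambda>_def)
  qed
  have sgP: "sgrp (\<Phi> w)" for w using sgrpG sgrp_\<Lambda> by (simp add: \<Phi>_def)
  have nP: "normalised G (\<Phi> w)" for w
    using normalised_\<Lambda> sgrp_cj[OF sgrpG] by (simp add: \<Phi>_def normalised_def)
  have com1: "com x g \<in> \<Phi> (Suc w)" if "x \<in> \<Phi> w" "g \<in> G" for x g w
  proof (cases "w \<le> 1")
    case True
    have "com x g \<in> L 2" using comL[of 1 x g] that \<Phi>G L1 by (auto simp: numeral_2_eq_2)
    then show ?thesis using \<Phi>L'[of 2 "Suc w"] True by (auto simp: min_le_iff_disj)
  next
    case False
    let ?k = "min (w - 1) (n - 1)"
    have "?k \<ge> 1" using False n4 by linarith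
    then have "com x g \<in> L (Suc ?k)" using com_\<Lambda>[of ?k x g] that False by (simp add: \<Phi>_def)
    moreover have "L (Suc ?k) \<subseteq> \<Phi> (Suc w)"
      by (rule \<Phi>L') (use \<open>?k \<ge> 1\<close> False in linarith)+
    ultimately show ?thesis by blast
  qed
  have fil: "filtration \<Phi>"
    unfolding filtration_def
  proof (intro conjI allI ballI sgP)
    fix w
    show "\<Phi> (Suc w) \<subseteq> \<Phi> w"
    proof (cases "w \<le> 1")
      case True then show ?thesis using \<Phi>G by (simp add: \<Phi>_def[of w])
    next
      case False
      then have w2: "min w (n - 1) \<ge> 2" using n4 by linarith
      then have "\<Phi> (Suc w) = L (min w (n - 1))" using False \<Lambda>_simps(1)[OF w2] by (simp add: \<Phi>_def)
      moreover have "L (min w (n - 1)) \<subseteq> \<Phi> w"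
        by (rule \<Phi>L') (use \<open>min w (n - 1) \<ge> 2\<close> in linarith)+
      ultimately show ?thesis by simp
    qed
  next
    fix w v x y assume x: "x \<in> \<Phi> w" and y: "y \<in> \<Phi> v"
    have xG: "x \<in> G" "y \<in> G" using x y \<Phi>G by auto
    have 0: "com u g \<in> \<Phi> k" if "u \<in> \<Phi> k" "g \<in> G" for u g k
      using that normalisedD[OF nP that] sgrp_cj_iff[OF sgP] by blast
    consider "w = 0" | "v = 0" | "w = 1" | "v = 1" | "2 \<le> w" "2 \<le> v" by linarith
    then show "com x y \<in> \<Phi> (w + v)"
    proof cases
      case 1 then show ?thesis using 0[OF y xG(1)] sgrp_com_swap[OF sgP] by auto
    next
      case 2 then show ?thesis using 0[OF x xG(2)] by auto
    next
      case 3 then show ?thesis using com1[OF y xG(1)] sgrp_com_swap[OF sgP] by auto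
    next
      case 4 then show ?thesis using com1[OF x xG(2)] by auto
    next
      case 5
      let ?a = "min (w - 1) (n - 1)" and ?b = "min (v - 1) (n - 1)"
      have "com x y \<in> L (min (?a + ?b + 1) (n - 1))"
      proof (rule com_\<Lambda>\<Lambda>[OF n4])
        show "cz 2 \<subseteq> cz j" if "2 \<le> j" "j + 2 \<le> n - 1" for j using call[of j] that by simp
        show "x \<in> \<Lambda> ?a" "y \<in> \<Lambda> ?b" using x y 5 by (auto simp: \<Phi>_def)
      qed (use 5 n4 in linarith)+
      moreover have "L (min (?a + ?b + 1) (n - 1)) \<subseteq> \<Phi> (w + v)"
        by (rule \<Phi>L') (use 5 n4 in linarith)+
      ultimately show ?thesis by blast
    qed
  qed
  have bot: "\<Phi> w = L (n - 1)" if "w \<ge> n" for w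
  proof -
    have "min (w - 1) (n - 1) = n - 1" using that by simp
    then show ?thesis using that n4 \<Lambda>_simps(1)[of "n - 1"] by (simp add: \<Phi>_def)
  qed
  have \<Phi>2: "\<Phi> 2 = cz 2" using n4 \<Lambda>_simps(2) by (simp add: \<Phi>_def min_absorb1)
  have nrm: "twisted_norm s a p \<in> L (n - 1)" if "a \<in> \<Phi> 2" for a
  proof (rule twisted_norm_in[OF s(1)])
    have a: "a \<in> cz 2" using that \<Phi>2 by simp
    then show "a \<in> G" using cz_G by blast
    fix j assume j: "2 \<le> j" "j < n - 1"
    show "s \<notin> cz j" using call[OF j] s by simp
    show "a * inverse s \<notin> cz j"
      unfolding call[OF j] using s a sgrp_mult_cancel(1)[OF sgrp_cz a] sgrp_inverse_iff[OF sgrp_cz] by metis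
  qed (use n4 in auto)
  have e2: "e \<in> \<Phi> 2" "s \<in> \<Phi> 1" using e s \<Phi>2 by (auto simp: \<Phi>_def)
  have "e ^ p * iter_com e s (p - 1) \<in> \<Phi> (2 + p)"
    using power_iter_com(1)[OF fil e2(2) p bot nrm e2(1)] by simp
  moreover have "\<Phi> (2 + p) = L (p + 1)" using pn p3 \<Lambda>_simps(1)[of "p + 1"] by (simp add: \<Phi>_def min_absorb1)
  ultimately have "iter_com e s (p - 1) \<in> L (p + 1)" using e(3) by simp
  moreover have "iter_com e s (p - 1) \<notin> L (p + 1)"
  proof -
    define k where "k = p - 2"
    have k: "p = Suc (Suc k)" using p3 by (simp add: k_def)
    have es: "com e s \<in> L 2" "com e s \<notin> L (Suc 2)"
      using com_level1[OF _ _ s e(1,2)] n4 by (auto simp: numeral_3_eq_3 numeral_2_eq_2)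
    have "s \<notin> cz j" if "2 \<le> j" "j < 2 + k" for j
    proof -
      have "j < n - 1" using that k pn by linarith
      then show ?thesis using call[of j] that(1) s(2) by metis
    qed
    moreover have "2 + k \<le> n" using k pn by linarith
    ultimately have "iter_com (com e s) s k \<notin> L (Suc (2 + k))"
      using iter_com_level[OF s(1) order.refl es, of k] by blast
    then show ?thesis using k iter_com_Suc_shift[of e s k] by simp
  qed
  ultimately show False by blast
qed

end

section \<open>Additive subgroups and products of subgroups\<close>

definition add_subgroup :: "'w :: comm_ring_1 set \<Rightarrow> bool"
  where "add_subgroup W \<longleftrightarrow> 0 \<in> W \<and> (\<forall>x\<in>W. \<forall>y\<in>W. x - y \<in> W)"

lemma add_subgroupD:
  assumes "add_subgroup W"
  shows "0 \<in> W" "x \<in> W \<Longrightarrow> y \<in> W \<Longrightarrow> x - y \<in> W" "x \<in> W \<Longrightarrow> - x \<in> W" "x \<in> W \<Longrightarrow> y \<in> W \<Longrightarrow> x + y \<in> W"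
proof -
  have d: "x - y \<in> W" if "x \<in> W" "y \<in> W" for x y using assms that by (auto simp: add_subgroup_def)
  show 0: "0 \<in> W" using assms by (simp add: add_subgroup_def)
  have m: "- x \<in> W" if "x \<in> W" for x using d[OF 0 that] by simp
  show "x \<in> W \<Longrightarrow> y \<in> W \<Longrightarrow> x - y \<in> W" "x \<in> W \<Longrightarrow> - x \<in> W" using d m by auto
  show "x \<in> W \<Longrightarrow> y \<in> W \<Longrightarrow> x + y \<in> W" using d[of x "- y"] m[of y] by simp
qed

lemma add_subgroup_of_nat: "add_subgroup W \<Longrightarrow> x \<in> W \<Longrightarrow> of_nat k * x \<in> W"
  by (induction k) (auto simp: algebra_simps intro: add_subgroupD)

lemma add_subgroup_numeral: "add_subgroup W \<Longrightarrow> x \<in> W \<Longrightarrow> numeral k * x \<in> W"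
  using add_subgroup_of_nat[of W x "numeral k"] by simp

definition splus :: "'w :: comm_ring_1 set \<Rightarrow> 'w set \<Rightarrow> 'w set"
  where "splus S T = {x + y | x y. x \<in> S \<and> y \<in> T}"

lemma add_subgroup_splus: "add_subgroup S \<Longrightarrow> add_subgroup T \<Longrightarrow> add_subgroup (splus S T)"
  unfolding add_subgroup_def[of "splus S T"]
proof (intro conjI ballI)
  assume ST: "add_subgroup S" "add_subgroup T"
  show "0 \<in> splus S T" using ST add_subgroupD(1) by (force simp: splus_def)
  fix a b assume "a \<in> splus S T" "b \<in> splus S T"
  then obtain x y x' y' where *: "a = x + y" "b = x' + y'" "x \<in> S" "x' \<in> S" "y \<in> T" "y' \<in> T" by (auto simp: splus_def)
  then have "a - b = (x - x') + (y - y')" by simp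
  then show "a - b \<in> splus S T" using * ST add_subgroupD(2) unfolding splus_def by blast
qed

lemma splus_upper: "add_subgroup S \<Longrightarrow> add_subgroup T \<Longrightarrow> S \<subseteq> splus S T" "add_subgroup S \<Longrightarrow> add_subgroup T \<Longrightarrow> T \<subseteq> splus S T"
  unfolding splus_def by (auto dest!: add_subgroupD(1)) (metis add.right_neutral, metis add.left_neutral)

lemma splus_least: "add_subgroup Z \<Longrightarrow> S \<subseteq> Z \<Longrightarrow> T \<subseteq> Z \<Longrightarrow> splus S T \<subseteq> Z"
  by (auto simp: splus_def intro: add_subgroupD)

lemma card_le_fibres:
  assumes "finite S" "finite T" "f ` S \<subseteq> T" "\<And>y. y \<in> T \<Longrightarrow> card {x \<in> S. f x = y} \<le> k"
  shows "card S \<le> card T * k"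
proof -
  have "S = (\<Union>y\<in>T. {x \<in> S. f x = y})" using assms(3) by auto
  then have "card S \<le> (\<Sum>y\<in>T. card {x \<in> S. f x = y})" using card_UN_le[OF assms(2)] by metis
  also have "\<dots> \<le> (\<Sum>y\<in>T. k)" by (rule sum_mono[OF assms(4)])
  finally show ?thesis by simp
qed

lemma card_splus:
  assumes "add_subgroup S" "add_subgroup T" "finite S" "finite T"
  shows "card S * card T \<le> card (splus S T) * card (S \<inter> T)"
proof -
  have fin: "finite (splus S T)"
  proof -
    have "splus S T = (\<lambda>(x, y). x + y) ` (S \<times> T)" by (auto simp: splus_def)
    then show ?thesis using assms by simp
  qed
  have "card (S \<times> T) \<le> card (splus S T) * card (S \<inter> T)"
  proof (rule card_le_fibres[where f = "\<lambda>(x, y). x + y"])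
    fix z assume "z \<in> splus S T"
    then obtain x y where xy: "z = x + y" "x \<in> S" "y \<in> T" by (auto simp: splus_def)
    have "inj_on (\<lambda>(a, b). a - x) {u \<in> S \<times> T. (\<lambda>(x, y). x + y) u = z}"
      by (auto simp: inj_on_def)
    moreover have "(\<lambda>(a, b). a - x) ` {u \<in> S \<times> T. (\<lambda>(x, y). x + y) u = z} \<subseteq> S \<inter> T"
    proof
      fix w assume "w \<in> (\<lambda>(a, b). a - x) ` {u \<in> S \<times> T. (\<lambda>(x, y). x + y) u = z}"
      then obtain a b where ab: "w = a - x" "a \<in> S" "b \<in> T" "a + b = z" by auto
      then have "a - x = y - b" using xy by (simp add: algebra_simps)
      then show "w \<in> S \<inter> T" using ab xy assms add_subgroupD(2) by (metis IntI)
    qed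
    ultimately show "card {u \<in> S \<times> T. (\<lambda>(x, y). x + y) u = z} \<le> card (S \<inter> T)"
      using assms by (intro card_inj_on_le) auto
  qed (use assms fin in \<open>auto simp: splus_def\<close>)
  then show ?thesis by (simp add: card_cartesian_product)
qed

definition sprod :: "'a :: mgroup set \<Rightarrow> 'a set \<Rightarrow> 'a set"
  where "sprod S T = {x * y | x y. x \<in> S \<and> y \<in> T}"

lemma sprod_upper: "sgrp S \<Longrightarrow> sgrp T \<Longrightarrow> S \<subseteq> sprod S T" "sgrp S \<Longrightarrow> sgrp T \<Longrightarrow> T \<subseteq> sprod S T"
  unfolding sprod_def by (auto dest!: sgrpD(1)) (metis mult.right_neutral, metis mult.left_neutral)

lemma sgrp_sprod:
  assumes "sgrp S" "sgrp T" "\<And>x y. x \<in> S \<Longrightarrow> y \<in> T \<Longrightarrow> x * y = y * x"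
  shows "sgrp (sprod S T)"
  unfolding sgrp_def
proof (intro conjI ballI)
  show "1 \<in> sprod S T" using assms sgrpD(1) by (force simp: sprod_def)
  fix a assume "a \<in> sprod S T"
  then obtain x y where xy: "a = x * y" "x \<in> S" "y \<in> T" by (auto simp: sprod_def)
  have "inverse a = inverse x * inverse y" using xy assms(3)[of x y] by (metis mg_inverse_mult)
  then show "inverse a \<in> sprod S T" using xy assms sgrpD(3) unfolding sprod_def by blast
  fix b assume "b \<in> sprod S T"
  then obtain x' y' where xy': "b = x' * y'" "x' \<in> S" "y' \<in> T" by (auto simp: sprod_def)
  have "a * b = x * (y * x') * y'" using xy xy' by (simp add: mult.assoc)
  also have "\<dots> = x * (x' * y) * y'" using assms(3)[OF xy'(2) xy(3)] by simp
  also have "\<dots> = (x * x') * (y * y')" by (simp add: mult.assoc)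
  finally show "a * b \<in> sprod S T" using xy xy' assms sgrpD(2) unfolding sprod_def by blast
qed

lemma card_sprod:
  assumes "sgrp S" "sgrp T" "finite S" "finite T"
  shows "card S * card T \<le> card (sprod S T) * card (S \<inter> T)"
proof -
  have fin: "finite (sprod S T)"
  proof -
    have "sprod S T = (\<lambda>(x, y). x * y) ` (S \<times> T)" by (auto simp: sprod_def)
    then show ?thesis using assms by simp
  qed
  have "card (S \<times> T) \<le> card (sprod S T) * card (S \<inter> T)"
  proof (rule card_le_fibres[where f = "\<lambda>(x, y). x * y"])
    fix z assume "z \<in> sprod S T"
    then obtain x y where xy: "z = x * y" "x \<in> S" "y \<in> T" by (auto simp: sprod_def)
    have "inj_on (\<lambda>(a, b). inverse x * a) {u \<in> S \<times> T. (\<lambda>(x, y). x * y) u = z}"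
      by (auto simp: inj_on_def)
    moreover have "(\<lambda>(a, b). inverse x * a) ` {u \<in> S \<times> T. (\<lambda>(x, y). x * y) u = z} \<subseteq> S \<inter> T"
    proof
      fix w assume "w \<in> (\<lambda>(a, b). inverse x * a) ` {u \<in> S \<times> T. (\<lambda>(x, y). x * y) u = z}"
      then obtain a b where ab: "w = inverse x * a" "a \<in> S" "b \<in> T" "a * b = z" by auto
      then have "a * b * inverse b = x * y * inverse b" using xy by simp
      then have "a = x * (y * inverse b)" by (simp add: mult.assoc)
      then have "inverse x * a = y * inverse b" by simp
      then show "w \<in> S \<inter> T" using ab xy assms sgrpD(2,3) by (metis IntI)
    qed
    ultimately show "card {u \<in> S \<times> T. (\<lambda>(x, y). x * y) u = z} \<le> card (S \<inter> T)"
      using assms by (intro card_inj_on_le) auto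
  qed (use assms fin in \<open>auto simp: sprod_def\<close>)
  then show ?thesis by (simp add: card_cartesian_product)
qed

section \<open>Faithful modules and quadratic elements\<close>

text \<open>The ring multiplication on the ambient type is only used to write multiples by numerals; \<open>V\<close> is a vector space
over the field with \<open>p\<close> elements because \<open>p\<close> annihilates it.\<close>

locale faithful_module =
  fixes G :: "'a :: mgroup set" and V :: "'w :: comm_ring_1 set" and act :: "'a \<Rightarrow> 'w \<Rightarrow> 'w" and p :: nat
  assumes p: "Factorial_Ring.prime p" and sgrpG: "sgrp G" and finG: "finite G"
    and V: "add_subgroup V" and finV: "finite V" and torsion: "v \<in> V \<Longrightarrow> of_nat p * v = 0"
    and act_V: "g \<in> G \<Longrightarrow> v \<in> V \<Longrightarrow> act g v \<in> V"
    and act_add: "g \<in> G \<Longrightarrow> v \<in> V \<Longrightarrow> w \<in> V \<Longrightarrow> act g (v + w) = act g v + act g w"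
    and act_mult: "g \<in> G \<Longrightarrow> h \<in> G \<Longrightarrow> v \<in> V \<Longrightarrow> act (g * h) v = act g (act h v)"
    and act_one: "v \<in> V \<Longrightarrow> act 1 v = v"
    and faithful: "g \<in> G \<Longrightarrow> (\<And>v. v \<in> V \<Longrightarrow> act g v = v) \<Longrightarrow> g = 1"
begin

definition D :: "'a \<Rightarrow> 'w \<Rightarrow> 'w"
  where "D g v = act g v - v"

text \<open>Elements acting trivially are included; for a faithful module that is only the identity.\<close>

definition quad :: "'a \<Rightarrow> bool"
  where "quad g \<longleftrightarrow> (\<forall>v\<in>V. D g (D g v) = 0)"

lemma act_D: "act g v = v + D g v"
  by (simp add: D_def)

lemma act_0: "g \<in> G \<Longrightarrow> act g 0 = 0"
  using act_add[of g 0 0] add_subgroupD(1)[OF V] by simp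

lemma act_diff: "g \<in> G \<Longrightarrow> v \<in> V \<Longrightarrow> w \<in> V \<Longrightarrow> act g (v - w) = act g v - act g w"
  using act_add[of g "v - w" w] add_subgroupD(2)[OF V, of v w] by simp

lemma D_V: "g \<in> G \<Longrightarrow> v \<in> V \<Longrightarrow> D g v \<in> V"
  using act_V add_subgroupD(2)[OF V] by (simp add: D_def)

lemma D_add: "g \<in> G \<Longrightarrow> v \<in> V \<Longrightarrow> w \<in> V \<Longrightarrow> D g (v + w) = D g v + D g w"
  by (simp add: D_def act_add)

lemma D_0: "g \<in> G \<Longrightarrow> D g 0 = 0"
  by (simp add: D_def act_0)

lemma D_diff: "g \<in> G \<Longrightarrow> v \<in> V \<Longrightarrow> w \<in> V \<Longrightarrow> D g (v - w) = D g v - D g w"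
  by (simp add: D_def act_diff)

lemma D_of_nat: "g \<in> G \<Longrightarrow> v \<in> V \<Longrightarrow> D g (of_nat k * v) = of_nat k * D g v"
  by (induction k) (simp_all add: D_0 distrib_right D_add add_subgroup_of_nat[OF V])

lemma D_numeral: "g \<in> G \<Longrightarrow> v \<in> V \<Longrightarrow> D g (numeral k * v) = numeral k * D g v"
  using D_of_nat[of g v "numeral k"] by simp

lemma D_commute: "g \<in> G \<Longrightarrow> h \<in> G \<Longrightarrow> g * h = h * g \<Longrightarrow> v \<in> V \<Longrightarrow> D g (D h v) = D h (D g v)"
  by (simp add: D_def act_diff act_V flip: act_mult)

lemma torsion_cancel: "v \<in> V \<Longrightarrow> of_nat k * v = 0 \<Longrightarrow> coprime k p \<Longrightarrow> v = 0"
proof -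
  assume v: "v \<in> V" and k: "of_nat k * v = 0" and c: "coprime k p"
  show "v = 0"
  proof (cases "k = 0")
    case True then show ?thesis using c p by (simp add: coprime_0_left_iff prime_nat_iff)
  next
    case False
    then obtain x y where "k * x = p * y + 1" using bezout_nat[of k p] c by auto
    then have "of_nat (k * x) * v = of_nat (p * y + 1) * v" by simp
    then have "of_nat x * (of_nat k * v) = of_nat y * (of_nat p * v) + v" by (simp add: algebra_simps)
    then show ?thesis using k torsion[OF v] by simp
  qed
qed

lemma D_cj:
  assumes "a \<in> G" "g \<in> G" "w \<in> V"
  shows "D (cj a g) w = act (inverse g) (D a (act g w))"
proof -
  have ig: "inverse g \<in> G" using assms sgrpG by (simp add: sgrpD)
  have "act (inverse g) (act g w) = w" using assms ig act_mult[of "inverse g" g w] act_one by simp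
  then show ?thesis
    using assms ig sgrpG by (simp add: D_def cj_def act_mult act_diff act_V sgrpD)
qed

lemma act_cancel: "g \<in> G \<Longrightarrow> w \<in> V \<Longrightarrow> act g (act (inverse g) w) = w"
  and act_cancel': "g \<in> G \<Longrightarrow> w \<in> V \<Longrightarrow> act (inverse g) (act g w) = w"
  using act_mult[of g "inverse g" w] act_mult[of "inverse g" g w] act_one sgrpD(3)[OF sgrpG] by auto

lemma quad_cj:
  assumes "quad a" "a \<in> G" "g \<in> G"
  shows "quad (cj a g)"
  unfolding quad_def
proof
  fix v assume v: "v \<in> V"
  have ig: "inverse g \<in> G" using assms sgrpG by (simp add: sgrpD)
  show "D (cj a g) (D (cj a g) v) = 0"
    using assms v ig act_V D_V act_0 act_cancel by (simp add: D_cj) (simp add: quad_def)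
qed

lemma act_quad_power:
  assumes "quad a" "a \<in> G" and v: "v \<in> V"
  shows "act (a ^ k) v = v + of_nat k * D a v"
  proof (induction k)
    case 0 then show ?case using act_one v by simp
  next
    case (Suc k)
    have "act (a ^ Suc k) v = act a (act (a ^ k) v)"
      using act_mult[OF assms(2) sgrp_power[OF sgrpG assms(2)] v] by simp
    also have "\<dots> = act a v + act a (of_nat k * D a v)"
      using Suc v assms D_V add_subgroup_of_nat[OF V] by (simp add: act_add)
    also have "act a (of_nat k * D a v) = of_nat k * D a v"
      using D_of_nat[OF assms(2) D_V[OF assms(2) v], of k] assms(1) v by (simp add: act_D[of a] quad_def)
    finally show ?case by (simp add: act_D[of a] algebra_simps)
  qed

lemma quad_power_p: assumes "quad a" "a \<in> G" shows "a ^ p = 1"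
proof (rule faithful)
  show "a ^ p \<in> G" using assms sgrpG sgrp_power by blast
  fix v assume v: "v \<in> V"
  have "act (a ^ p) v = v + of_nat p * D a v" by (rule act_quad_power[OF assms v])
  then show "act (a ^ p) v = v" using torsion[OF D_V[OF assms(2) v]] by simp
qed

text \<open>With \<open>x = a c\<close> and \<open>y = a c\<^sup>2\<close> one has \<open>a y = x\<^sup>2\<close>, that is, \<open>D a + D y + D a D y = 2 D x\<close>. Multiplying this relation by \<open>D a\<close>,
\<open>D y\<close> and \<open>D x\<close>, whose squares vanish, shows that the mixed products vanish, because 2 is invertible. Then \<open>D c = D x - D a\<close>
has square zero.\<close>

lemma quad_progression_2:
  assumes p2: "p \<noteq> 2" and G: "a \<in> G" "c \<in> G" and cm: "a * c = c * a"
    and q: "quad a" "quad (a * c)" "quad (a * c * c)"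
  shows "quad c" and "\<And>v. v \<in> V \<Longrightarrow> D a (D c v) = 0"
proof -
  define x y where "x = a * c" and "y = a * c * c"
  have xyG: "x \<in> G" "y \<in> G" using G sgrpG by (auto simp: x_def y_def sgrpD)
  have cm': "a * x = x * a" "a * y = y * a" "x * y = y * x"
    using cm by (simp_all add: x_def y_def) (metis mult.assoc)+
  have rel: "a * y = x * x" using cm by (simp add: x_def y_def) (metis mult.assoc)
  define A B C where "A v = D a (D x v)" and "B v = D a (D y v)" and "C v = D x (D y v)" for v
  note Vs = D_V add_subgroupD(4)[OF V] add_subgroup_numeral[OF V] G xyG
  note sq = q[unfolded quad_def, folded y_def, folded x_def, rule_format]
  have com: "D x (D a v) = D a (D x v)" "D y (D a v) = D a (D y v)" "D y (D x v) = D x (D y v)" if "v \<in> V" for v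
    using D_commute cm' Vs that by metis+
  have R: "D a v + D y v + D a (D y v) = 2 * D x v" if v: "v \<in> V" for v
  proof -
    have "act a (act y v) = act x (act x v)" using rel v Vs by (simp flip: act_mult)
    then have "v + D y v + (D a v + D a (D y v)) = v + D x v + (D x v + D x (D x v))"
      using v Vs by (simp add: act_D[of a] act_D[of x] act_D[of y] D_add)
    then show ?thesis using sq(2)[OF v] by (simp add: algebra_simps)
  qed
  have two: "w = 0" if "w \<in> V" "2 * w = 0" for w
    using torsion_cancel[OF that(1), of 2] that(2) p p2 prime_odd_nat[of p] prime_ge_2_nat[of p] by auto
  have main: "D a (D x v) = 0 \<and> D a (D y v) = 0" if v: "v \<in> V" for v
  proof -
    have "D a (D a v + D y v + D a (D y v)) = D a (2 * D x v)" using R[OF v] by simp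
    then have 1: "D a (D y v) = 2 * D a (D x v)" using v Vs sq(1) by (simp add: D_add D_numeral)
    have "D y (D a v + D y v + D a (D y v)) = D y (2 * D x v)" using R[OF v] by simp
    then have 2: "D a (D y v) = 2 * D x (D y v)" using v Vs sq(3) by (simp add: D_add D_numeral com D_0)
    have "D x (D a v + D y v + D a (D y v)) = D x (2 * D x v)" using R[OF v] by simp
    then have 3: "D a (D x v) + D x (D y v) + D a (D x (D y v)) = 0" using v Vs sq(2) by (simp add: D_add D_numeral com)
    have "2 * D a (D x (D y v)) = D a (D a (D y v))" using 2 v Vs by (simp add: D_numeral)
    then have 4: "D a (D x (D y v)) = 0" using two[of "D a (D x (D y v))"] sq(1) v Vs by simp
    have "2 * (2 * D a (D x v)) = 2 * D a (D x v) + 2 * D a (D x v)" by simp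
    also have "\<dots> = 2 * D a (D x v) + 2 * D x (D y v)" using 1 2 by simp
    finally have "2 * (2 * D a (D x v)) = 2 * (D a (D x v) + D x (D y v))" by (simp only: distrib_left)
    also have "D a (D x v) + D x (D y v) = 0" using 3 4 by simp
    finally have "2 * (2 * D a (D x v)) = 0" by simp
    then have "2 * D a (D x v) = 0" using two[of "2 * D a (D x v)"] v Vs by simp
    then show ?thesis using two[of "D a (D x v)"] 1 v Vs by simp
  qed
  have Dc: "D c v = D x v - D a v" if v: "v \<in> V" for v
  proof -
    have "act a (act c v) = act x v" using v G by (simp add: x_def act_mult)
    moreover have "act a (v + (D x v - D a v)) = act x v"
      using v Vs sq(1) main[OF v] add_subgroupD(2)[OF V] by (simp add: act_D[of a] act_D[of x] D_add D_diff)
    ultimately have "act a (act c v - (v + (D x v - D a v))) = 0"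
      using v Vs act_V add_subgroupD[OF V] by (simp add: act_diff)
    moreover have "act (inverse a) (act a w) = w" if "w \<in> V" for w
      using that G act_mult[of "inverse a" a w] act_one sgrpD(3)[OF sgrpG] by simp
    ultimately have "act c v - (v + (D x v - D a v)) = act (inverse a) 0"
      using v Vs act_V add_subgroupD[OF V] by metis
    then show ?thesis using act_0 sgrpD(3)[OF sgrpG G(1)] by (simp add: D_def)
  qed
  show "quad c" unfolding quad_def
    using Dc main sq com Vs add_subgroupD(2)[OF V] by (simp add: D_diff)
  show "D a (D c v) = 0" if "v \<in> V" for v
    using Dc main sq that Vs by (simp add: D_diff)
qed

text \<open>The relation says that the third multiplicative difference of \<open>a, b, c, d\<close> is trivial. For quadratic elements a cube acts
as \<open>1 + 3 D\<close>, so the relation becomes one between \<open>D a, \<dots>, D d\<close> and their products. Multiplying it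
by one or two of these operators gives linear equations for the mixed products, which are solved using that 6 is invertible.\<close>

lemma quad_third_difference:
  assumes p5: "5 \<le> p" and G: "a \<in> G" "b \<in> G" "c \<in> G" "d \<in> G"
    and q: "quad a" "quad b" "quad c" "quad d"
    and cm: "a * b = b * a" "a * c = c * a" "a * d = d * a" "b * c = c * b" "b * d = d * b" "c * d = d * c"
    and rel: "d * b ^ 3 = c ^ 3 * a" and v: "v \<in> V"
  shows "D a (D b (D c v)) = 0"
    and "D a (D c v) = D a (D b v) + 3 * D b (D c v)"
    and "D b (D d v) = D a (D b v) + 3 * D b (D c v)"
    and "D c (D d v) = D a (D b v)"
proof -
  note Vs = D_V add_subgroupD(4)[OF V] add_subgroup_numeral[OF V] G
  note sq = q[unfolded quad_def, rule_format]
  have com: "D b (D a w) = D a (D b w)" "D c (D a w) = D a (D c w)" "D d (D a w) = D a (D d w)"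
    "D c (D b w) = D b (D c w)" "D d (D b w) = D b (D d w)" "D d (D c w) = D c (D d w)" if "w \<in> V" for w
    using D_commute G cm that by metis+
  have six: "w = 0" if "w \<in> V" "6 * w = 0" for w
  proof -
    have "coprime 2 p" "coprime 3 p"
      using p5 p primes_coprime[of 2 p] primes_coprime[of 3 p] by auto
    then have "coprime (2 * 3) p" by (simp only: coprime_mult_left_iff)
    then show ?thesis using torsion_cancel[OF that(1), of 6] that(2) by simp
  qed
  have pw: "act (g ^ 3) w = w + 3 * D g w" if "g \<in> G" "quad g" "w \<in> V" for g w
    using act_quad_power[OF that(2,1,3), of 3] by simp
  have E: "3 * D b v + D d v + 3 * D b (D d v) = D a v + 3 * D c v + 3 * D a (D c v)"
  proof -
    have "act d (act (b ^ 3) v) = act (c ^ 3) (act a v)"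
      using rel v G sgrp_power[OF sgrpG] by (simp flip: act_mult)
    then have "v + 3 * D b v + D d (v + 3 * D b v) = v + D a v + 3 * D c (v + D a v)"
      using v Vs G q by (simp add: pw act_D[of d] act_D[of a])
    then show ?thesis using v Vs by (simp add: D_add D_numeral com algebra_simps)
  qed
  note simps = D_add D_numeral com sq Vs v D_0 distrib_left
  have ap: "D g (3 * D b v + D d v + 3 * D b (D d v)) = D g (D a v + 3 * D c v + 3 * D a (D c v))" for g
    by (simp add: E)
  have ap2: "D h (D g (3 * D b v + D d v + 3 * D b (D d v))) = D h (D g (D a v + 3 * D c v + 3 * D a (D c v)))" for g h
    by (simp add: E)
  have c: "D a (D b (D d v)) = 3 * D a (D b (D c v))" using ap2[of a b] by (simp add: simps)
  have f: "D b (D c (D d v)) = D a (D b (D c v))" using ap2[of b c] by (simp add: simps)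
  have e: "3 * D b (D c (D d v)) = D a (D c (D d v))" using ap2[of c d] by (simp add: simps)
  have "D c (D a (D b (D d v))) = D c (3 * D a (D b (D c v)))" by (simp add: c)
  then have Q: "D a (D b (D c (D d v))) = 0" by (simp add: simps)
  have a: "D a (D b (D d v)) + 3 * D b (D c (D d v)) = 0" using ap2[of b d] Q by (simp add: simps)
  have "6 * D a (D b (D c v)) = 3 * D a (D b (D c v)) + 3 * D a (D b (D c v))" by (simp flip: distrib_right)
  then have "6 * D a (D b (D c v)) = 0" using a c f by simp
  then show T: "D a (D b (D c v)) = 0" using six Vs v by simp
  have T': "D a (D b (D d v)) = 0" "D b (D c (D d v)) = 0" "D a (D c (D d v)) = 0"
    using T c f e by simp_all
  define A B C where "A = D a (D b v)" and "B = D a (D c v)" and "C = D b (D c v)"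
  have 1: "3 * A + D a (D d v) = 3 * B" using ap[of a] T' by (simp add: simps A_def B_def)
  have 2: "D b (D d v) = A + 3 * C" using ap[of b] T by (simp add: simps A_def C_def)
  have 3: "3 * C + D c (D d v) = B" using ap[of c] T' by (simp add: simps B_def C_def)
  have 4: "3 * D b (D d v) = D a (D d v) + 3 * D c (D d v)" using ap[of d] T' by (simp add: simps)
  have "D a (D d v) = 3 * B - 3 * A" "D c (D d v) = B - 3 * C" using 1 3 by (simp_all add: algebra_simps)
  then have 5: "3 * (A + 3 * C) = 3 * B - 3 * A + 3 * (B - 3 * C)" using 2 4 by simp
  have "6 * (B - (A + 3 * C)) = 3 * B - 3 * A + 3 * (B - 3 * C) - 3 * (A + 3 * C)" by (simp add: algebra_simps)
  also have "\<dots> = 0" by (simp only: 5 diff_self)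
  finally have "6 * (B - (A + 3 * C)) = 0" .
  then have BAC: "B = A + 3 * C" using six[of "B - (A + 3 * C)"] v Vs add_subgroupD(2)[OF V]
    by (simp add: A_def B_def C_def)
  show "D a (D c v) = D a (D b v) + 3 * D b (D c v)" "D b (D d v) = D a (D b v) + 3 * D b (D c v)"
    using BAC 2 by (simp_all add: A_def B_def C_def)
  show "D c (D d v) = D a (D b v)" using 3 BAC by (simp add: A_def B_def C_def algebra_simps)
qed

text \<open>The five elements $a\,b^k z^{k(k-1)/2}$ form a progression of degree 2, so the relation of \<open>quad_third_difference\<close>
holds for the terms 0 to 3 and for the terms 1 to 4. Comparing the two sets of equations determines the products of two of the
operators \<open>D a\<close>, \<open>D b1\<close>, \<open>D b2\<close> in terms of \<open>D a (D b1 v)\<close>. Finally \<open>z\<close> is the second difference of the progression, so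
\<open>D z = D b2 + D a - 2 D b1\<close> up to products that cancel, and its square is zero.\<close>

lemma quad_progression_3:
  assumes p5: "5 \<le> p" and G: "a \<in> G" "b \<in> G" "z \<in> G"
    and cm: "a * b = b * a" "a * z = z * a" "b * z = z * b"
    and q: "quad a" "quad (a * b)" "quad (a * b ^ 2 * z)" "quad (a * b ^ 3 * z ^ 3)" "quad (a * b ^ 4 * z ^ 6)"
  shows "quad z"
proof -
  define b1 b2 b3 b4 where "b1 = a * b" and "b2 = a * b ^ 2 * z" and "b3 = a * b ^ 3 * z ^ 3" and "b4 = a * b ^ 4 * z ^ 6"
  have abG: "b1 \<in> G" "b2 \<in> G" "b3 \<in> G" "b4 \<in> G"
    using G sgrpG by (auto simp: b1_def b2_def b3_def b4_def sgrpD sgrp_power)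
  \<comment> \<open>normal forms \<open>a ^ i * b ^ j * z ^ k\<close>\<close>
  have nf: "(a ^ i * b ^ j * z ^ k) * (a ^ i' * b ^ j' * z ^ k') = a ^ (i + i') * b ^ (j + j') * z ^ (k + k')"
    for i j k i' j' k' :: nat
  proof -
    have ab: "b ^ j * a ^ i' = a ^ i' * b ^ j" and az: "z ^ k * a ^ i' = a ^ i' * z ^ k" and bz: "z ^ k * b ^ j' = b ^ j' * z ^ k"
      using cm by (metis power_commuting_commutes)+
    have "(a ^ i * b ^ j * z ^ k) * (a ^ i' * b ^ j' * z ^ k') = a ^ i * (b ^ j * (z ^ k * a ^ i')) * b ^ j' * z ^ k'"
      by (simp add: mult.assoc)
    also have "\<dots> = a ^ i * (b ^ j * a ^ i') * (z ^ k * b ^ j') * z ^ k'" by (simp add: az mult.assoc)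
    also have "\<dots> = a ^ (i + i') * b ^ (j + j') * z ^ (k + k')" by (simp add: ab bz power_add mult.assoc)
    finally show ?thesis .
  qed
  have N: "a = a ^ 1 * b ^ 0 * z ^ 0" "b1 = a ^ 1 * b ^ 1 * z ^ 0" "b2 = a ^ 1 * b ^ 2 * z ^ 1"
    "b3 = a ^ 1 * b ^ 3 * z ^ 3" "b4 = a ^ 1 * b ^ 4 * z ^ 6" "z = a ^ 0 * b ^ 0 * z ^ 1"
    by (simp_all add: b1_def b2_def b3_def b4_def)
  have cms: "(a ^ i * b ^ j * z ^ k) * (a ^ i' * b ^ j' * z ^ k') = (a ^ i' * b ^ j' * z ^ k') * (a ^ i * b ^ j * z ^ k)"
    for i j k i' j' k' :: nat
    unfolding nf by (simp add: add.commute)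
  have comm: "a * b1 = b1 * a" "a * b2 = b2 * a" "a * b3 = b3 * a" "b1 * b2 = b2 * b1" "b1 * b3 = b3 * b1" "b2 * b3 = b3 * b2"
    "b1 * b4 = b4 * b1" "b2 * b4 = b4 * b2" "b3 * b4 = b4 * b3"
    using cms N by metis+
  have cube: "(a ^ i * b ^ j * z ^ k) ^ 3 = a ^ (3 * i) * b ^ (3 * j) * z ^ (3 * k)" for i j k :: nat
  proof -
    have "3 * l = l + l + l" for l :: nat by simp
    then show ?thesis by (simp only: power3_eq_cube nf)
  qed
  have rel: "b3 * b1 ^ 3 = b2 ^ 3 * a" "b4 * b2 ^ 3 = b3 ^ 3 * b1"
  proof -
    have "b3 * b1 ^ 3 = (a ^ 1 * b ^ 3 * z ^ 3) * (a ^ 1 * b ^ 1 * z ^ 0) ^ 3" using N by metis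
    also have "\<dots> = (a ^ 1 * b ^ 2 * z ^ 1) ^ 3 * (a ^ 1 * b ^ 0 * z ^ 0)" unfolding cube nf by simp
    also have "\<dots> = b2 ^ 3 * a" using N by metis
    finally show "b3 * b1 ^ 3 = b2 ^ 3 * a" .
    have "b4 * b2 ^ 3 = (a ^ 1 * b ^ 4 * z ^ 6) * (a ^ 1 * b ^ 2 * z ^ 1) ^ 3" using N by metis
    also have "\<dots> = (a ^ 1 * b ^ 3 * z ^ 3) ^ 3 * (a ^ 1 * b ^ 1 * z ^ 0)" unfolding cube nf by simp
    also have "\<dots> = b3 ^ 3 * b1" using N by metis
    finally show "b4 * b2 ^ 3 = b3 ^ 3 * b1" .
  qed
  have zrel: "z * (b1 * b1) = b2 * a"
  proof -
    have "z * (b1 * b1) = (a ^ 0 * b ^ 0 * z ^ 1) * ((a ^ 1 * b ^ 1 * z ^ 0) * (a ^ 1 * b ^ 1 * z ^ 0))" using N by metis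
    also have "\<dots> = (a ^ 1 * b ^ 2 * z ^ 1) * (a ^ 1 * b ^ 0 * z ^ 0)" unfolding nf by (simp add: power2_eq_square)
    also have "\<dots> = b2 * a" using N by metis
    finally show ?thesis .
  qed
  have qs: "quad b1" "quad b2" "quad b3" "quad b4" using q by (simp_all add: b1_def b2_def b3_def b4_def)
  note t1 = quad_third_difference[OF p5 G(1) abG(1-3) q(1) qs(1-3) comm(1-6) rel(1)]
  note t2 = quad_third_difference[OF p5 abG qs comm(4,5,7,6,8,9) rel(2)]
  note Vs = D_V add_subgroupD(4)[OF V] add_subgroup_numeral[OF V] G(1) abG
  note sq = q(1)[unfolded quad_def, rule_format] qs(1,2)[unfolded quad_def, rule_format]
  have com: "D b1 (D a w) = D a (D b1 w)" "D b2 (D a w) = D a (D b2 w)" "D b2 (D b1 w) = D b1 (D b2 w)" if "w \<in> V" for w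
    using D_commute G(1) abG comm that by metis+
  have two: "w = 0" if "w \<in> V" "2 * w = 0" for w
    using torsion_cancel[OF that(1), of 2] that(2) p p5 prime_odd_nat[of p] by auto
  have AC: "D b1 (D b2 v) = D a (D b1 v)" "D a (D b2 v) = 4 * D a (D b1 v)" if v: "v \<in> V" for v
  proof -
    have eq: "D b1 (D b2 v) + 3 * D a (D b1 v) = D a (D b1 v) + 3 * D b1 (D b2 v)"
      using t1(3,4)[OF v] t2(2)[OF v] by simp
    have "2 * (D b1 (D b2 v) - D a (D b1 v)) = D a (D b1 v) + 3 * D b1 (D b2 v) - (D b1 (D b2 v) + 3 * D a (D b1 v))"
      by (simp add: algebra_simps)
    also have "\<dots> = 0" by (simp only: eq diff_self)
    finally have "2 * (D b1 (D b2 v) - D a (D b1 v)) = 0" .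
    moreover have "D b1 (D b2 v) - D a (D b1 v) \<in> V" by (rule add_subgroupD(2)[OF V]) (simp_all add: v Vs)
    ultimately have "D b1 (D b2 v) - D a (D b1 v) = 0" using two by blast
    then show "D b1 (D b2 v) = D a (D b1 v)" by simp
    then show "D a (D b2 v) = 4 * D a (D b1 v)" using t1(2)[OF v] by simp
  qed
  have Dz: "D z v = D b2 v + D a v - 2 * D b1 v" if v: "v \<in> V" for v
  proof -
    define w where "w = v - 2 * D b1 v"
    have w: "w \<in> V" using v Vs add_subgroupD(2)[OF V] by (simp add: w_def)
    have "act (b1 * b1) w = act b1 (w + D b1 w)" using act_mult[OF abG(1,1) w] by (simp add: D_def)
    also have "w + D b1 w = v - D b1 v"
      using v Vs sq add_subgroupD(2)[OF V] by (simp add: w_def D_diff D_numeral)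
    also have "act b1 (v - D b1 v) = v" using v Vs sq by (simp add: act_diff act_D[of b1] D_diff)
    finally have "act z v = act z (act (b1 * b1) w)" by simp
    also have "\<dots> = act b2 (act a w)"
      using zrel w G abG sgrpD(2)[OF sgrpG] by (simp flip: act_mult)
    also have "\<dots> = w + D a w + D b2 (w + D a w)" by (simp add: act_D[of b2] act_D[of a])
    also have "\<dots> = w + D a w + D b2 w + D b2 (D a w)" using w Vs by (simp add: D_add)
    also have "\<dots> = v + (D b2 v + D a v - 2 * D b1 v)"
    proof -
      have "D a w = D a v - 2 * D a (D b1 v)"
        using v Vs by (simp add: w_def D_diff D_numeral)
      moreover have "D b2 w = D b2 v - 2 * D a (D b1 v)"
        using v Vs com AC[OF v] by (simp add: w_def D_diff D_numeral)
      moreover have "D b2 (D a w) = 4 * D a (D b1 v)"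
        using v Vs com AC[OF v] t1(1)[OF v] by (simp add: w_def D_diff D_numeral)
      ultimately show ?thesis by (simp add: w_def)
    qed
    finally show ?thesis by (simp add: D_def)
  qed
  show ?thesis
    unfolding quad_def
  proof
    fix v assume v: "v \<in> V"
    define w where "w = D b2 v + D a v - 2 * D b1 v"
    have w: "w \<in> V" using v Vs add_subgroupD(2)[OF V] by (simp add: w_def)
    have "D z (D z v) = D b2 w + D a w - 2 * D b1 w" using Dz[OF v] Dz[OF w] by (simp add: w_def)
    also have "\<dots> = 0"
    proof -
      have "D b2 w = 2 * D a (D b1 v)"
        using v Vs sq com AC[OF v] by (simp add: w_def D_diff D_add D_numeral)
      moreover have "D a w = 2 * D a (D b1 v)"
        using v Vs sq AC[OF v] by (simp add: w_def D_diff D_add D_numeral)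
      moreover have "D b1 w = 2 * D a (D b1 v)"
        using v Vs sq com AC[OF v] by (simp add: w_def D_diff D_add D_numeral)
      ultimately show ?thesis by simp
    qed
    finally show "D z (D z v) = 0" .
  qed
qed

section \<open>Fixed vectors and Timmesfeld's replacement theorem\<close>

definition fixv :: "'a set \<Rightarrow> 'w set"
  where "fixv B = {v \<in> V. \<forall>g\<in>B. act g v = v}"

lemma fixv_V: "fixv B \<subseteq> V" by (auto simp: fixv_def)

lemma finite_fixv: "finite (fixv B)" using finite_subset[OF fixv_V finV] .

lemma add_subgroup_fixv: "B \<subseteq> G \<Longrightarrow> add_subgroup (fixv B)"
  unfolding add_subgroup_def fixv_def using add_subgroupD(1,2)[OF V] by (auto simp: act_0 act_diff subsetD)

lemma fixv_anti: "B \<subseteq> C \<Longrightarrow> fixv C \<subseteq> fixv B" by (auto simp: fixv_def)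

lemma fixv_one: "fixv {1} = V" using act_one by (auto simp: fixv_def)

lemma fixv_sprod: "B \<subseteq> G \<Longrightarrow> C \<subseteq> G \<Longrightarrow> fixv B \<inter> fixv C \<subseteq> fixv (sprod B C)"
  by (auto simp: fixv_def sprod_def act_mult subsetD)

lemma fixv_D: "v \<in> fixv B \<longleftrightarrow> v \<in> V \<and> (\<forall>g\<in>B. D g v = 0)"
  by (auto simp: fixv_def D_def)

text \<open>The binomial theorem for \<open>act g = 1 + D g\<close>.\<close>

lemma iterate_D:
  assumes "g \<in> G" "v \<in> V"
  shows "act (g ^ k) v = (\<Sum>j\<le>k. of_nat (k choose j) * (D g ^^ j) v)" and "(D g ^^ k) v \<in> V"
proof -
  have DV: "(D g ^^ j) v \<in> V" for j by (induction j) (auto simp: assms D_V)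
  then show "(D g ^^ k) v \<in> V" .
  show "act (g ^ k) v = (\<Sum>j\<le>k. of_nat (k choose j) * (D g ^^ j) v)"
  proof (induction k)
    case 0 then show ?case using act_one assms by simp
  next
    case (Suc k)
    have sumV: "(\<Sum>j\<in>S. of_nat (k choose j) * (D g ^^ j) v) \<in> V" if "finite S" for S
      using that by (induction S) (auto intro: add_subgroupD[OF V] add_subgroup_of_nat[OF V] DV)
    have Dsum: "D g (\<Sum>j\<in>S. of_nat (k choose j) * (D g ^^ j) v) = (\<Sum>j\<in>S. of_nat (k choose j) * (D g ^^ Suc j) v)" if "finite S" for S
      using that
    proof (induction S)
      case (insert x F)
      then show ?case
        using sumV[of F] assms DV by (simp add: D_add D_of_nat add_subgroup_of_nat[OF V])
    qed (use assms D_0 in simp)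
    have "act (g ^ Suc k) v = act g (act (g ^ k) v)"
      using act_mult[OF assms(1) sgrp_power[OF sgrpG assms(1)] assms(2)] by simp
    also have "\<dots> = (\<Sum>j\<le>k. of_nat (k choose j) * (D g ^^ j) v) + (\<Sum>j\<le>k. of_nat (k choose j) * (D g ^^ Suc j) v)"
      by (subst Suc) (simp only: act_D[of g "\<Sum>j\<le>k. of_nat (k choose j) * (D g ^^ j) v"] Dsum finite_atMost)
    also have "(\<Sum>j\<le>k. of_nat (k choose j) * (D g ^^ j) v) = (\<Sum>j\<le>Suc k. of_nat (k choose j) * (D g ^^ j) v)"
      by (simp add: binomial_eq_0)
    also have "\<dots> = v + (\<Sum>j\<le>k. of_nat (k choose Suc j) * (D g ^^ Suc j) v)"
      by (subst sum.atMost_Suc_shift) simp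
    also have "\<dots> + (\<Sum>j\<le>k. of_nat (k choose j) * (D g ^^ Suc j) v)
        = v + (\<Sum>j\<le>k. of_nat (Suc k choose Suc j) * (D g ^^ Suc j) v)"
      by (simp add: sum.distrib[symmetric] algebra_simps)
    also have "\<dots> = (\<Sum>j\<le>Suc k. of_nat (Suc k choose j) * (D g ^^ j) v)"
      by (subst sum.atMost_Suc_shift) simp
    finally show ?case .
  qed
qed

text \<open>In the binomial expansion of \<open>act (g ^ p)\<close> only the first and the last term are not divisible by \<open>p\<close>.\<close>

lemma D_nilpotent:
  assumes "g \<in> G" "g ^ p = 1" "v \<in> V"
  shows "(D g ^^ p) v = 0"
proof -
  have p0: "p > 0" using p prime_gt_0_nat by blast
  have "v = (\<Sum>j\<le>p. of_nat (p choose j) * (D g ^^ j) v)"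
    using iterate_D(1)[OF assms(1,3), of p] assms act_one by simp
  also have "\<dots> = (\<Sum>j\<in>{0, p}. of_nat (p choose j) * (D g ^^ j) v)"
  proof (rule sum.mono_neutral_right)
    show "\<forall>j\<in>{..p} - {0, p}. of_nat (p choose j) * (D g ^^ j) v = 0"
    proof
      fix j assume "j \<in> {..p} - {0, p}"
      then obtain c where c: "p choose j = p * c" using dvd_choose_prime[of j p] p by (auto simp: dvd_def)
      show "of_nat (p choose j) * (D g ^^ j) v = 0"
        using torsion[OF iterate_D(2)[OF assms(1,3), of j]] by (simp add: c mult.assoc mult.left_commute)
    qed
  qed auto
  also have "\<dots> = v + (D g ^^ p) v" using p0 by simp
  finally show ?thesis by simp
qed

definition add_span :: "'w set \<Rightarrow> 'w set"
  where "add_span S = \<Inter>{W. add_subgroup W \<and> S \<subseteq> W}"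

lemma add_subgroup_add_span: "add_subgroup (add_span S)"
  by (auto simp: add_subgroup_def add_span_def)

lemma add_span_upper: "S \<subseteq> add_span S" by (auto simp: add_span_def)

lemma add_span_least: "add_subgroup W \<Longrightarrow> S \<subseteq> W \<Longrightarrow> add_span S \<subseteq> W" by (auto simp: add_span_def)

lemma D_add_span:
  assumes "g \<in> G" "S \<subseteq> V" "add_subgroup U" "D g ` S \<subseteq> U"
  shows "D g ` add_span S \<subseteq> U" "add_span S \<subseteq> V"
proof -
  have "add_subgroup {v \<in> V. D g v \<in> U}"
    unfolding add_subgroup_def using add_subgroupD[OF V] add_subgroupD[OF assms(3)] assms(1) by (auto simp: D_0 D_diff)
  then have "add_span S \<subseteq> {v \<in> V. D g v \<in> U}" by (rule add_span_least) (use assms in auto)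
  then show "D g ` add_span S \<subseteq> U" "add_span S \<subseteq> V" by auto
qed

lemma add_subgroup_D_image:
  assumes "g \<in> G" "add_subgroup W" "W \<subseteq> V"
  shows "add_subgroup (D g ` W)"
  unfolding add_subgroup_def
proof (intro conjI ballI)
  show "0 \<in> D g ` W" using add_subgroupD(1)[OF assms(2)] D_0[OF assms(1)] by (metis imageI)
  fix x y assume "x \<in> D g ` W" "y \<in> D g ` W"
  then obtain a b where "x = D g a" "y = D g b" "a \<in> W" "b \<in> W" by auto
  then show "x - y \<in> D g ` W" using D_diff[OF assms(1), of a b] add_subgroupD(2)[OF assms(2), of a b] assms(3) by (metis imageI subsetD)
qed

text \<open>Commuting nilpotent operators cannot satisfy \<open>W = (\<Sum>g\<in>S. D g W)\<close> unless \<open>W = 0\<close>. The operators are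
removed one by one: modulo the contribution of the others, \<open>W = D g W\<close>, and iterating \<open>p\<close> times leaves nothing.\<close>

lemma nilpotent_family:
  assumes "finite S" "S \<subseteq> G" "\<And>g h. g \<in> S \<Longrightarrow> h \<in> S \<Longrightarrow> g * h = h * g" "\<And>g. g \<in> S \<Longrightarrow> g ^ p = 1"
    and W: "add_subgroup W" "W \<subseteq> V" "\<And>g. g \<in> S \<Longrightarrow> D g ` W \<subseteq> W"
    and "W \<subseteq> add_span (\<Union>g\<in>S. D g ` W)"
  shows "W \<subseteq> {0}"
  using assms(1,2,3,4,7,8)
proof (induction S)
  case empty
  have "add_span {} \<subseteq> {0}" by (rule add_span_least) (auto simp: add_subgroup_def)
  then show ?case using empty by auto
next
  case (insert g S)
  have g: "g \<in> G" using insert by simp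
  define U where "U = add_span (\<Union>h\<in>S. D h ` W)"
  have U: "add_subgroup U" using add_subgroup_add_span by (simp add: U_def)
  have SW: "(\<Union>h\<in>S. D h ` W) \<subseteq> W" using insert.prems(4) by auto
  have UW: "U \<subseteq> W" unfolding U_def by (rule add_span_least[OF W(1) SW])
  have DU: "D g ` U \<subseteq> U"
    unfolding U_def
  proof (rule D_add_span(1)[OF g _ add_subgroup_add_span])
    show "(\<Union>h\<in>S. D h ` W) \<subseteq> V" using SW W by auto
    show "D g ` (\<Union>h\<in>S. D h ` W) \<subseteq> add_span (\<Union>h\<in>S. D h ` W)"
    proof clarify
      fix h w assume h: "h \<in> S" and w: "w \<in> W"
      have hG: "h \<in> G" and wV: "w \<in> V" using insert.prems(1) h w W(2) by blast+
      have "g * h = h * g" by (rule insert.prems(2)) (use h in blast)+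
      then have "D g (D h w) = D h (D g w)" by (rule D_commute[OF g hG _ wV])
      moreover have "D g w \<in> W" using insert.prems(4)[of g] w by blast
      then have "D h (D g w) \<in> (\<Union>h\<in>S. D h ` W)" using h by blast
      then have "D h (D g w) \<in> add_span (\<Union>h\<in>S. D h ` W)" by (rule subsetD[OF add_span_upper])
      ultimately show "D g (D h w) \<in> add_span (\<Union>h\<in>S. D h ` W)" by (simp only:)
    qed
  qed
  have Dg: "add_subgroup (D g ` W)" by (rule add_subgroup_D_image[OF g W(1,2)])
  have dec: "\<exists>w'\<in>W. \<exists>u\<in>U. w = D g w' + u" if "w \<in> W" for w
  proof -
    have "add_span (\<Union>h\<in>insert g S. D h ` W) \<subseteq> splus (D g ` W) U"
    proof (rule add_span_least[OF add_subgroup_splus[OF Dg U]])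
      have "(\<Union>h\<in>S. D h ` W) \<subseteq> U" unfolding U_def by (rule add_span_upper)
      then show "(\<Union>h\<in>insert g S. D h ` W) \<subseteq> splus (D g ` W) U"
        using splus_upper[OF Dg U] by auto
    qed
    then have "w \<in> splus (D g ` W) U" using insert.prems(5) that by blast
    then show ?thesis by (auto simp: splus_def)
  qed
  have iter: "\<exists>w'\<in>W. \<exists>u\<in>U. w = (D g ^^ l) w' + u" if "w \<in> W" for w l
    using that
  proof (induction l arbitrary: w)
    case 0
    have "w = (D g ^^ 0) w + 0" by simp
    then show ?case using 0 add_subgroupD(1)[OF U] by blast
  next
    case (Suc l)
    obtain w' u where 1: "w' \<in> W" "u \<in> U" "w = D g w' + u" using dec[OF Suc.prems] by blast
    obtain w'' u' where 2: "w'' \<in> W" "u' \<in> U" "w' = (D g ^^ l) w'' + u'" using Suc.IH[OF 1(1)] by blast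
    have "D g w' = (D g ^^ Suc l) w'' + D g u'"
      using 2 g W UW iterate_D(2)[OF g, of w'' l] by (auto simp: D_add subsetD)
    then have "w = (D g ^^ Suc l) w'' + (D g u' + u)" using 1 by (simp add: add.assoc)
    moreover have "D g u' + u \<in> U" using DU 2 1 add_subgroupD(4)[OF U] by blast
    ultimately show ?case using 2 by blast
  qed
  have "W \<subseteq> U"
  proof
    fix w assume "w \<in> W"
    then obtain w' u where "w' \<in> W" "u \<in> U" "w = (D g ^^ p) w' + u" using iter[of w p] by blast
    moreover have "(D g ^^ p) w' = 0" by (rule D_nilpotent[OF g]) (use insert.prems(3) W(2) calculation in auto)
    ultimately show "w \<in> U" by simp
  qed
  then have "W \<subseteq> add_span (\<Union>h\<in>S. D h ` W)" by (simp only: U_def)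
  moreover have "g' * h = h * g'" if "g' \<in> S" "h \<in> S" for g' h
    by (rule insert.prems(2)) (use that in blast)+
  ultimately show ?case using insert.prems(1,3,4) by (intro insert.IH) blast+
qed

text \<open>An offender is a subgroup \<open>B\<close> with \<open>meas B \<ge> card V\<close>, the right-hand side being the value at the trivial group.\<close>

definition meas :: "'a set \<Rightarrow> nat"
  where "meas B = card B * card (fixv B)"

lemma card_fixv_pos: "B \<subseteq> G \<Longrightarrow> card (fixv B) > 0"
  using add_subgroupD(1)[OF add_subgroup_fixv] finite_fixv by (auto simp: card_gt_0_iff)

text \<open>Submodularity of \<open>meas\<close> with the fixed spaces replaced by arbitrary subspaces \<open>W\<close>, \<open>W'\<close> of them. Both the orders of the subgroups
and those of the subspaces satisfy the product formula, and \<open>W \<inter> W'\<close> is fixed by the product.\<close>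

lemma meas_submodular:
  assumes B: "sgrp B" "B \<subseteq> G" "sgrp C" "C \<subseteq> G" "\<And>x y. x \<in> B \<Longrightarrow> y \<in> C \<Longrightarrow> x * y = y * x"
    and W: "add_subgroup W" "W \<subseteq> fixv B" "add_subgroup W'" "W' \<subseteq> fixv C"
  shows "(card B * card W) * (card C * card W') \<le> meas (sprod B C) * (card (B \<inter> C) * card (splus W W'))"
proof -
  have fB: "finite B" "finite C" "finite W" "finite W'"
    using B W finG finite_fixv finite_subset by metis+
  have "card (W \<inter> W') \<le> card (fixv (sprod B C))"
    using fixv_sprod[OF B(2,4)] W by (intro card_mono finite_fixv) auto
  then have 1: "card (sprod B C) * card (W \<inter> W') \<le> meas (sprod B C)" by (simp add: meas_def)
  have "(card B * card W) * (card C * card W') = (card B * card C) * (card W * card W')" by simp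
  also have "\<dots> \<le> (card (sprod B C) * card (B \<inter> C)) * (card (splus W W') * card (W \<inter> W'))"
    by (intro mult_mono card_sprod card_splus B W fB) auto
  also have "\<dots> = (card (sprod B C) * card (W \<inter> W')) * (card (B \<inter> C) * card (splus W W'))" by simp
  also have "\<dots> \<le> meas (sprod B C) * (card (B \<inter> C) * card (splus W W'))" by (rule mult_right_mono[OF 1]) simp
  finally show ?thesis .
qed

text \<open>The subgroup in question is $C_M([V,M])$, the intersection over \<open>v \<in> V\<close> of the subgroups $C_M([v,M])$. Each of these satisfies the bound with the
subspace \<open>fixv M + [v,M]\<close>, because \<open>(g, w) \<mapsto> D g v + w\<close> has fibres of size at most
$|C_M([v,M])|$. By submodularity and the maximality of \<open>meas M\<close> the bound is inherited by intersections, with the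
sum of the subspaces. If the intersection were trivial, the corresponding sum would be all of \<open>V\<close>, so
\<open>V = fixv M + [V,M]\<close>; then \<open>[V,M] = [V,M,M]\<close>, which is impossible for a nontrivial unipotent action.\<close>

theorem timmesfeld:
  assumes M: "sgrp M" "M \<subseteq> G" "M \<noteq> {1}" and ab: "\<And>x y. x \<in> M \<Longrightarrow> y \<in> M \<Longrightarrow> x * y = y * x"
    and ep: "\<And>x. x \<in> M \<Longrightarrow> x ^ p = 1"
    and best: "\<And>B. sgrp B \<Longrightarrow> B \<subseteq> M \<Longrightarrow> meas B \<le> meas M"
  shows "{f \<in> M. \<forall>v\<in>V. \<forall>g\<in>M. D f (D g v) = 0} \<noteq> {1}"
    and "meas M \<le> meas {f \<in> M. \<forall>v\<in>V. \<forall>g\<in>M. D f (D g v) = 0}"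
proof -
  define F where "F U = {f \<in> M. \<forall>v\<in>U. \<forall>g\<in>M. D f (D g v) = 0}" for U
  have finM: "finite M" using M finG finite_subset by blast
  define S where "S = (\<Union>g\<in>M. D g ` V)"
  have SV: "S \<subseteq> V" using M D_V by (auto simp: S_def)
  define W0 where "W0 = add_span S"
  have W0: "add_subgroup W0" "W0 \<subseteq> V" using add_subgroup_add_span add_span_least[OF V SV] by (auto simp: W0_def)
  have fM: "add_subgroup (fixv M)" by (rule add_subgroup_fixv[OF M(2)])
  define Z where "Z = splus (fixv M) W0"
  have Z: "add_subgroup Z" unfolding Z_def by (rule add_subgroup_splus[OF fM W0(1)])
  have sgF: "sgrp (F U)" if "U \<subseteq> V" for U
  proof -
    have eq: "D f w = 0 \<longleftrightarrow> act f w = w" for f w by (simp add: D_def)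
    have DV: "D g v \<in> V" if "v \<in> U" "g \<in> M" for g v using that \<open>U \<subseteq> V\<close> M D_V by auto
    show ?thesis
      unfolding sgrp_def F_def eq
    proof (intro conjI ballI; clarsimp simp: eq)
      show "1 \<in> M \<and> (\<forall>v\<in>U. \<forall>g\<in>M. act 1 (D g v) = D g v)" using sgrpD(1)[OF M(1)] act_one DV by auto
    next
      fix x y assume "x \<in> M" "y \<in> M" "\<forall>v\<in>U. \<forall>g\<in>M. act x (D g v) = D g v" "\<forall>v\<in>U. \<forall>g\<in>M. act y (D g v) = D g v"
      then show "x * y \<in> M \<and> (\<forall>v\<in>U. \<forall>g\<in>M. act (x * y) (D g v) = D g v)"
        using sgrpD(2)[OF M(1)] act_mult DV M(2) by (auto simp: subsetD)
    next
      fix x assume x: "x \<in> M" "\<forall>v\<in>U. \<forall>g\<in>M. act x (D g v) = D g v"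
      then have "act (inverse x) (D g v) = D g v" if "v \<in> U" "g \<in> M" for g v
        using act_cancel'[of x "D g v"] DV that M(2) by (metis subsetD)
      then show "inverse x \<in> M \<and> (\<forall>v\<in>U. \<forall>g\<in>M. act (inverse x) (D g v) = D g v)"
        using sgrpD(3)[OF M(1) x(1)] by blast
    qed
  qed
  \<comment> \<open>the statement propagated to intersections: \<open>W\<close> witnesses that \<open>B\<close> has measure at least \<open>meas M\<close>\<close>
  define good where "good B W \<longleftrightarrow> sgrp B \<and> B \<subseteq> M \<and> add_subgroup W \<and> W \<subseteq> fixv B \<and> W \<subseteq> Z \<and> meas M \<le> card B * card W" for B W
  have mpos: "meas M > 0"
    using card_fixv_pos[OF M(2)] finM sgrpD(1)[OF M(1)] by (auto simp: meas_def card_gt_0_iff)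
  have good_Int: "good (B \<inter> C) (splus W W')" if "good B W" "good C W'" for B C W W'
  proof -
    have BC: "sgrp B" "B \<subseteq> M" "sgrp C" "C \<subseteq> M" "add_subgroup W" "W \<subseteq> fixv B" "add_subgroup W'" "W' \<subseteq> fixv C"
      "W \<subseteq> Z" "W' \<subseteq> Z" "meas M \<le> card B * card W" "meas M \<le> card C * card W'"
      using that by (auto simp: good_def)
    have cm: "x * y = y * x" if "x \<in> B" "y \<in> C" for x y using that ab BC by blast
    have "sprod B C \<subseteq> M" using BC(2,4) sgrpD(2)[OF M(1)] unfolding sprod_def by blast
    then have le: "meas (sprod B C) \<le> meas M" by (intro best sgrp_sprod BC cm)
    have "meas M * meas M \<le> (card B * card W) * (card C * card W')" by (intro mult_mono BC) auto
    also have "\<dots> \<le> meas (sprod B C) * (card (B \<inter> C) * card (splus W W'))"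
      by (rule meas_submodular[OF BC(1) _ BC(3) _ cm BC(5-8)]) (use BC(2,4) M(2) in auto)
    also have "\<dots> \<le> meas M * (card (B \<inter> C) * card (splus W W'))" by (rule mult_right_mono[OF le]) simp
    finally have "meas M \<le> card (B \<inter> C) * card (splus W W')" using mpos by simp
    moreover have "splus W W' \<subseteq> fixv (B \<inter> C)"
      using BC M fixv_anti[of "B \<inter> C" B] fixv_anti[of "B \<inter> C" C] by (intro splus_least add_subgroup_fixv) auto
    moreover have "splus W W' \<subseteq> Z" using BC Z by (intro splus_least) auto
    ultimately show ?thesis using BC sgrp_Int add_subgroup_splus by (auto simp: good_def)
  qed
  have good_v: "\<exists>W. good (F {v}) W" if v: "v \<in> V" for v
  proof -
    define T where "T = (\<lambda>g. D g v) ` M"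
    have TV: "T \<subseteq> V" using M v D_V by (auto simp: T_def)
    define W where "W = splus (fixv M) (add_span T)"
    have aW: "add_subgroup W" unfolding W_def by (rule add_subgroup_splus[OF fM add_subgroup_add_span])
    have FM: "F {v} \<subseteq> M" by (auto simp: F_def)
    have FG: "F {v} \<subseteq> G" using FM M by auto
    have TF: "T \<subseteq> fixv (F {v})" using TV by (auto simp: T_def F_def fixv_D)
    have WF: "W \<subseteq> fixv (F {v})"
      unfolding W_def using fixv_anti[OF FM] add_span_least[OF add_subgroup_fixv[OF FG] TF]
      by (intro splus_least add_subgroup_fixv FG)
    have "T \<subseteq> S" using v by (auto simp: T_def S_def)
    then have "add_span T \<subseteq> W0" unfolding W0_def using add_span_upper[of S] by (intro add_span_least add_subgroup_add_span) auto
    then have WZ: "W \<subseteq> Z" unfolding W_def using splus_upper[OF fM W0(1)] Z by (intro splus_least) (auto simp: Z_def)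
    have WV: "W \<subseteq> V" using WF fixv_V by blast
    have "card (M \<times> fixv M) \<le> card W * card (F {v})"
    proof (rule card_le_fibres[where f = "\<lambda>(g, w). D g v + w"])
      show "finite (M \<times> fixv M)" using finM finite_fixv by simp
      show "finite W" using WV finV finite_subset by blast
      show "(\<lambda>(g, w). D g v + w) ` (M \<times> fixv M) \<subseteq> W"
      proof clarify
        fix g w assume "g \<in> M" "w \<in> fixv M"
        then have "w + D g v \<in> W" using add_span_upper[of T] by (auto simp: W_def splus_def T_def)
        then show "D g v + w \<in> W" by (simp add: add.commute)
      qed
      fix y
      let ?R = "{x \<in> M \<times> fixv M. (case x of (g, w) \<Rightarrow> D g v + w) = y}"
      show "card ?R \<le> card (F {v})"
      proof (cases "?R = {}")
        case False
        then obtain h w0 where h: "h \<in> M" "w0 \<in> fixv M" "D h v + w0 = y" by auto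
        have "inj_on (\<lambda>(g, w). inverse h * g) ?R"
        proof (rule inj_onI)
          fix x x' assume "x \<in> ?R" "x' \<in> ?R" "(case x of (g, w) \<Rightarrow> inverse h * g) = (case x' of (g, w) \<Rightarrow> inverse h * g)"
          then show "x = x'" by (cases x; cases x') auto
        qed
        moreover have "(\<lambda>(g, w). inverse h * g) ` ?R \<subseteq> F {v}"
        proof
          fix x assume "x \<in> (\<lambda>(g, w). inverse h * g) ` ?R"
          then obtain g w where x: "x = inverse h * g" and gw: "g \<in> M" "w \<in> fixv M" "D g v + w = D h v + w0"
            using h(3) by auto
          show "x \<in> F {v}"
            unfolding F_def x
          proof (intro CollectI conjI ballI)
            show "inverse h * g \<in> M" using gw h sgrpD[OF M(1)] by blast
            fix v' k assume v': "v' \<in> {v}" and k: "k \<in> M"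
            have G: "g \<in> G" "h \<in> G" "k \<in> G" "inverse h \<in> G" using gw h k M sgrpD(3)[OF M(1)] by auto
            have wV: "w \<in> V" "w0 \<in> V" using gw h fixv_V by auto
            have "D k (D g v + w) = D k (D h v + w0)" using gw by simp
            moreover have "D k w = 0" "D k w0 = 0" using gw h k by (auto simp: fixv_D)
            ultimately have "D k (D g v) = D k (D h v)" using G wV v D_V by (simp add: D_add)
            then have "D g (D k v) = D h (D k v)"
              using D_commute[OF G(3,1) _ v] D_commute[OF G(3,2) _ v] ab k gw h by metis
            then have "act g (D k v) = act h (D k v)" by (simp add: D_def)
            then have "act (inverse h * g) (D k v) = D k v"
              using act_mult[OF G(4,1) D_V[OF G(3) v]] act_cancel'[OF G(2) D_V[OF G(3) v]] by simp
            then show "D (inverse h * g) (D k v') = 0" using v' by (simp add: D_def)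
          qed
        qed
        ultimately show ?thesis using FM finM finite_subset by (intro card_inj_on_le) auto
      next
        case True
        show ?thesis unfolding True by simp
      qed
    qed
    then have "meas M \<le> card (F {v}) * card W" by (simp add: meas_def card_cartesian_product mult.commute)
    then have "good (F {v}) W" using sgF[of "{v}"] v FM aW WF WZ by (auto simp: good_def)
    then show ?thesis by blast
  qed
  have ex: "\<exists>W. good (F U) W" if "finite U" "U \<subseteq> V" for U
    using that
  proof (induction U)
    case empty
    have "F {} = M" by (simp add: F_def)
    moreover have "good M (fixv M)"
      using M fM splus_upper(1)[OF fM W0(1)] by (auto simp: good_def meas_def Z_def)
    ultimately show ?case by auto
  next
    case (insert v U)
    then obtain W W' where "good (F U) W" "good (F {v}) W'" using good_v[of v] by auto
    from good_Int[OF this] have "good (F U \<inter> F {v}) (splus W W')" .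
    moreover have "F U \<inter> F {v} = F (insert v U)" by (auto simp: F_def)
    ultimately show ?case by auto
  qed
  then obtain W where W: "good (F V) W" using finV by blast
  have "card W \<le> card (fixv (F V))" using W by (intro card_mono finite_fixv) (simp add: good_def)
  moreover have "meas M \<le> card (F V) * card W" using W by (simp add: good_def)
  ultimately have "meas M \<le> meas (F V)" unfolding meas_def[of "F V"] by (meson le_trans mult_le_mono2)
  then show "meas M \<le> meas {f \<in> M. \<forall>v\<in>V. \<forall>g\<in>M. D f (D g v) = 0}" by (simp add: F_def)
  have False if F1: "F V = {1}"
  proof -
  have W: "good {1} W" using W F1 by simp
  have "card V = meas {1}" by (simp add: meas_def fixv_one)
  also have "\<dots> \<le> meas M" by (rule best) (use sgrpD(1)[OF M(1)] in \<open>auto simp: sgrp_def\<close>)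
  also have "\<dots> \<le> card W" using W by (simp add: good_def)
  finally have "card V \<le> card W" .
  moreover have "W \<subseteq> V" using W by (auto simp: good_def fixv_one)
  ultimately have "W = V" using finV by (simp add: card_seteq)
  then have VZ: "V \<subseteq> Z" using W by (simp add: good_def)
  have DW: "D g ` W0 \<subseteq> W0" if "g \<in> M" for g
    using that W0 add_span_upper[of S] by (auto simp: W0_def S_def)
  have "S \<subseteq> (\<Union>g\<in>M. D g ` W0)"
  proof
    fix x assume "x \<in> S"
    then obtain g v where gv: "g \<in> M" "v \<in> V" "x = D g v" by (auto simp: S_def)
    then obtain f w where fw: "f \<in> fixv M" "w \<in> W0" "v = f + w" using VZ by (auto simp: Z_def splus_def)
    have "D g v = D g f + D g w" unfolding fw(3) using gv fw fixv_V W0 M by (intro D_add) auto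
    then have "x = D g w" using fw gv by (auto simp: fixv_D)
    then show "x \<in> (\<Union>g\<in>M. D g ` W0)" using gv fw by auto
  qed
  then have "W0 \<subseteq> add_span (\<Union>g\<in>M. D g ` W0)"
    unfolding W0_def[symmetric] using add_span_upper add_span_least[OF add_subgroup_add_span] unfolding W0_def by (meson order_trans)
  then have "W0 \<subseteq> {0}" by (intro nilpotent_family[OF finM M(2) ab ep W0 DW])
  then have D0: "D g v = 0" if "g \<in> M" "v \<in> V" for g v
    using that add_span_upper[of S] by (auto simp: W0_def S_def)
  have "g = 1" if "g \<in> M" for g
    using that M D0[OF that] by (intro faithful) (auto simp: D_def)
  then show False using M sgrpD(1)[OF M(1)] by auto
  qed
  then show "{f \<in> M. \<forall>v\<in>V. \<forall>g\<in>M. D f (D g v) = 0} \<noteq> {1}" by (auto simp: F_def)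
qed

text \<open>Among the subgroups of \<open>A\<close> of maximal measure the largest one, \<open>M\<close>, contains all the others, since by submodularity the
product of two subgroups of maximal measure has maximal measure again. Conjugation
preserves the measure, so \<open>M\<close> is normal in \<open>G\<close>, and so is \<open>F = \<close>$C_M([V,M])$, which is an offender by Timmesfeld's theorem. Elements of
\<open>F\<close> are quadratic because they centralise \<open>[V,F]\<close>.\<close>

theorem offender_in_abelian_normal:
  assumes A: "sgrp A" "A \<subseteq> G" "normalised G A" and ab: "\<And>x y. x \<in> A \<Longrightarrow> y \<in> A \<Longrightarrow> x * y = y * x"
    and ep: "\<And>x. x \<in> A \<Longrightarrow> x ^ p = 1"
    and E: "sgrp E" "E \<subseteq> A" "E \<noteq> {1}" "card V \<le> meas E"
  obtains F where "sgrp F" "F \<subseteq> A" "F \<noteq> {1}" "normalised G F" "\<And>f. f \<in> F \<Longrightarrow> quad f" "card V \<le> meas F"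
proof -
  have finA: "finite A" using A finG finite_subset by blast
  define \<B> where "\<B> = {B. sgrp B \<and> B \<subseteq> A}"
  have fB: "finite \<B>" using finA by (auto simp: \<B>_def intro: finite_subset[of _ "Pow A"])
  have EB: "E \<in> \<B>" using E by (simp add: \<B>_def)
  define \<mu> where "\<mu> = Max (meas ` \<B>)"
  have le: "meas B \<le> \<mu>" if "B \<in> \<B>" for B using that fB by (simp add: \<mu>_def)
  define best where "best = {B \<in> \<B>. meas B = \<mu>}"
  have "\<mu> \<in> meas ` \<B>" unfolding \<mu>_def using fB EB by (intro Max_in) auto
  then have "best \<noteq> {}" by (auto simp: best_def)
  moreover have "finite best" using fB by (simp add: best_def)
  ultimately obtain M where Mb: "M \<in> best" and Mmax: "\<And>B. B \<in> best \<Longrightarrow> card B \<le> card M"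
    by (metis (no_types, lifting) arg_max_on_def obtains_MAX[of best card] Max_ge finite_imageI imageI)
  have M: "sgrp M" "M \<subseteq> A" "meas M = \<mu>" using Mb by (auto simp: best_def \<B>_def)
  have upper: "B \<subseteq> M" if "B \<in> best" for B
  proof -
    have B: "sgrp B" "B \<subseteq> A" "meas B = \<mu>" using that by (auto simp: best_def \<B>_def)
    have cm: "x * y = y * x" if "x \<in> B" "y \<in> M" for x y using that B M ab by blast
    have P: "sprod B M \<in> \<B>" using sgrp_sprod[OF B(1) M(1) cm] B M sgrpD(2)[OF A(1)] by (auto simp: \<B>_def sprod_def)
    have I: "B \<inter> M \<in> \<B>" using sgrp_Int[OF B(1) M(1)] B by (auto simp: \<B>_def)
    have BMG: "B \<subseteq> G" "M \<subseteq> G" using B M A by auto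
    have "splus (fixv B) (fixv M) \<subseteq> fixv (B \<inter> M)"
      using BMG fixv_anti[of "B \<inter> M" B] fixv_anti[of "B \<inter> M" M] by (intro splus_least add_subgroup_fixv) auto
    then have "card (B \<inter> M) * card (splus (fixv B) (fixv M)) \<le> meas (B \<inter> M)"
      by (simp add: meas_def card_mono finite_fixv)
    also have "\<dots> \<le> \<mu>" by (rule le[OF I])
    finally have 1: "card (B \<inter> M) * card (splus (fixv B) (fixv M)) \<le> \<mu>" .
    have "\<mu> * \<mu> = (card B * card (fixv B)) * (card M * card (fixv M))" using B M by (simp add: meas_def)
    also have "\<dots> \<le> meas (sprod B M) * (card (B \<inter> M) * card (splus (fixv B) (fixv M)))"
      by (rule meas_submodular[OF B(1) BMG(1) M(1) BMG(2) cm add_subgroup_fixv[OF BMG(1)] order.refl add_subgroup_fixv[OF BMG(2)] order.refl])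
    also have "\<dots> \<le> meas (sprod B M) * \<mu>" by (rule mult_left_mono[OF 1]) simp
    finally have "\<mu> * \<mu> \<le> meas (sprod B M) * \<mu>" .
    moreover have "\<mu> > 0"
      using card_fixv_pos[OF BMG(2)] M finite_subset[OF M(2) finA] sgrpD(1)[OF M(1)] by (auto simp: meas_def card_gt_0_iff)
    ultimately have "\<mu> \<le> meas (sprod B M)" by simp
    then have "sprod B M \<in> best" using P le[OF P] by (simp add: best_def)
    then have "card (sprod B M) \<le> card M" by (rule Mmax)
    moreover have "M \<subseteq> sprod B M" by (rule sprod_upper(2)[OF B(1) M(1)])
    moreover have "finite (sprod B M)" using P finA finite_subset by (auto simp: \<B>_def)
    ultimately have "M = sprod B M" by (intro card_seteq) auto
    then show ?thesis using sprod_upper(1)[OF B(1) M(1)] by simp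
  qed
  have M1: "M \<noteq> {1}"
  proof
    assume M1: "M = {1}"
    then have "\<mu> = card V" using M by (simp add: meas_def fixv_one)
    then have "E \<in> best" using E le[OF EB] EB by (simp add: best_def)
    then show False using upper M1 E sgrpD(1)[OF E(1)] by blast
  qed
  have MG: "M \<subseteq> G" using M A by auto
  have nM: "normalised G M"
    unfolding normalised_def
  proof (intro ballI)
    fix u g assume u: "u \<in> M" and g: "g \<in> G"
    define B where "B = (\<lambda>x. cj x g) ` M"
    have ig: "inverse g \<in> G" using g sgrpD(3)[OF sgrpG] by blast
    have inj: "inj_on (\<lambda>x. cj x g) M" by (auto simp: inj_on_def cj_def)
    have "sgrp B" unfolding B_def sgrp_def
      using sgrpD[OF M(1)] by (auto simp: cj_mult[symmetric] cj_inverse[symmetric]) (metis cj_one(2) imageI)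
    moreover have "B \<subseteq> A" using M A g by (auto simp: B_def normalisedD)
    ultimately have BB: "B \<in> \<B>" by (simp add: \<B>_def)
    have "inj_on (act (inverse g)) (fixv M)"
      using act_cancel[OF g] fixv_V by (auto intro!: inj_on_inverseI[of _ "act g"])
    moreover have "act (inverse g) ` fixv M \<subseteq> fixv B"
    proof clarify
      fix v assume v: "v \<in> fixv M"
      have vV: "v \<in> V" using v fixv_V by blast
      have "D (cj x g) (act (inverse g) v) = 0" if x: "x \<in> M" for x
      proof -
        have "D (cj x g) (act (inverse g) v) = act (inverse g) (D x v)"
          using x MG g ig vV act_V act_cancel by (auto simp: D_cj)
        then show ?thesis using v x act_0[OF ig] by (simp add: fixv_D)
      qed
      then show "act (inverse g) v \<in> fixv B" using act_V[OF ig vV] by (auto simp: fixv_D B_def)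
    qed
    ultimately have "card (fixv M) \<le> card (fixv B)" using finite_fixv by (intro card_inj_on_le) auto
    moreover have "card B = card M" unfolding B_def by (rule card_image[OF inj])
    ultimately have "meas B \<ge> \<mu>" unfolding M(3)[symmetric] meas_def by simp
    then have "B \<in> best" using BB le[OF BB] by (simp add: best_def)
    then show "cj u g \<in> M" using upper u by (auto simp: B_def)
  qed
  define F where "F = {f \<in> M. \<forall>v\<in>V. \<forall>g\<in>M. D f (D g v) = 0}"
  have FM: "F \<subseteq> M" by (auto simp: F_def)
  have Mbest: "meas B \<le> meas M" if "sgrp B" "B \<subseteq> M" for B
    using le[of B] that M by (auto simp: \<B>_def)
  have abM: "x * y = y * x" if "x \<in> M" "y \<in> M" for x y using that M ab by blast
  have epM: "x ^ p = 1" if "x \<in> M" for x using that M ep by blast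
  note tf = timmesfeld[OF M(1) MG M1 abM epM Mbest, folded F_def]
  have F1: "F \<noteq> {1}" by (rule tf(1))
  have FV: "card V \<le> meas F"
    using tf(2) E(4) le[OF EB] M(3) by linarith
  have Ffix: "f \<in> F \<longleftrightarrow> f \<in> M \<and> (\<forall>v\<in>V. \<forall>g\<in>M. act f (D g v) = D g v)" for f
    by (auto simp: F_def D_def)
  have DV: "D g v \<in> V" if "v \<in> V" "g \<in> M" for g v using that MG D_V by auto
  have sgF: "sgrp F"
    unfolding sgrp_def
  proof (intro conjI ballI)
    show "1 \<in> F" unfolding Ffix using sgrpD(1)[OF M(1)] act_one DV by auto
    show "x * y \<in> F" if "x \<in> F" "y \<in> F" for x y
      using that sgrpD(2)[OF M(1)] act_mult DV MG unfolding Ffix by (auto simp: subsetD)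
    show "inverse x \<in> F" if "x \<in> F" for x
      unfolding Ffix
    proof (intro conjI ballI)
      show "inverse x \<in> M" using that FM sgrpD(3)[OF M(1)] by auto
      fix v g assume vg: "v \<in> V" "g \<in> M"
      then show "act (inverse x) (D g v) = D g v"
        using that act_cancel'[of x "D g v"] DV MG unfolding Ffix by (metis subsetD)
    qed
  qed
  have nF: "normalised G F"
    unfolding normalised_def
  proof (intro ballI)
    fix f h assume f: "f \<in> F" and h: "h \<in> G"
    have ih: "inverse h \<in> G" using h sgrpD(3)[OF sgrpG] by blast
    have fM: "f \<in> M" "f \<in> G" using f FM MG by auto
    have "D (cj f h) (D g v) = 0" if vg: "v \<in> V" "g \<in> M" for v g
    proof -
      have gG: "g \<in> G" using vg MG by auto
      have g': "cj g (inverse h) \<in> M" using nM vg ih by (simp add: normalisedD)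
      have "D (cj g (inverse h)) (act h v) = act h (D g v)"
        using D_cj[OF gG ih act_V[OF h vg(1)]] act_cancel'[OF h vg(1)] by simp
      moreover have "D f (D (cj g (inverse h)) (act h v)) = 0"
        using f g' act_V[OF h vg(1)] by (simp add: F_def)
      ultimately have "D f (act h (D g v)) = 0" by simp
      then show ?thesis using D_cj[OF fM(2) h DV[OF vg]] act_0[OF ih] by simp
    qed
    then show "cj f h \<in> F" using nM fM h by (simp add: F_def normalisedD)
  qed
  have "quad f" if "f \<in> F" for f using that FM by (auto simp: F_def quad_def)
  then show ?thesis using that[OF sgF _ F1 nF _ FV] FM M by blast
qed

end

section \<open>Normal subgroups of groups of maximal class\<close>

definition normal_closure :: "'a :: mgroup set \<Rightarrow> 'a \<Rightarrow> 'a set"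
  where "normal_closure G x = \<Inter>{K. sgrp K \<and> K \<subseteq> G \<and> normalised G K \<and> x \<in> K}"

lemma normal_closure_least: "sgrp K \<Longrightarrow> K \<subseteq> G \<Longrightarrow> normalised G K \<Longrightarrow> x \<in> K \<Longrightarrow> normal_closure G x \<subseteq> K"
  by (auto simp: normal_closure_def)

lemma normal_closure_props:
  assumes "sgrp G" "x \<in> G"
  shows "x \<in> normal_closure G x" "sgrp (normal_closure G x)" "normalised G (normal_closure G x)" "normal_closure G x \<subseteq> G"
proof -
  have G: "normalised G G" using sgrp_cj[OF assms(1)] by (simp add: normalised_def)
  show "x \<in> normal_closure G x" "normalised G (normal_closure G x)" by (auto simp: normal_closure_def normalised_def)
  show "sgrp (normal_closure G x)" unfolding normal_closure_def sgrp_def by blast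
  show "normal_closure G x \<subseteq> G" by (rule normal_closure_least) (use assms G in auto)
qed

context max_class
begin

lemma com_next:
  assumes "2 \<le> j" "Suc j < n" "y \<in> L j" "y \<notin> L (Suc j)"
  obtains g where "g \<in> G" "com y g \<in> L (Suc j)" "com y g \<notin> L (Suc (Suc j))"
proof -
  have "\<exists>g\<in>G. com y g \<notin> L (Suc (Suc j))"
  proof (rule ccontr)
    assume "\<not> ?thesis"
    then have *: "com y g \<in> L (Suc (Suc j))" if "g \<in> G" for g using that by blast
    have "L (Suc j) \<subseteq> L (Suc (Suc j))"
    proof (rule leastL[OF _ sgrpL])
      fix x g assume x: "x \<in> L j" and g: "g \<in> G"
      obtain i h where h: "h \<in> L (Suc j)" "x = y ^ i * h" by (rule layer_generator[OF assms(1) _ assms(3,4) x]) (use assms in auto)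
      have yG: "y \<in> G" "h \<in> G" "y ^ i \<in> G" using assms h LinG sgrp_power[OF sgrpG] by auto
      have "com h g \<in> L (Suc (Suc j))" using comL[OF _ h(1) g] by simp
      then show "com x g \<in> L (Suc (Suc j))" unfolding h(2)
        using comG_bilinear(1)[OF sgrpL normalisedL yG(3,2) g] comG_bilinear(3)[OF sgrpL normalisedL yG(1,1) g *[OF g]] by blast
    qed (use assms in auto)
    then show False using L_neq[of "Suc j"] assms by auto
  qed
  then show ?thesis using that comL[of j y] assms by auto
qed

text \<open>From an element of level \<open>j\<close> in \<open>K\<close>, commutation with a suitable group element produces one of level \<open>j + 1\<close> in \<open>K\<close>. So
\<open>K\<close> meets every later layer, and the layers have order \<open>p\<close>.\<close>

lemma normal_contains_L:
  assumes K: "sgrp K" "normalised G K" and i: "2 \<le> i" "i < n" and x: "x \<in> K" "x \<in> L i" "x \<notin> L (Suc i)"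
  shows "L i \<subseteq> K"
proof -
  have A: "\<exists>y\<in>K. y \<in> L j \<and> y \<notin> L (Suc j)" if "i \<le> j" "j < n" for j
    using that
  proof (induction j rule: dec_induct)
    case base then show ?case using x by blast
  next
    case (step j)
    then obtain y where y: "y \<in> K" "y \<in> L j" "y \<notin> L (Suc j)" by auto
    obtain g where g: "g \<in> G" "com y g \<in> L (Suc j)" "com y g \<notin> L (Suc (Suc j))"
      by (rule com_next[OF _ _ y(2,3)]) (use step i in auto)
    have "cj y g \<in> K" using normalisedD[OF K(2) y(1) g(1)] .
    then have "com y g \<in> K" using sgrp_cj_iff[OF K(1) y(1)] by blast
    then show ?case using g by blast
  qed
  have "L j \<subseteq> K" if "i \<le> j" "j \<le> n" for j
    using that(2,1)
  proof (induction j rule: inc_induct)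
    case base then show ?case using Ln sgrpD(1)[OF K(1)] by simp
  next
    case (step j)
    then obtain y where y: "y \<in> K" "y \<in> L j" "y \<notin> L (Suc j)" using A[of j] by auto
    show ?case
    proof
      fix z assume z: "z \<in> L j"
      obtain k h where h: "h \<in> L (Suc j)" "z = y ^ k * h" by (rule layer_generator[OF _ _ y(2,3) z]) (use step i in auto)
      then show "z \<in> K" using step.IH step.prems y sgrp_power[OF K(1)] sgrpD(2)[OF K(1)] by (auto simp: subsetD)
    qed
  qed
  then show ?thesis using i by simp
qed

lemma level:
  assumes "x \<in> L m" "x \<noteq> 1" "m \<le> n"
  obtains i where "m \<le> i" "i < n" "x \<in> L i" "x \<notin> L (Suc i)"
proof -
  have "\<exists>i. m \<le> i \<and> i < n \<and> x \<in> L i \<and> x \<notin> L (Suc i)"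
  proof (rule ccontr)
    assume no: "\<not> ?thesis"
    have "x \<in> L j" if "m \<le> j" "j \<le> n" for j
      using that by (induction j rule: dec_induct) (use assms no in auto)
    then show False using assms Ln by auto
  qed
  then show ?thesis using that by blast
qed

text \<open>The group \<open>H\<close> generated by \<open>x\<close> and \<open>L 2\<close> is cyclic modulo \<open>L 2\<close>, hence proper, since \<open>G / L 2\<close> is not cyclic. It is
normal, has index \<open>p\<close>, and is the normal closure of \<open>x\<close>: were all commutators of \<open>x\<close> in \<open>L 3\<close>, then \<open>G\<close>, generated by \<open>H\<close> and one
further element, would be abelian modulo \<open>L 3\<close>; so some commutator of \<open>x\<close> generates \<open>L 2\<close> modulo \<open>L 3\<close>.\<close>

lemma outside_L2:
  assumes x: "x \<in> G" "x \<notin> L 2"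
  shows "card (normal_closure G x) = p ^ (n - 1)" "L 2 \<subseteq> normal_closure G x" "\<exists>g\<in>G. com x g \<in> L 2 \<and> com x g \<notin> L 3"
proof -
  define H where "H = {x ^ i * h | i h. h \<in> L 2}"
  have HG: "H \<subseteq> G" using x LinG sgrp_power[OF sgrpG] sgrpD(2)[OF sgrpG] by (auto simp: H_def)
  have xi: "x ^ i \<in> G" for i using x sgrp_power[OF sgrpG] by blast
  have sH: "sgrp H"
  proof (rule sgrp_of_finite_closed)
    show "finite H" using HG finG finite_subset by blast
    show "H \<noteq> {}" using sgrpD(1)[OF sgrpL] by (auto simp: H_def)
    fix u v assume "u \<in> H" "v \<in> H"
    then obtain i h j k where *: "u = x ^ i * h" "v = x ^ j * k" "h \<in> L 2" "k \<in> L 2" by (auto simp: H_def)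
    then have "u * v = x ^ (i + j) * (cj h (x ^ j) * k)" by (simp add: power_add cj_def mult.assoc)
    then show "u * v \<in> H" using Lnormal[OF *(3) xi[of j]] *(4) sgrpD(2)[OF sgrpL] unfolding H_def by blast
  qed
  have LH: "L 2 \<subseteq> H" unfolding H_def by (auto intro!: exI[of _ 0])
  have xH: "x \<in> H" unfolding H_def using sgrpD(1)[OF sgrpL] by (auto intro!: exI[of _ 1])
  have c23: "com h g \<in> L 3" if "h \<in> L 2" "g \<in> G" for h g using comL[OF _ that] by (simp add: numeral_3_eq_3)
  have HH: "com u v \<in> L 3" if u: "u \<in> H" and v: "v \<in> H" for u v
  proof -
    obtain i h where h: "u = x ^ i * h" "h \<in> L 2" using u by (auto simp: H_def)
    obtain j k where k: "v = x ^ j * k" "k \<in> L 2" using v by (auto simp: H_def)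
    have G: "h \<in> G" "k \<in> G" "v \<in> G" using h k v HG LinG by auto
    have "com (x ^ i) (x ^ j) = 1" by (simp add: com_eq_1_iff flip: power_add add: add.commute)
    moreover have "com (x ^ i) k \<in> L 3" using c23[OF k(2) xi[of i]] sgrp_com_swap[OF sgrpL] by blast
    ultimately have "com (x ^ i) v \<in> L 3" unfolding k(1)
      using comG_bilinear(2)[OF sgrpL normalisedL xi[of i] xi[of j] G(2)] sgrpD(1)[OF sgrpL] by simp
    then show ?thesis unfolding h(1) using comG_bilinear(1)[OF sgrpL normalisedL xi[of i] G(1,3)] c23[OF h(2) G(3)] by simp
  qed
  have L23: "\<not> L 2 \<subseteq> L 3" using L_neq[of 2] n by (auto simp: numeral_3_eq_3 numeral_2_eq_2)
  have ne: "H \<noteq> G"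
  proof
    assume "H = G"
    then have "L (Suc 1) \<subseteq> L 3" using HH L1 by (intro leastL sgrpL) auto
    then show False using L23 by (simp add: numeral_2_eq_2)
  qed
  have le: "card H \<le> p ^ (n - 1)"
  proof (rule card_proper[OF sH sgrpG _ order.refl])
    show "H \<subset> G" using ne HG by blast
    show "card G = p ^ Suc (n - 1)" using cardG n by simp
  qed
  have "card (L 2) < card H"
    using LH xH x HG finG finite_subset by (intro psubset_card_mono) blast+
  then have gt: "p ^ (n - 2) < card H" using card_L[of 2] n by simp
  obtain k where k: "card H = p ^ k" by (rule card_sgrp[OF sH HG])
  have "k = n - 1"
  proof -
    have p1: "1 < p" using p2 by simp
    have "n - 2 < k" using gt unfolding k power_strict_increasing_iff[OF p1] .
    moreover have "k \<le> n - 1" using le unfolding k power_increasing_iff[OF p1] .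
    ultimately show ?thesis by simp
  qed
  then have cH: "card H = p ^ (n - 1)" using k by simp
  have nH: "normalised G H"
    unfolding normalised_def
  proof (intro ballI)
    fix u g assume u: "u \<in> H" and g: "g \<in> G"
    have "com u g \<in> L 2" using comL[of 1 u g] u g HG L1 by (auto simp: numeral_2_eq_2)
    then show "cj u g \<in> H" using LH sgrp_cj_iff[OF sH u] by blast
  qed
  show ex: "\<exists>g\<in>G. com x g \<in> L 2 \<and> com x g \<notin> L 3"
  proof (rule ccontr)
    assume no: "\<not> ?thesis"
    have xg: "com x g \<in> L 3" if "g \<in> G" for g
      using no comL[of 1 x g] that x L1 by (auto simp: numeral_2_eq_2)
    obtain g where g: "g \<in> G" "g \<notin> H" using ne HG by blast
    have cG: "card G = p * card H" using cH cardG n by (simp flip: power_Suc)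
    have Hg: "com u y \<in> L 3" if u: "u \<in> H" and y: "y \<in> G" for u y
    proof -
      obtain i h where h: "u = x ^ i * h" "h \<in> L 2" using u by (auto simp: H_def)
      have hG: "h \<in> G" using h LinG by auto
      have "com (x ^ i) y \<in> L 3" by (rule comG_bilinear(3)[OF sgrpL normalisedL x(1) x(1) y xg[OF y]])
      then show ?thesis unfolding h(1) using comG_bilinear(1)[OF sgrpL normalisedL xi[of i] hG y] c23[OF h(2) y] by simp
    qed
    have "L (Suc 1) \<subseteq> L 3"
    proof (rule leastL[OF _ sgrpL])
      fix y z assume "y \<in> L 1" and z: "z \<in> G"
      then have y: "y \<in> G" using L1 by simp
      obtain i u where u: "u \<in> H" "y = g ^ i * u"
        by (rule cyclic_quotient[OF sH sgrpG order.refl HG cG g normalisedD[OF nH _ g(1)] y])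
      obtain j v where v: "v \<in> H" "z = g ^ j * v"
        by (rule cyclic_quotient[OF sH sgrpG order.refl HG cG g normalisedD[OF nH _ g(1)] z])
      have gi: "g ^ i \<in> G" "g ^ j \<in> G" "u \<in> G" "v \<in> G" using g u v HG sgrp_power[OF sgrpG] by auto
      have "com (g ^ i) (g ^ j) = 1" by (simp add: com_eq_1_iff flip: power_add add: add.commute)
      moreover have "com (g ^ i) v \<in> L 3" using Hg[OF v(1) gi(1)] sgrp_com_swap[OF sgrpL] by blast
      ultimately have "com (g ^ i) z \<in> L 3" unfolding v(2)
        using comG_bilinear(2)[OF sgrpL normalisedL gi(1,2,4)] sgrpD(1)[OF sgrpL] by simp
      then show "com y z \<in> L 3" unfolding u(2)
        using comG_bilinear(1)[OF sgrpL normalisedL gi(1,3) z] Hg[OF u(1) z] by simp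
    qed simp
    then show False using L23 by (simp add: numeral_2_eq_2)
  qed
  have L2K: "L 2 \<subseteq> K" if K: "sgrp K" "normalised G K" "x \<in> K" for K
  proof -
    obtain g where g: "g \<in> G" "com x g \<in> L 2" "com x g \<notin> L (Suc 2)" using ex by (auto simp: numeral_3_eq_3 numeral_2_eq_2)
    have "com x g \<in> K" using normalisedD[OF K(2,3) g(1)] sgrp_cj_iff[OF K(1,3)] by blast
    then show ?thesis using normal_contains_L[OF K(1,2) _ _ _ g(2,3)] n by simp
  qed
  note nc = normal_closure_props[OF sgrpG x(1)]
  show L2N: "L 2 \<subseteq> normal_closure G x" by (rule L2K[OF nc(2,3,1)])
  have "H \<subseteq> normal_closure G x" using L2N nc(1,2) sgrp_power sgrpD(2) unfolding H_def by blast
  moreover have "normal_closure G x \<subseteq> H" by (rule normal_closure_least[OF sH HG nH xH])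
  ultimately show "card (normal_closure G x) = p ^ (n - 1)" using cH by (metis subset_antisym)
qed

lemma normal_contains_bottom:
  assumes K: "sgrp K" "normalised G K" "K \<subseteq> G" "K \<noteq> {1}"
  shows "L (n - 1) \<subseteq> K"
proof -
  obtain x where x: "x \<in> K" "x \<noteq> 1" using K sgrpD(1)[OF K(1)] by blast
  have xG: "x \<in> G" using x K by blast
  show ?thesis
  proof (cases "x \<in> L 2")
    case True
    obtain i where i: "2 \<le> i" "i < n" "x \<in> L i" "x \<notin> L (Suc i)" by (rule level[OF True x(2)]) (use n in auto)
    have "L i \<subseteq> K" by (rule normal_contains_L[OF K(1,2) i(1,2) x(1) i(3,4)])
    moreover have "L (n - 1) \<subseteq> L i" by (rule Lmono) (use i in linarith)
    ultimately show ?thesis by blast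
  next
    case False
    have "normal_closure G x \<subseteq> K" by (rule normal_closure_least[OF K(1,3,2) x(1)])
    moreover have "L (n - 1) \<subseteq> L 2" by (rule Lmono) (use n in linarith)
    ultimately show ?thesis using outside_L2(2)[OF xG False] by blast
  qed
qed

text \<open>At level 1 the normal closure is not determined by the level, but it still is a maximal subgroup containing \<open>L 2\<close>.\<close>

lemma normal_closure_level:
  assumes "e \<in> G" "e \<noteq> 1"
  obtains i where "1 \<le> i" "i < n" "e \<notin> L (Suc i)" "card (normal_closure G e) = p ^ (n - i)" "L (Suc i) \<subseteq> normal_closure G e"
    "i \<ge> 2 \<Longrightarrow> e \<in> L i \<and> normal_closure G e = L i"
proof (cases "e \<in> L 2")
  case True
  obtain i where i: "2 \<le> i" "i < n" "e \<in> L i" "e \<notin> L (Suc i)" by (rule level[OF True assms(2)]) (use n in auto)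
  note nc = normal_closure_props[OF sgrpG assms(1)]
  have "L i \<subseteq> normal_closure G e" by (rule normal_contains_L[OF nc(2,3) i(1,2) nc(1) i(3,4)])
  moreover have "normal_closure G e \<subseteq> L i" by (rule normal_closure_least[OF sgrpL LG normalisedL i(3)])
  ultimately have eq: "normal_closure G e = L i" by blast
  show ?thesis by (rule that[of i]) (use i eq card_L LSuc in auto)
next
  case False
  show ?thesis by (rule that[of 1]) (use outside_L2[OF assms(1) False] False n in \<open>auto simp: numeral_2_eq_2\<close>)
qed

end

section \<open>Central quadratic elements\<close>

locale max_class_module = max_class G p n L + faithful_module G V act p
  for G :: "'a :: mgroup set" and p n :: nat and L :: "nat \<Rightarrow> 'a set" and V :: "'w :: comm_ring_1 set" and act :: "'a \<Rightarrow> 'w \<Rightarrow> 'w"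
begin

text \<open>The homomorphism \<open>f\<close> commutes with conjugation by \<open>G\<close> because \<open>x\<close> is central modulo \<open>L m\<close>, which \<open>N\<close> centralises. So its kernel and image
are normal in \<open>G\<close>, and \<open>c = f e\<close> is nontrivial, since \<open>e\<close> generates \<open>N\<close> as a normal subgroup. The image contains
\<open>L \<tau>\<close> for the level \<open>\<tau> = n - t\<close> of \<open>c\<close> and the kernel contains \<open>L (m - 1)\<close>, hence \<open>t + (n - m + 1) \<le> n - i\<close>, where
\<open>t \<le> n - m\<close>.\<close>

theorem nonabelian_closure:
  assumes p3: "3 \<le> p" and p7: "p \<le> 7" and e: "e \<in> G" "e \<noteq> 1" "quad e"
    and nab: "\<not> (\<forall>x\<in>normal_closure G e. \<forall>y\<in>normal_closure G e. x * y = y * x)"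
  obtains z where "z \<in> L (n - 1)" "z \<noteq> 1" "quad z"
proof -
  define N where "N = normal_closure G e"
  have N: "e \<in> N" "sgrp N" "normalised G N" "N \<subseteq> G" using normal_closure_props[OF sgrpG e(1)] by (auto simp: N_def)
  obtain i where i: "1 \<le> i" "i < n" "e \<notin> L (Suc i)" "card N = p ^ (n - i)" "L (Suc i) \<subseteq> N"
    "i \<ge> 2 \<Longrightarrow> e \<in> L i \<and> N = L i"
    using normal_closure_level[OF e(1,2)] unfolding N_def by blast
  have Ngen: "\<exists>k h. h \<in> L (Suc i) \<and> y = e ^ k * h" if y: "y \<in> N" for y
  proof -
    have "card N = p * card (L (Suc i))" using i by (simp add: card_L Suc_diff_Suc flip: power_Suc)
    from cyclic_quotient[OF sgrpL N(2,4) i(5) this N(1) i(3) Lnormal[OF _ e(1)] y] show ?thesis by metis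
  qed
  define Nc where "Nc j \<longleftrightarrow> (\<forall>y\<in>N. \<forall>x\<in>L j. com y x = 1)" for j
  have Ncmono: "Nc k" if "Nc j" "j \<le> k" for j k using that Lmono[of j k] by (auto simp: Nc_def)
  have "Nc n" by (simp add: Nc_def Ln)
  \<comment> \<open>the first term of the series that is centralised by \<open>N\<close>\<close>
  define m where "m = (LEAST j. Nc j)"
  have Ncm: "Nc m" unfolding m_def using \<open>Nc n\<close> by (rule LeastI)
  have mn: "m \<le> n" unfolding m_def using \<open>Nc n\<close> by (rule Least_le)
  have "\<not> Nc (Suc i)"
  proof
    assume c: "Nc (Suc i)"
    have "y * z = z * y" if y: "y \<in> N" and z: "z \<in> N" for y z
    proof -
      obtain k h where h: "h \<in> L (Suc i)" "y = e ^ k * h" using Ngen[OF y] by blast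
      obtain l g where g: "g \<in> L (Suc i)" "z = e ^ l * g" using Ngen[OF z] by blast
      have ek: "e ^ k \<in> N" "e ^ l \<in> N" "h \<in> N" using N sgrp_power h i(5) by auto
      have 1: "z * h = h * z" using c z h by (simp add: Nc_def com_eq_1_iff)
      have 2: "e ^ k * g = g * e ^ k" using c ek g by (simp add: Nc_def com_eq_1_iff)
      have "e ^ k * z = e ^ l * (e ^ k * g)" unfolding g(2) by (simp add: mult.assoc[symmetric] power_add[symmetric] add.commute)
      also have "\<dots> = z * e ^ k" unfolding 2 by (simp add: g(2) mult.assoc)
      finally have 3: "e ^ k * z = z * e ^ k" .
      have "y * z = e ^ k * z * h" unfolding h(2) using 1 by (simp add: mult.assoc)
      then show ?thesis unfolding 3 by (simp add: h(2) mult.assoc)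
    qed
    then show False using nab by (auto simp: N_def)
  qed
  then have mi: "i + 2 \<le> m" using Ncmono[OF Ncm, of "Suc i"] by (cases "m \<le> Suc i") auto
  define j where "j = m - 1"
  have j: "m = Suc j" "Suc i \<le> j" "2 \<le> j" "j < n" using mi mn i by (auto simp: j_def)
  have "\<not> Nc j" using not_less_Least[of j Nc] j by (simp add: m_def)
  then obtain y0 x where x: "x \<in> L j" "y0 \<in> N" "com y0 x \<noteq> 1" by (auto simp: Nc_def)
  have LjN: "L j \<subseteq> N" using i(5) Lmono[OF j(2)] by blast
  have xN: "x \<in> N" and xG: "x \<in> G" using x LjN N by auto
  have LmN: "L m \<subseteq> N" using LjN LSuc[of j] j by auto
  have xm: "x \<notin> L (Suc j)" using Ncm x j by (auto simp: Nc_def)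
  have cen: "com y u = 1" "y * u = u * y" if "y \<in> N" "u \<in> L m" for y u
    using Ncm that by (auto simp: Nc_def com_eq_1_iff)
  define f where "f y = com y x" for y
  have fm: "f y \<in> L m" if "y \<in> N" for y
    using comL[of j x y] x j that N(4) sgrp_com_swap[OF sgrpL, of y x m] by (auto simp: f_def)
  have fmult: "f (y * z) = f y * f z" if "y \<in> N" "z \<in> N" for y z
  proof -
    have "cj (f y) z = f y" using cen(2)[OF that(2) fm[OF that(1)], symmetric] by (simp add: cj_def mult.assoc)
    then show ?thesis by (simp add: f_def com_mult_left)
  qed
  have fcj: "f (cj y g) = cj (f y) g" if y: "y \<in> N" and g: "g \<in> G" for y g
  proof -
    define u where "u = com x g"
    have u: "u \<in> L m" using comL[of j x g] x g j by (simp add: u_def)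
    have yN: "cj y g \<in> N" using N y g by (simp add: normalisedD)
    have "cj (f y) g = com (cj y g) (x * u)" by (simp add: f_def cj_com_distrib cj_com[of x] u_def)
    also have "\<dots> = com (cj y g) u * cj (f (cj y g)) u" by (simp add: com_mult_right f_def)
    also have "com (cj y g) u = 1" using cen yN u by simp
    also have "cj (f (cj y g)) u = f (cj y g)"
      using cen(2)[OF subsetD[OF LmN u] fm[OF yN], symmetric] by (simp add: cj_def mult.assoc)
    finally show ?thesis by simp
  qed
  have f1: "f 1 = 1" by (simp add: f_def)
  have finv: "f (inverse y) = inverse (f y)" if "y \<in> N" for y
    using fmult[OF that sgrpD(3)[OF N(2) that]] f1 mg_inverse_unique[of "f y"] by simp
  define ker where "ker = {y \<in> N. f y = 1}"
  have sk: "sgrp ker" unfolding sgrp_def ker_def using sgrpD[OF N(2)] fmult finv f1 by auto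
  have nk: "normalised G ker" unfolding normalised_def ker_def using fcj N(3) by (auto simp: normalisedD)
  define c where "c = f e"
  have c1: "c \<noteq> 1"
  proof
    assume "c = 1"
    then have "e \<in> ker" using N by (simp add: ker_def c_def)
    then have "N \<subseteq> ker" unfolding N_def using sk nk N(4) by (intro normal_closure_least) (auto simp: ker_def)
    then show False using x by (auto simp: ker_def f_def)
  qed
  have cm: "c \<in> L m" using fm N by (simp add: c_def)
  obtain \<tau> where \<tau>: "m \<le> \<tau>" "\<tau> < n" "c \<in> L \<tau>" "c \<notin> L (Suc \<tau>)" by (rule level[OF cm c1 mn])
  have L\<tau>: "L \<tau> \<subseteq> f ` N"
  proof (rule normal_contains_L[OF _ _ _ \<tau>(2) _ \<tau>(3,4)])
    show "sgrp (f ` N)" unfolding sgrp_def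
    proof (intro conjI ballI)
      show "1 \<in> f ` N" using sgrpD(1)[OF N(2)] f1 by (rule rev_image_eqI[OF _ sym])
      fix u assume "u \<in> f ` N"
      then obtain y where y: "u = f y" "y \<in> N" by blast
      show "inverse u \<in> f ` N" using finv[OF y(2)] sgrpD(3)[OF N(2) y(2)] y(1) by (simp add: rev_image_eqI)
      fix v assume "v \<in> f ` N"
      then obtain z where z: "v = f z" "z \<in> N" by blast
      show "u * v \<in> f ` N" using fmult[OF y(2) z(2)] sgrpD(2)[OF N(2) y(2) z(2)] y(1) z(1) by (simp add: rev_image_eqI)
    qed
    show "normalised G (f ` N)" unfolding normalised_def
    proof (intro ballI)
      fix u g assume "u \<in> f ` N" and g: "g \<in> G"
      then obtain y where y: "u = f y" "y \<in> N" by blast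
      show "cj u g \<in> f ` N" using fcj[OF y(2) g] normalisedD[OF N(3) y(2) g] y(1) by (simp add: rev_image_eqI)
    qed
  qed (use \<tau> j N c_def in auto)
  have count: "card (L \<tau>) * card ker \<le> card N"
  proof -
    define r where "r z = (SOME y. y \<in> N \<and> f y = z)" for z
    have r: "r z \<in> N \<and> f (r z) = z" if "z \<in> L \<tau>" for z
      unfolding r_def by (rule someI_ex) (use L\<tau> that in auto)
    have inj: "inj_on (\<lambda>(z, k). r z * k) (L \<tau> \<times> ker)"
    proof (rule inj_onI)
      fix a b assume ab: "a \<in> L \<tau> \<times> ker" "b \<in> L \<tau> \<times> ker" "(case a of (z, k) \<Rightarrow> r z * k) = (case b of (z, k) \<Rightarrow> r z * k)"
      obtain z k z' k' where eq: "a = (z, k)" "b = (z', k')" by (cases a; cases b)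
      have *: "z \<in> L \<tau>" "z' \<in> L \<tau>" "k \<in> ker" "k' \<in> ker" "r z * k = r z' * k'" using ab eq by auto
      have "f (r z * k) = z" "f (r z' * k') = z'" using r *(1-4) fmult by (auto simp: ker_def)
      then have "z = z'" using *(5) by simp
      then show "a = b" using * eq by simp
    qed
    have sub: "(\<lambda>(z, k). r z * k) ` (L \<tau> \<times> ker) \<subseteq> N" using r sgrpD(2)[OF N(2)] by (auto simp: ker_def)
    have "finite N" using N finG finite_subset by blast
    then show ?thesis using card_inj_on_le[OF inj sub] by (simp add: card_cartesian_product)
  qed
  have finker: "finite ker" using N finG finite_subset[of ker N] finite_subset[of N G] by (auto simp: ker_def)
  have lower: "n - \<tau> + (n - k) \<le> n - i" if "L k \<subseteq> ker" "2 \<le> k" "k \<le> n" for k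
  proof -
    have "p ^ (n - \<tau> + (n - k)) = card (L \<tau>) * card (L k)"
      using card_L[of \<tau>] card_L[of k] \<tau> j that by (simp only: power_add)
    also have "\<dots> \<le> card (L \<tau>) * card ker" using card_mono[OF finker that(1)] by simp
    also have "\<dots> \<le> p ^ (n - i)" using count i by simp
    finally show ?thesis using p2 by simp
  qed
  define t where "t = n - \<tau>"
  have t1: "1 \<le> t" "\<tau> = n - t" "t < n" using \<tau> j by (auto simp: t_def)
  have "L j \<subseteq> ker"
  proof
    fix k assume k: "k \<in> L j"
    obtain l h where h: "h \<in> L (Suc j)" "k = x ^ l * h" by (rule layer_generator[OF j(3,4) x(1) xm k])
    have "f (x ^ l) = 1" by (simp add: f_def com_eq_1_iff power_commutes)
    moreover have "f h = 1"
      using cen(2)[OF xN, of h] h(1) j(1) by (simp add: f_def com_eq_1_iff)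
    moreover have "h \<in> N" "x ^ l \<in> N" using h LmN j xN sgrp_power[OF N(2)] by auto
    ultimately show "k \<in> ker" using h fmult sgrpD(2)[OF N(2)] by (auto simp: ker_def)
  qed
  from lower[OF this] have ti: "2 * t + 1 \<le> n - i" using \<tau> j unfolding t_def by linarith
  have cG: "c \<in> G" and cN: "c \<in> N" using cm LmN N by auto
  have codd: "p \<noteq> 2" using p3 by simp
  \<comment> \<open>\<open>x\<close> commutes with \<open>c\<close>, so \<open>e\<close>, \<open>e c\<close> and \<open>e c\<^sup>2\<close> are conjugates of \<open>e\<close>\<close>
  have ec: "cj e x = e * c" by (simp add: cj_com c_def f_def)
  have cx: "cj c x = c" using cen(2)[OF xN cm, symmetric] by (simp add: cj_def mult.assoc)
  have qc: "quad c"
  proof (rule quad_progression_2(1)[OF codd e(1) cG cen(2)[OF N(1) cm] e(3)])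
    show "quad (e * c)" using quad_cj[OF e(3,1) xG] by (simp add: ec)
    have "cj e (x * x) = e * c * c" by (simp add: cj_cj[symmetric] ec cj_mult cx)
    then show "quad (e * c * c)" using quad_cj[OF e(3,1), of "x * x"] xG sgrpD(2)[OF sgrpG] by simp
  qed
  have zcom: "z * g = g * z" if "z \<in> L (n - 1)" "g \<in> G" for z g
    using comL[of "n - 1" z g] that n Ln by (simp add: com_eq_1_iff)
  consider "t = 1" | "t = 2" | "3 \<le> t" using t1 by linarith
  then show ?thesis
  proof cases
    case 1
    then show ?thesis using that[of c] \<tau> t1 c1 qc by simp
  next
    case 2
    obtain g where g: "g \<in> G" "com c g \<in> L (Suc \<tau>)" "com c g \<notin> L (Suc (Suc \<tau>))"
      by (rule com_next[OF _ _ \<tau>(3,4)]) (use 2 t1 \<tau> j n in auto)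
    define z where "z = com c g"
    have z: "z \<in> L (n - 1)" "z \<noteq> 1" using g 2 t1 n Ln by (auto simp: z_def Suc_diff_Suc numeral_2_eq_2)
    have zG: "z \<in> G" using z LinG by blast
    have cg: "cj c g = c * z" by (simp add: cj_com z_def)
    have zg: "cj z g = z" using zcom[OF z(1) g(1)] by (simp add: cj_def mult.assoc)
    have "quad z"
    proof (rule quad_progression_2(1)[OF codd cG zG zcom[OF z(1) cG, symmetric] qc])
      show "quad (c * z)" using quad_cj[OF qc cG g(1)] by (simp add: cg)
      have "cj c (g * g) = c * z * z" by (simp add: cj_cj[symmetric] cg cj_mult zg)
      then show "quad (c * z * z)" using quad_cj[OF qc cG, of "g * g"] g sgrpD(2)[OF sgrpG] by simp
    qed
    then show ?thesis using that z by blast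
  next
    case 3
    have n4: "4 \<le> n" using 3 ti by simp
    have Lm2: "L (n - 2) \<subseteq> L m" by (rule Lmono) (use \<tau>(1) t1(2) 3 in linarith)
    have ep: "e ^ p = 1" by (rule quad_power_p[OF e(3,1)])
    \<comment> \<open>quadratic elements have order \<open>p\<close>, which bounds the level of \<open>e\<close> from below\<close>
    have "n - i \<le> p"
    proof (cases "2 \<le> i")
      case True
      then show ?thesis using order_p_at_level[OF p3 True i(2) _ i(3) ep] i(6) by auto
    next
      case False
      then have i1: "i = 1" using i by simp
      have e2: "e \<notin> L 2" using i(3) i1 by (simp add: numeral_2_eq_2)
      have "e \<in> cz 2"
      proof (rule ccontr)
        assume ne: "e \<notin> cz 2"
        obtain y where y: "y \<in> L 2" "y \<notin> L (Suc 2)" using L_neq[of 2] n by auto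
        have cy: "com y e \<in> L (Suc 2)" "com y e \<notin> L (Suc (Suc 2))" using uniserial[OF e(1) ne _ _ y] n by auto
        have yN: "y \<in> N" using y i(5) i1 by (auto simp: numeral_2_eq_2)
        have fc: "f y * f e = f e * f y" using cen(2)[of "f y" "f e"] fm yN N(1) LmN by blast
        have "f (com y e) = inverse (f y) * inverse (f e) * f y * f e"
          using yN N fmult finv sgrpD[OF N(2)] by (simp add: com_def)
        also have "\<dots> = 1" using fc by (simp add: mult.assoc)
        finally have "com y e \<in> ker" using sgrp_com[OF N(2) yN N(1)] by (simp add: ker_def)
        from normal_contains_L[OF sk nk _ _ this cy] have "L 3 \<subseteq> ker" using n4 by (simp add: numeral_3_eq_3)
        from lower[OF this] show False using n4 i1 3 \<tau> by (simp add: t_def)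
      qed
      \<comment> \<open>the last layers are centralised by \<open>N\<close>, in particular by \<open>e\<close>, and \<open>e\<close> generates \<open>cz 2\<close> modulo \<open>L 2\<close>\<close>
      moreover have "cz 2 \<subseteq> cz (n - 2)"
      proof
        fix u assume u: "u \<in> cz 2"
        obtain k h where h: "h \<in> L 2" "u = e ^ k * h" by (rule cz_gen2[OF _ _ \<open>e \<in> cz 2\<close> e2 u]) (use n4 in auto)
        have "e \<in> cz (n - 2)"
        proof (rule czI[OF e(1)])
          fix v assume "v \<in> L (n - 2)"
          then have "v \<in> L m" using Lm2 by blast
          then have "com v e = 1" using cen(2)[OF N(1)] by (simp add: com_eq_1_iff)
          then show "com v e \<in> L (n - 2 + 2)" using sgrpD(1)[OF sgrpL] by simp
        qed
        then show "u \<in> cz (n - 2)" unfolding h(2) using L2_cz h(1) sgrp_power[OF sgrp_cz] sgrpD(2)[OF sgrp_cz] by blast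
      qed
      ultimately have "n \<le> 1 + p" using order_p_at_level_1[OF p3 n4 _ e2 ep] by blast
      then show ?thesis using i1 by simp
    qed
    then have t3: "t = 3" and p5: "5 \<le> p" using ti p7 3 by linarith+
    have \<tau>3: "\<tau> = n - 3" "3 \<le> \<tau>" using t3 t1 \<tau> j by auto
    have c2: "cz (n - 3) \<subset> G" by (rule cz_proper) (use \<tau>3 in auto)
    have c2': "cz (n - 2) \<subset> G" by (rule cz_proper) (use \<tau>3 in auto)
    have "\<And>H. H \<in> {cz (n - 3), cz (n - 2)} \<Longrightarrow> sgrp H \<and> H \<subset> G"
      using sgrp_cz c2 c2' by auto
    moreover have "card {cz (n - 3), cz (n - 2)} \<le> p"
      using p3 card_insert_le_m1[of 2 "{cz (n - 2)}" "cz (n - 3)"] by simp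
    ultimately obtain s where s: "s \<in> G" "\<And>H. H \<in> {cz (n - 3), cz (n - 2)} \<Longrightarrow> s \<notin> H"
      using avoid_subgroups[of "{cz (n - 3), cz (n - 2)}"] by blast
    define b where "b = com c s"
    define z where "z = com b s"
    have idx: "Suc (n - 3) = n - 2" "Suc (n - 2) = n - 1" "Suc (n - 1) = n" using n4 by auto
    have b: "b \<in> L (n - 2)" "b \<notin> L (n - 1)"
      using uniserial[OF s(1), of "n - 3" c] s(2) \<tau> \<tau>3 unfolding b_def idx by (auto simp: idx)
    have z: "z \<in> L (n - 1)" "z \<notin> L n"
      using uniserial[OF s(1), of "n - 2" b] s(2) b n4 unfolding z_def idx by (auto simp: idx)
    have z1: "z \<noteq> 1" using z(2) Ln by auto
    have bm: "b \<in> L m" using b Lm2 by blast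
    have G: "b \<in> G" "z \<in> G" using b z LinG by auto
    have cb: "c * b = b * c" by (rule cen(2)[OF cN bm])
    have cz': "c * z = z * c" "b * z = z * b" using zcom[OF z(1)] cG G by auto
    have js: "cj c s = c * b" "cj b s = b * z" "cj z s = z"
      using zcom[OF z(1) s(1)] cj_com[of c s] cj_com[of b s] by (simp_all only: b_def[symmetric] z_def[symmetric]) (simp add: cj_def mult.assoc)
    have zp: "z ^ k * b ^ l = b ^ l * z ^ k" for k l using cz'(2) by (metis power_commuting_commutes)
    have bz: "(b * z) ^ k = b ^ k * z ^ k" for k
      by (induction k) (simp_all add: mult.assoc, metis zp mult.assoc power_one_right)
    have step: "cj (c * b ^ k * z ^ l) s = c * b ^ Suc k * z ^ (k + l)" for k l
      by (simp add: cj_mult cj_power js bz power_add mult.assoc)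
    \<comment> \<open>the conjugates $c\,b^k z^{k(k-1)/2}$ for \<open>k = 0, \<dots>, 4\<close>\<close>
    define s' where "s' k = cj c (s ^ k)" for k
    have s'Suc: "s' (Suc k) = cj (s' k) s" for k
      unfolding s'_def cj_cj by (simp add: power_commutes)
    have q': "quad (s' k)" for k unfolding s'_def by (rule quad_cj[OF qc cG sgrp_power[OF sgrpG s(1)]])
    have s'1: "s' 1 = c * b ^ 1 * z ^ 0" using s'Suc[of 0] js by (simp add: s'_def)
    have s'2: "s' 2 = c * b ^ 2 * z ^ 1" using s'Suc[of 1] step[of 1 0] s'1 by (simp add: numeral_2_eq_2)
    have s'3: "s' 3 = c * b ^ 3 * z ^ 3" using s'Suc[of 2] step[of 2 1] s'2 by (simp add: numeral_3_eq_3)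
    have s'4: "s' 4 = c * b ^ 4 * z ^ 6" using s'Suc[of 3] step[of 3 3] s'3 by (simp add: eval_nat_numeral)
    have "quad z"
    proof (rule quad_progression_3[OF p5 cG G cb cz' qc])
      show "quad (c * b)" "quad (c * b ^ 2 * z)" "quad (c * b ^ 3 * z ^ 3)" "quad (c * b ^ 4 * z ^ 6)"
        using q'[of 1] q'[of 2] q'[of 3] q'[of 4] unfolding s'1 s'2 s'3 s'4 by auto
    qed
    then show ?thesis using that z z1 by blast
  qed
qed

text \<open>The offender \<open>E\<close> is first replaced by a quadratic offender \<open>Q\<close>, regarding \<open>V\<close> as a module for \<open>E\<close> only. If the normal closures of
the elements of \<open>Q\<close> are abelian, the closure of an element of smallest level contains \<open>Q\<close>: this is clear
inside \<open>L 2\<close>. If \<open>e \<in> Q\<close> lies outside \<open>L 2\<close> and some \<open>d \<in> Q\<close> does not lie in its closure, then \<open>e\<close> commutes with \<open>d\<close> and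
with a maximal subgroup not containing \<open>d\<close>, so \<open>e\<close> would be central, contrary to its level.\<close>

theorem central_quadratic:
  assumes p3: "3 \<le> p" and p7: "p \<le> 7" and E: "sgrp E" "E \<subseteq> G" "E \<noteq> {1}" "card V \<le> meas E"
    and ab: "\<And>x y. x \<in> E \<Longrightarrow> y \<in> E \<Longrightarrow> x * y = y * x" and ep: "\<And>x. x \<in> E \<Longrightarrow> x ^ p = 1"
  obtains z where "z \<in> L (n - 1)" "z \<noteq> 1" "quad z"
proof -
  interpret E: faithful_module E V act p
  proof
    show "finite E" using E(2) finG by (rule finite_subset)
  qed (use E(1) subsetD[OF E(2)] p V finV torsion act_V act_add act_mult act_one faithful in simp_all)
  have nE: "normalised E E" using sgrp_cj[OF E(1)] by (simp add: normalised_def)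
  obtain Q where Q: "sgrp Q" "Q \<subseteq> E" "Q \<noteq> {1}" "\<And>f. f \<in> Q \<Longrightarrow> quad f" "card V \<le> meas Q"
    using E.offender_in_abelian_normal[OF E(1) order.refl nE ab ep E(1) order.refl E(3,4)] by metis
  have QG: "Q \<subseteq> G" using Q E by auto
  show ?thesis
  proof (cases "\<exists>e\<in>Q. \<not> (\<forall>x\<in>normal_closure G e. \<forall>y\<in>normal_closure G e. x * y = y * x)")
    case True
    then obtain e where e: "e \<in> Q" "\<not> (\<forall>x\<in>normal_closure G e. \<forall>y\<in>normal_closure G e. x * y = y * x)" by blast
    have "e \<noteq> 1"
    proof
      assume "e = 1"
      then have "normal_closure G e \<subseteq> {1}" using sgrpD(1)[OF sgrpG] by (intro normal_closure_least) (auto simp: sgrp_def normalised_def)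
      then show False using e(2) by auto
    qed
    then show ?thesis using nonabelian_closure[OF p3 p7 _ _ Q(4)[OF e(1)] e(2)] e(1) QG that by blast
  next
    case False
    then have abn: "x * y = y * x" if "e \<in> Q" "x \<in> normal_closure G e" "y \<in> normal_closure G e" for e x y using that by blast
    have "\<exists>e\<in>Q. Q \<subseteq> normal_closure G e"
    proof (cases "Q \<subseteq> L 2")
      case True
      define P where "P i \<longleftrightarrow> 2 \<le> i \<and> i < n \<and> (\<exists>x\<in>Q. x \<in> L i \<and> x \<notin> L (Suc i))" for i
      obtain x where x: "x \<in> Q" "x \<noteq> 1" using Q sgrpD(1)[OF Q(1)] by blast
      obtain i where "P i"
        by (rule level[of x 2]) (use x True n in \<open>auto simp: P_def\<close>)
      \<comment> \<open>the smallest level of an element of \<open>Q\<close>\<close>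
      define i0 where "i0 = (LEAST i. P i)"
      have P0: "P i0" unfolding i0_def using \<open>P i\<close> by (rule LeastI)
      then obtain e where e: "e \<in> Q" "e \<in> L i0" "e \<notin> L (Suc i0)" "2 \<le> i0" "i0 < n" by (auto simp: P_def)
      have "Q \<subseteq> L i0"
      proof
        fix y assume y: "y \<in> Q"
        show "y \<in> L i0"
        proof (cases "y = 1")
          case True then show ?thesis using sgrpD(1)[OF sgrpL] by simp
        next
          case y1: False
          obtain k where k: "2 \<le> k" "k < n" "y \<in> L k" "y \<notin> L (Suc k)"
            by (rule level[of y 2]) (use y y1 \<open>Q \<subseteq> L 2\<close> n in auto)
          then have "P k" using y by (auto simp: P_def)
          then have "i0 \<le> k" unfolding i0_def by (rule Least_le)
          then show ?thesis using Lmono k by blast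
        qed
      qed
      moreover have "L i0 \<subseteq> normal_closure G e"
        using normal_contains_L[OF _ _ e(4,5) _ e(2,3)] normal_closure_props[OF sgrpG, of e] e QG by blast
      ultimately show ?thesis using e by blast
    next
      case False
      then obtain e where e: "e \<in> Q" "e \<notin> L 2" by blast
      have eG: "e \<in> G" using e QG by blast
      note nc = normal_closure_props[OF sgrpG eG]
      have "Q \<subseteq> normal_closure G e"
      proof (rule ccontr)
        assume "\<not> Q \<subseteq> normal_closure G e"
        then obtain d where d: "d \<in> Q" "d \<notin> normal_closure G e" by blast
        have dG: "d \<in> G" using d QG by blast
        have cG: "card G = p * card (normal_closure G e)" using outside_L2(1)[OF eG e(2)] cardG n by (simp flip: power_Suc)
        obtain g where g: "g \<in> G" "com e g \<notin> L 3" using outside_L2(3)[OF eG e(2)] by blast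
        obtain k h where h: "h \<in> normal_closure G e" "g = d ^ k * h"
          by (rule cyclic_quotient[OF nc(2) sgrpG order.refl nc(4) cG dG d(2) normalisedD[OF nc(3) _ dG] g(1)])
        have "e * d = d * e" using ab e d Q by blast
        then have 1: "e * d ^ k = d ^ k * e" by (metis power_commuting_commutes)
        have 2: "e * h = h * e" using abn[OF e(1) nc(1) h(1)] .
        have "e * g = d ^ k * (e * h)" unfolding h(2) using 1 by (simp add: mult.assoc[symmetric])
        also have "\<dots> = g * e" unfolding 2 h(2) by (simp add: mult.assoc)
        finally have "com e g = 1" by (simp add: com_eq_1_iff)
        then show False using g sgrpD(1)[OF sgrpL] by simp
      qed
      then show ?thesis using e by blast
    qed
    then obtain e where e: "e \<in> Q" "Q \<subseteq> normal_closure G e" by blast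
    note nc = normal_closure_props[OF sgrpG subsetD[OF QG e(1)]]
    \<comment> \<open>a normal elementary abelian subgroup containing \<open>Q\<close>\<close>
    define A where "A = {x \<in> normal_closure G e. x ^ p = 1}"
    have abA: "x * y = y * x" if "x \<in> A" "y \<in> A" for x y using that abn[OF e(1)] by (auto simp: A_def)
    have pm: "(x * y) ^ k = x ^ k * y ^ k" if "x * y = y * x" for x y :: 'a and k
    proof (induction k)
      case (Suc k)
      have "y * x ^ k = x ^ k * y" using power_commuting_commutes[OF that, of k] by simp
      then have "y * (x ^ k * y ^ k) = x ^ k * (y * y ^ k)" by (metis mult.assoc)
      then show ?case using Suc by (simp add: mult.assoc)
    qed simp
    have sA: "sgrp A"
      unfolding sgrp_def
    proof (intro conjI ballI)
      show "1 \<in> A" using sgrpD(1)[OF nc(2)] by (simp add: A_def)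
      show "x * y \<in> A" if "x \<in> A" "y \<in> A" for x y
        using that pm[OF abA[OF that]] sgrpD(2)[OF nc(2)] by (simp add: A_def)
      show "inverse x \<in> A" if "x \<in> A" for x
        using that sgrpD(3)[OF nc(2)] mg_inverse_power[of x p] by (auto simp: A_def)
    qed
    have nA: "normalised G A" using nc(3) by (auto simp: normalised_def A_def cj_power[symmetric])
    have AG: "A \<subseteq> G" using nc(4) by (auto simp: A_def)
    have QA: "Q \<subseteq> A" using e(2) Q(2) ep by (auto simp: A_def)
    have epA: "x ^ p = 1" if "x \<in> A" for x using that by (simp add: A_def)
    obtain F where F: "sgrp F" "F \<subseteq> A" "F \<noteq> {1}" "normalised G F" "\<And>f. f \<in> F \<Longrightarrow> quad f"
      using offender_in_abelian_normal[OF sA AG nA abA epA Q(1) QA Q(3,5)] by metis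
    have "L (n - 1) \<subseteq> F" using normal_contains_bottom[OF F(1,4) _ F(3)] F(2) AG by blast
    moreover obtain z where "z \<in> L (n - 1)" "z \<noteq> 1" using Ln1 sgrpD(1)[OF sgrpL, of "n - 1"] by blast
    ultimately show ?thesis using that F(5) by blast
  qed
qed

end

context faithful_module
begin

text \<open>Stated with natural numbers as coefficients: no nontrivial linear relation between \<open>act g\<close> and the identity. Applied to a nonzero vector
\<open>d = D g v\<close>, which is fixed by \<open>g\<close>, the relation gives \<open>k + l = 0\<close> modulo \<open>p\<close>; applied to \<open>v\<close> it then gives \<open>k d = 0\<close>.\<close>

lemma degree_at_least_2:
  assumes g: "g \<in> G" "g \<noteq> 1" "quad g" and eq: "\<And>v. v \<in> V \<Longrightarrow> of_nat k * act g v + of_nat l * v = 0"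
  shows "p dvd k" "p dvd l"
proof -
  obtain v where v: "v \<in> V" "act g v \<noteq> v" using faithful[OF g(1)] g(2) by blast
  define d where "d = D g v"
  have d: "d \<in> V" "d \<noteq> 0" "D g d = 0" using v g D_V by (auto simp: d_def quad_def D_def)
  have kill: "p dvd m" if "of_nat m * d = 0" for m
  proof (rule ccontr)
    assume "\<not> p dvd m"
    then have "coprime m p" using prime_imp_coprime[OF p] by (simp add: coprime_commute)
    then show False using torsion_cancel[OF d(1) that] d(2) by simp
  qed
  have "of_nat (k + l) * d = 0" using eq[OF d(1)] d(3) by (simp add: D_def distrib_right)
  then have kl: "p dvd k + l" by (rule kill)
  then obtain q where q: "k + l = p * q" by blast
  have "of_nat (k + l) * v = of_nat q * (of_nat p * v)" unfolding q by (simp add: algebra_simps)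
  then have "of_nat (k + l) * v = 0" using torsion[OF v(1)] by simp
  moreover have "of_nat k * act g v + of_nat l * v = of_nat k * d + of_nat (k + l) * v"
    by (simp add: d_def D_def algebra_simps)
  ultimately have "of_nat k * d = 0" using eq[OF v(1)] by simp
  then show "p dvd k" by (rule kill)
  then show "p dvd l" using kl by (simp add: dvd_add_right_iff)
qed

end

context max_class_module
begin

lemma bottom_central: "z \<in> L (n - 1) \<Longrightarrow> g \<in> G \<Longrightarrow> z * g = g * z"
  using comL[of "n - 1" z g] n Ln by (simp add: com_eq_1_iff)

text \<open>A central involution satisfies $(z - 1)^2 = 2 (1 - z) = 0$.\<close>

lemma two_group_quadratic:
  assumes "p = 2"
  obtains z where "z \<in> L (n - 1)" "z \<noteq> 1" "quad z"
proof -
  obtain z where z: "z \<in> L (n - 1)" "z \<noteq> 1" using Ln1 sgrpD(1)[OF sgrpL, of "n - 1"] by blast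
  have fin: "finite (L (n - 1))" using LG finG finite_subset by blast
  have "card (L (n - 1)) = p" using card_L[of "n - 1"] n by simp
  then have zp: "z * z = 1" using sgrp_pow_card[OF sgrpL fin z(1)] assms by (simp add: power2_eq_square)
  have zG: "z \<in> G" using z LG by blast
  have "D z (D z v) = 0" if v: "v \<in> V" for v
  proof -
    have "act z (act z v) = v" using act_mult[OF zG zG v] act_one[OF v] zp by simp
    then have "D z (D z v) = of_nat p * (v - act z v)"
      using v zG assms by (simp add: D_def act_diff act_V)
    then show ?thesis using torsion[OF add_subgroupD(2)[OF V v act_V[OF zG v]]] by simp
  qed
  then show ?thesis using that z by (simp add: quad_def)
qed

end

section \<open>Coordinates on a module over the prime field\<close>

lemma residue_simps:
  "carrier (residue_ring m) = {0..m - 1}" "\<one>\<^bsub>residue_ring m\<^esub> = 1" "\<zero>\<^bsub>residue_ring m\<^esub> = 0"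
  "a \<otimes>\<^bsub>residue_ring m\<^esub> b = (a * b) mod m" "a \<oplus>\<^bsub>residue_ring m\<^esub> b = (a + b) mod m"
  by (simp_all add: residue_ring_def)

lemma of_nat_mod_char:
  assumes "CHAR('k :: comm_ring_1) = p"
  shows "of_nat (m mod p) = (of_nat m :: 'k)"
proof -
  have "(of_nat m :: 'k) = of_nat (p * (m div p) + m mod p)" by simp
  also have "\<dots> = of_nat CHAR('k) * of_nat (m div p) + of_nat (m mod p)" unfolding assms of_nat_add of_nat_mult ..
  finally show ?thesis by simp
qed

text \<open>A linear embedding of \<open>V\<close> into the functions from \<open>V\<close> to a ring of characteristic \<open>p\<close>. Choose a submodule \<open>U\<close> of maximal size that has
an embedding whose values are supported on \<open>U\<close>. If \<open>w\<close> lies outside \<open>U\<close>, mapping \<open>w\<close> to the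
indicator function of \<open>{w}\<close> extends the embedding to \<open>U + \<langle>w\<rangle>\<close>; it stays injective since the coordinate \<open>w\<close> is unused on \<open>U\<close>.\<close>

lemma coordinates:
  fixes V :: "(int, 'v, 'n) module_scheme" and p :: nat
  assumes p: "Factorial_Ring.prime p" and M: "module (residue_ring (int p)) V" and fin: "finite (carrier V)"
    and ch: "CHAR('k :: comm_ring_1) = p"
  shows "\<exists>\<iota> :: 'v \<Rightarrow> 'v \<Rightarrow> 'k. (\<forall>u\<in>carrier V. \<forall>v\<in>carrier V. \<iota> (u \<oplus>\<^bsub>V\<^esub> v) = \<iota> u + \<iota> v) \<and>
    (\<forall>a\<in>{0..int p - 1}. \<forall>v\<in>carrier V. \<iota> (a \<odot>\<^bsub>V\<^esub> v) = of_nat (nat a) * \<iota> v) \<and> inj_on \<iota> (carrier V)"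
proof -
  interpret module "residue_ring (int p)" V by (rule M)
  note sm = residue_simps[of "int p"]
  have p1: "1 < p" using p prime_gt_1_nat by blast
  define coords :: "'v set \<Rightarrow> ('v \<Rightarrow> 'v \<Rightarrow> 'k) \<Rightarrow> bool" where "coords U \<iota> \<longleftrightarrow>
    (\<forall>u\<in>U. \<forall>v\<in>U. \<iota> (u \<oplus>\<^bsub>V\<^esub> v) = \<iota> u + \<iota> v) \<and> (\<forall>a\<in>{0..int p - 1}. \<forall>v\<in>U. \<iota> (a \<odot>\<^bsub>V\<^esub> v) = of_nat (nat a) * \<iota> v)
    \<and> (\<forall>u\<in>U. \<iota> u = 0 \<longrightarrow> u = \<zero>\<^bsub>V\<^esub>) \<and> (\<forall>u\<in>U. \<forall>x. x \<notin> U \<longrightarrow> \<iota> u x = 0)" for U \<iota>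
  define sub where "sub U \<longleftrightarrow> U \<subseteq> carrier V \<and> \<zero>\<^bsub>V\<^esub> \<in> U \<and> (\<forall>u\<in>U. \<forall>v\<in>U. u \<oplus>\<^bsub>V\<^esub> v \<in> U)
    \<and> (\<forall>a\<in>{0..int p - 1}. \<forall>v\<in>U. a \<odot>\<^bsub>V\<^esub> v \<in> U)" for U
  define good where "good U \<longleftrightarrow> sub U \<and> (\<exists>\<iota>. coords U \<iota>)" for U
  have sub_minus: "\<ominus>\<^bsub>V\<^esub> u \<in> U" if "sub U" "u \<in> U" for U u
  proof -
    have u: "u \<in> carrier V" using that by (auto simp: sub_def)
    have in_R: "\<ominus>\<^bsub>residue_ring (int p)\<^esub> \<one>\<^bsub>residue_ring (int p)\<^esub> \<in> carrier (residue_ring (int p))" by simp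
    have "(\<ominus>\<^bsub>residue_ring (int p)\<^esub> \<one>\<^bsub>residue_ring (int p)\<^esub>) \<odot>\<^bsub>V\<^esub> u = \<ominus>\<^bsub>V\<^esub> u"
      using smult_l_minus[OF R.one_closed u] smult_one[OF u] by simp
    then show ?thesis using in_R that unfolding sub_def sm(1) by metis
  qed
  have "good {\<zero>\<^bsub>V\<^esub>}"
  proof -
    have "sub {\<zero>\<^bsub>V\<^esub>}" unfolding sub_def using smult_r_null unfolding sm(1) by auto
    moreover have "coords {\<zero>\<^bsub>V\<^esub>} (\<lambda>_. 0)" unfolding coords_def by simp
    ultimately show ?thesis unfolding good_def by blast
  qed
  moreover have bd: "card U < Suc (card (carrier V))" if "good U" for U
    using that fin card_mono[of "carrier V" U] by (auto simp: good_def sub_def)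
  ultimately obtain U where U: "good U" and Umax: "\<And>U'. good U' \<Longrightarrow> card U' \<le> card U"
    using ex_has_greatest_nat[of good "{\<zero>\<^bsub>V\<^esub>}" card "Suc (card (carrier V))"] by auto
  obtain \<iota> where \<iota>: "coords U \<iota>" and sU: "sub U" using U by (auto simp: good_def)
  have UV: "U \<subseteq> carrier V" using sU by (simp add: sub_def)
  have "U = carrier V"
  proof (rule ccontr)
    assume "U \<noteq> carrier V"
    then obtain w where w: "w \<in> carrier V" "w \<notin> U" using UV by blast
    let ?S = "{0..int p - 1}"
    let ?m = "\<lambda>u a. u \<oplus>\<^bsub>V\<^esub> a \<odot>\<^bsub>V\<^esub> w"
    have sc: "a \<odot>\<^bsub>V\<^esub> v \<in> carrier V" if "a \<in> ?S" "v \<in> carrier V" for a v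
      using smult_closed[of a v] that by (simp add: sm(1))
    have z0: "0 \<odot>\<^bsub>V\<^esub> v = \<zero>\<^bsub>V\<^esub>" if "v \<in> carrier V" for v
      using smult_l_null[OF that] by (simp add: sm(3))
    have line: "a = 0" if a: "a \<in> ?S" and aw: "a \<odot>\<^bsub>V\<^esub> w \<in> U" for a
    proof (rule ccontr)
      assume "a \<noteq> 0"
      then have "coprime a (int p)"
        using a p prime_imp_coprime[of "int p" a] zdvd_not_zless[of a "int p"] by (auto simp: coprime_commute)
      then obtain b where b: "[a * b = 1] (mod int p)" using cong_solve_coprime_int by blast
      define c where "c = b mod int p"
      have c: "c \<in> ?S" using p1 by (auto simp: c_def)
      have "(c * a) mod int p = 1" using b p1 by (simp add: c_def cong_def mod_mult_left_eq mod_mult_right_eq mult.commute)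
      then have "c \<odot>\<^bsub>V\<^esub> (a \<odot>\<^bsub>V\<^esub> w) = w"
        using smult_assoc1[of c a w] smult_one[OF w(1)] a c w unfolding sm by simp
      moreover have "c \<odot>\<^bsub>V\<^esub> (a \<odot>\<^bsub>V\<^esub> w) \<in> U" using sU c aw by (simp add: sub_def)
      ultimately show False using w by simp
    qed
    have uniq: "u = u' \<and> a = b" if u: "u \<in> U" "u' \<in> U" and ab: "a \<in> ?S" "b \<in> ?S" and eq: "?m u a = ?m u' b" for u u' a b
    proof -
      define c where "c = (a - b) mod int p"
      have c: "c \<in> ?S" using p1 by (auto simp: c_def)
      have "a = (c + b) mod int p" using ab by (simp add: c_def mod_add_left_eq)
      then have aw: "a \<odot>\<^bsub>V\<^esub> w = c \<odot>\<^bsub>V\<^esub> w \<oplus>\<^bsub>V\<^esub> b \<odot>\<^bsub>V\<^esub> w"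
        using smult_l_distr[of c b w] c ab w unfolding sm by simp
      have car: "u \<in> carrier V" "u' \<in> carrier V" "c \<odot>\<^bsub>V\<^esub> w \<in> carrier V" "b \<odot>\<^bsub>V\<^esub> w \<in> carrier V"
        using u UV sc c ab w by auto
      have 1: "u \<oplus>\<^bsub>V\<^esub> c \<odot>\<^bsub>V\<^esub> w = u'" using eq car unfolding aw by (simp add: M.a_assoc[symmetric])
      then have "c \<odot>\<^bsub>V\<^esub> w = \<ominus>\<^bsub>V\<^esub> u \<oplus>\<^bsub>V\<^esub> u'" using car by (metis M.r_neg1)
      then have "c \<odot>\<^bsub>V\<^esub> w \<in> U" using sU u sub_minus[OF sU u(1)] by (simp add: sub_def)
      then have c0: "c = 0" by (rule line[OF c])
      then have "u = u'" using 1 car z0[OF w(1)] by simp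
      moreover have "a = b" using \<open>a = (c + b) mod int p\<close> c0 ab by simp
      ultimately show ?thesis by simp
    qed
    define U' where "U' = {?m u a | u a. u \<in> U \<and> a \<in> ?S}"
    define \<delta> :: "'v \<Rightarrow> 'k" where "\<delta> x = (if x = w then 1 else 0)" for x
    define \<kappa> where "\<kappa> x = (THE f. \<exists>u a. u \<in> U \<and> a \<in> ?S \<and> x = ?m u a \<and> f = \<iota> u + of_nat (nat a) * \<delta>)" for x
    have \<kappa>: "\<kappa> (?m u a) = \<iota> u + of_nat (nat a) * \<delta>" if "u \<in> U" "a \<in> ?S" for u a
      unfolding \<kappa>_def by (rule the_equality) (use that uniq in blast)+
    have UU': "U \<subseteq> U'"
    proof
      fix u assume u: "u \<in> U"
      then have "u = ?m u 0" using z0[OF w(1)] UV by auto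
      moreover have "0 \<in> ?S" using p1 by simp
      ultimately show "u \<in> U'" using u unfolding U'_def by blast
    qed
    have wU': "w \<in> U'"
    proof -
      have "w = ?m \<zero>\<^bsub>V\<^esub> 1" using smult_one[OF w(1)] w by (simp add: sm)
      moreover have "\<zero>\<^bsub>V\<^esub> \<in> U" "1 \<in> ?S" using sU p1 by (auto simp: sub_def)
      ultimately show ?thesis unfolding U'_def by blast
    qed
    have add: "?m u a \<oplus>\<^bsub>V\<^esub> ?m u' b = ?m (u \<oplus>\<^bsub>V\<^esub> u') ((a + b) mod int p)" "(a + b) mod int p \<in> ?S"
      if "u \<in> U" "u' \<in> U" "a \<in> ?S" "b \<in> ?S" for u u' a b
    proof -
      have "((a + b) mod int p) \<odot>\<^bsub>V\<^esub> w = a \<odot>\<^bsub>V\<^esub> w \<oplus>\<^bsub>V\<^esub> b \<odot>\<^bsub>V\<^esub> w"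
        using smult_l_distr[of a b w] that w unfolding sm by simp
      then show "?m u a \<oplus>\<^bsub>V\<^esub> ?m u' b = ?m (u \<oplus>\<^bsub>V\<^esub> u') ((a + b) mod int p)"
        using that UV sc[OF _ w(1)] by (simp add: subsetD M.a_ac)
      show "(a + b) mod int p \<in> ?S" using p1 by auto
    qed
    have mul: "c \<odot>\<^bsub>V\<^esub> ?m u a = ?m (c \<odot>\<^bsub>V\<^esub> u) ((c * a) mod int p)" "(c * a) mod int p \<in> ?S"
      if "u \<in> U" "a \<in> ?S" "c \<in> ?S" for u a c
    proof -
      have "((c * a) mod int p) \<odot>\<^bsub>V\<^esub> w = c \<odot>\<^bsub>V\<^esub> (a \<odot>\<^bsub>V\<^esub> w)"
        using smult_assoc1[of c a w] that w unfolding sm by simp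
      then show "c \<odot>\<^bsub>V\<^esub> ?m u a = ?m (c \<odot>\<^bsub>V\<^esub> u) ((c * a) mod int p)"
        using smult_r_distr[of c u "a \<odot>\<^bsub>V\<^esub> w"] that UV sc[OF _ w(1)] by (simp add: subsetD sm(1))
      show "(c * a) mod int p \<in> ?S" using p1 by auto
    qed
    have nat_mod: "of_nat (nat (x mod int p)) * \<delta> = of_nat (nat x) * \<delta>" if "0 \<le> x" for x
    proof -
      have "nat (x mod int p) = nat x mod p" using that by (simp add: nat_mod_distrib)
      then show ?thesis using of_nat_mod_char[OF ch] by (simp add: fun_eq_iff)
    qed
    have "sub U'" unfolding sub_def
    proof (intro conjI ballI)
      show "U' \<subseteq> carrier V" using UV sc[OF _ w(1)] by (auto simp: U'_def)
      show "\<zero>\<^bsub>V\<^esub> \<in> U'" using sU UU' by (auto simp: sub_def)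
      fix x assume "x \<in> U'"
      then obtain u a where x: "x = ?m u a" "u \<in> U" "a \<in> ?S" unfolding U'_def by blast
      show "c \<odot>\<^bsub>V\<^esub> x \<in> U'" if "c \<in> ?S" for c
        using mul[OF x(2,3) that] x that sU unfolding U'_def sub_def by blast
      fix y assume "y \<in> U'"
      then obtain u' b where y: "y = ?m u' b" "u' \<in> U" "b \<in> ?S" unfolding U'_def by blast
      show "x \<oplus>\<^bsub>V\<^esub> y \<in> U'" using add[OF x(2) y(2) x(3) y(3)] x y sU unfolding U'_def sub_def by blast
    qed
    moreover have "coords U' \<kappa>" unfolding coords_def
    proof (intro conjI ballI allI impI)
      fix x assume xU: "x \<in> U'"
      then obtain u a where x: "x = ?m u a" "u \<in> U" "a \<in> ?S" unfolding U'_def by blast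
      have \<kappa>x: "\<kappa> x = \<iota> u + of_nat (nat a) * \<delta>" using \<kappa>[OF x(2,3)] x(1) by simp
      show "\<kappa> (c \<odot>\<^bsub>V\<^esub> x) = of_nat (nat c) * \<kappa> x" if c: "c \<in> ?S" for c
      proof -
        have "c \<odot>\<^bsub>V\<^esub> u \<in> U" using sU c x by (simp add: sub_def)
        then have "\<kappa> (c \<odot>\<^bsub>V\<^esub> x) = \<iota> (c \<odot>\<^bsub>V\<^esub> u) + of_nat (nat ((c * a) mod int p)) * \<delta>"
          using mul[OF x(2,3) c] \<kappa> x(1) by simp
        also have "\<iota> (c \<odot>\<^bsub>V\<^esub> u) = of_nat (nat c) * \<iota> u" using \<iota> c x by (simp add: coords_def)
        also have "of_nat (nat ((c * a) mod int p)) * \<delta> = of_nat (nat c) * (of_nat (nat a) * \<delta>)"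
          using nat_mod[of "c * a"] c x by (simp add: nat_mult_distrib mult.assoc)
        finally show ?thesis unfolding \<kappa>x by (simp add: fun_eq_iff distrib_left)
      qed
      show "\<kappa> (x \<oplus>\<^bsub>V\<^esub> y) = \<kappa> x + \<kappa> y" if yU: "y \<in> U'" for y
      proof -
        obtain u' b where y: "y = ?m u' b" "u' \<in> U" "b \<in> ?S" using yU unfolding U'_def by blast
        have \<kappa>y: "\<kappa> y = \<iota> u' + of_nat (nat b) * \<delta>" using \<kappa>[OF y(2,3)] y(1) by simp
        have "u \<oplus>\<^bsub>V\<^esub> u' \<in> U" using sU x y by (simp add: sub_def)
        then have "\<kappa> (x \<oplus>\<^bsub>V\<^esub> y) = \<iota> (u \<oplus>\<^bsub>V\<^esub> u') + of_nat (nat ((a + b) mod int p)) * \<delta>"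
          using add[OF x(2) y(2) x(3) y(3)] \<kappa> x(1) y(1) by simp
        also have "\<iota> (u \<oplus>\<^bsub>V\<^esub> u') = \<iota> u + \<iota> u'" using \<iota> x y by (simp add: coords_def)
        also have "of_nat (nat ((a + b) mod int p)) * \<delta> = of_nat (nat a) * \<delta> + of_nat (nat b) * \<delta>"
          using nat_mod[of "a + b"] y x by (simp add: nat_add_distrib distrib_right)
        finally show ?thesis unfolding \<kappa>x \<kappa>y by (simp add: fun_eq_iff algebra_simps)
      qed
      show "x = \<zero>\<^bsub>V\<^esub>" if "\<kappa> x = 0"
      proof -
        have "\<iota> u w = 0" using \<iota> x w by (simp add: coords_def)
        then have "(of_nat (nat a) :: 'k) = 0" using fun_cong[OF that, of w] unfolding \<kappa>x by (simp add: \<delta>_def)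
        then have "p dvd nat a" using ch by (simp add: of_nat_eq_0_iff_char_dvd)
        then have a0: "a = 0" using x(3) dvd_imp_le[of p "nat a"] by (cases "a = 0") auto
        then have "\<iota> u = 0" using that unfolding \<kappa>x by simp
        then have "u = \<zero>\<^bsub>V\<^esub>" using \<iota> x by (simp add: coords_def)
        then show ?thesis using x a0 z0[OF w(1)] by simp
      qed
      fix y assume "y \<notin> U'"
      then have "y \<noteq> w" "y \<notin> U" using wU' UU' by auto
      then show "\<kappa> x y = 0" using \<iota> x unfolding \<kappa>x by (simp add: coords_def \<delta>_def)
    qed
    ultimately have "good U'" by (auto simp: good_def)
    moreover have "finite U'" using \<open>sub U'\<close> fin finite_subset by (auto simp: sub_def)
    then have "card U < card U'" using UU' wU' w by (intro psubset_card_mono) auto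
    ultimately show False using Umax[of U'] by simp
  qed
  then have c: "coords (carrier V) \<iota>" using \<iota> by simp
  show ?thesis
  proof (intro exI[of _ \<iota>] conjI ballI)
    show add: "\<iota> (u \<oplus>\<^bsub>V\<^esub> v) = \<iota> u + \<iota> v" if "u \<in> carrier V" "v \<in> carrier V" for u v
      using c that by (simp add: coords_def)
    show "\<iota> (a \<odot>\<^bsub>V\<^esub> v) = of_nat (nat a) * \<iota> v" if "a \<in> {0..int p - 1}" "v \<in> carrier V" for a v
      using c that by (simp add: coords_def)
    show "inj_on \<iota> (carrier V)"
    proof (rule inj_onI)
      fix u v assume uv: "u \<in> carrier V" "v \<in> carrier V" "\<iota> u = \<iota> v"
      have m: "u \<ominus>\<^bsub>V\<^esub> v \<in> carrier V" "(u \<ominus>\<^bsub>V\<^esub> v) \<oplus>\<^bsub>V\<^esub> v = u"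
        using uv by (simp_all add: M.minus_eq M.a_assoc M.l_neg)
      have "\<iota> (u \<ominus>\<^bsub>V\<^esub> v) + \<iota> v = \<iota> u"
        using add[OF m(1) uv(2)] m(2) by simp
      then have "\<iota> (u \<ominus>\<^bsub>V\<^esub> v) = 0" using uv(3) by simp
      then have "u \<ominus>\<^bsub>V\<^esub> v = \<zero>\<^bsub>V\<^esub>" using c m(1) by (simp add: coords_def)
      then show "u = v" using m(2) uv(2) by simp
    qed
  qed
qed

section \<open>The regular representation\<close>

typedef 'g perm = "{f :: 'g \<Rightarrow> 'g. bij f}"
  by (rule exI[of _ id]) simp

setup_lifting type_definition_perm

instantiation perm :: (type) mgroup
begin
lift_definition times_perm :: "'a perm \<Rightarrow> 'a perm \<Rightarrow> 'a perm" is "(\<circ>)" by (rule bij_comp)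
lift_definition one_perm :: "'a perm" is id by simp
lift_definition inverse_perm :: "'a perm \<Rightarrow> 'a perm" is "inv_into UNIV" by (rule bij_imp_bij_inv)
definition divide_perm :: "'a perm \<Rightarrow> 'a perm \<Rightarrow> 'a perm" where "divide_perm f g = f * inverse g"
instance by standard (transfer; auto simp: bij_is_inj o_assoc)+
end

text \<open>Left multiplications are extended by the identity outside the carrier, so that they become permutations of the whole type.\<close>

lemma (in group) cayley:
  "\<exists>e :: 'a \<Rightarrow> 'a perm. inj_on e (carrier G) \<and> (\<forall>x\<in>carrier G. \<forall>y\<in>carrier G. e (x \<otimes> y) = e x * e y)"
proof -
  define f where "f g x = (if x \<in> carrier G then g \<otimes> x else x)" for g x
  have ff: "f g \<circ> f h = f (g \<otimes> h)" if "g \<in> carrier G" "h \<in> carrier G" for g h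
    using that by (auto simp: f_def fun_eq_iff m_assoc)
  have f1: "f \<one> = id" by (auto simp: f_def fun_eq_iff)
  have bij: "bij (f g)" if "g \<in> carrier G" for g
    by (rule o_bij[of "f (inv g)"]) (use that ff f1 in simp_all)
  show ?thesis
  proof (intro exI[of _ "\<lambda>g. Abs_perm (f g)"] conjI ballI)
    show "inj_on (\<lambda>g. Abs_perm (f g)) (carrier G)"
    proof (rule inj_onI)
      fix x y assume xy: "x \<in> carrier G" "y \<in> carrier G" "Abs_perm (f x) = Abs_perm (f y)"
      then have "f x \<one> = f y \<one>" using bij by (simp add: Abs_perm_inject)
      then show "x = y" using xy by (simp add: f_def)
    qed
    show "Abs_perm (f (x \<otimes> y)) = Abs_perm (f x) * Abs_perm (f y)" if "x \<in> carrier G" "y \<in> carrier G" for x y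
      using that bij ff by (simp add: times_perm.abs_eq eq_onp_def)
  qed
qed

context max_class_module
begin

lemma central_quadratic_any_prime:
  assumes p7: "p \<le> 7" and E: "sgrp E" "E \<subseteq> G" "E \<noteq> {1}" "card V \<le> meas E"
    and ab: "\<And>x y. x \<in> E \<Longrightarrow> y \<in> E \<Longrightarrow> x * y = y * x" and ep: "\<And>x. x \<in> E \<Longrightarrow> x ^ p = 1"
  shows "\<exists>z\<in>G. z \<noteq> 1 \<and> quad z \<and> (\<forall>g\<in>G. z * g = g * z)"
proof -
  obtain z where z: "z \<in> L (n - 1)" "z \<noteq> 1" "quad z"
  proof (cases "p = 2")
    case True
    then show ?thesis using that two_group_quadratic by blast
  next
    case False
    then have "3 \<le> p" using p2 by simp
    then show ?thesis using that central_quadratic[OF _ p7 E ab ep] by blast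
  qed
  then show ?thesis using LG bottom_central by blast
qed

end

section \<open>Polynomials over the prime field\<close>

text \<open>The polynomial \<open>[1, -1]\<close> is recognised as \<open>X - 1\<close> by adding the polynomial 1 to it.\<close>

lemma X_minus_one_squared:
  assumes "Factorial_Ring.prime (p :: nat)"
  defines "R \<equiv> residue_ring (int p)"
  shows "(X\<^bsub>R\<^esub> \<ominus>\<^bsub>poly_ring R\<^esub> \<one>\<^bsub>poly_ring R\<^esub>) [^]\<^bsub>poly_ring R\<^esub> (2::nat) = [1, (-2) mod int p, 1]"
proof -
  have p1: "1 < int p" using prime_gt_1_nat[OF assms(1)] by simp
  interpret residues_prime p R by unfold_locales (use assms in auto)
  interpret P: domain "poly_ring R" by (rule univ_poly_is_domain[OF carrier_is_subring])
  note rs = residue_simps[of "int p", folded R_def]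
  have m1: "(-1) mod int p \<noteq> 0" using p1 by (simp add: zmod_minus1)
  define Y where "Y = [1, (-1) mod int p]"
  have Yp: "Y \<in> carrier (poly_ring R)"
    using p1 by (auto simp: Y_def univ_poly_def polynomial_def rs)
  have "Y \<oplus>\<^bsub>poly_ring R\<^esub> \<one>\<^bsub>poly_ring R\<^esub> = X\<^bsub>R\<^esub>"
    using p1 by (simp add: Y_def univ_poly_def var_def rs mod_add_left_eq)
  then have "X\<^bsub>R\<^esub> \<ominus>\<^bsub>poly_ring R\<^esub> \<one>\<^bsub>poly_ring R\<^esub> = Y"
    using Yp by (metis P.one_closed P.minus_eq P.a_assoc P.r_neg P.a_inv_closed P.r_zero)
  then have "(X\<^bsub>R\<^esub> \<ominus>\<^bsub>poly_ring R\<^esub> \<one>\<^bsub>poly_ring R\<^esub>) [^]\<^bsub>poly_ring R\<^esub> (2::nat) = Y \<otimes>\<^bsub>poly_ring R\<^esub> Y"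
    using Yp by (simp add: numeral_2_eq_2)
  also have "\<dots> = [1, (-2) mod int p, 1]"
    using p1 m1 by (simp add: Y_def univ_poly_def rs mod_add_eq mod_mult_eq mod_simps)
  finally show ?thesis .
qed

lemma minimal_polynomialI:
  fixes V :: "(int, 'v, 'n) module_scheme" and p :: nat
  assumes p: "Factorial_Ring.prime p" and M: "module (residue_ring (int p)) V"
    and T: "\<And>v. v \<in> carrier V \<Longrightarrow> T v \<in> carrier V"
    and ann: "\<And>v. v \<in> carrier V \<Longrightarrow> T (T v) \<oplus>\<^bsub>V\<^esub> (((-2) mod int p) \<odot>\<^bsub>V\<^esub> T v \<oplus>\<^bsub>V\<^esub> v) = \<zero>\<^bsub>V\<^esub>"
    and min: "\<And>a b. a \<in> {0..int p - 1} \<Longrightarrow> b \<in> {0..int p - 1} \<Longrightarrow>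
      (\<And>v. v \<in> carrier V \<Longrightarrow> a \<odot>\<^bsub>V\<^esub> T v \<oplus>\<^bsub>V\<^esub> b \<odot>\<^bsub>V\<^esub> v = \<zero>\<^bsub>V\<^esub>) \<Longrightarrow> a = 0 \<and> b = 0"
  shows "is_minimal_polynomial (residue_ring (int p)) V T [1, (-2) mod int p, 1]"
proof -
  interpret module "residue_ring (int p)" V by (rule M)
  have p1: "1 < int p" using prime_gt_1_nat[OF p] by simp
  note rs = residue_simps[of "int p"]
  have one: "1 \<odot>\<^bsub>V\<^esub> v = v" if "v \<in> carrier V" for v using smult_one[OF that] by (simp add: rs)
  have zero: "0 \<odot>\<^bsub>V\<^esub> v = \<zero>\<^bsub>V\<^esub>" if "v \<in> carrier V" for v using smult_l_null[OF that] by (simp add: rs)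
  have sc: "a \<odot>\<^bsub>V\<^esub> v \<in> carrier V" if "a \<in> {0..int p - 1}" "v \<in> carrier V" for a v
    using smult_closed[of a v] that by (simp add: rs)
  show ?thesis
    unfolding is_minimal_polynomial_def
  proof (intro conjI ballI impI)
    show "[1, (-2) mod int p, 1] \<in> carrier (poly_ring (residue_ring (int p)))"
      using p1 by (auto simp: univ_poly_def polynomial_def rs)
    show "lead_coeff [1, (-2) mod int p, 1] = \<one>\<^bsub>residue_ring (int p)\<^esub>" by (simp add: rs)
    show "annihilates V T [1, (-2) mod int p, 1]"
      unfolding annihilates_def using ann T one by (simp add: numeral_2_eq_2)
    fix q assume q: "q \<in> carrier (poly_ring (residue_ring (int p)))" and q2: "q \<noteq> [] \<and> annihilates V T q"
    have qR: "set q \<subseteq> {0..int p - 1}" "hd q \<noteq> 0"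
      using q q2 by (auto simp: univ_poly_def polynomial_def rs)
    have an: "endo_eval V T q v = \<zero>\<^bsub>V\<^esub>" if "v \<in> carrier V" for v using q2 that by (simp add: annihilates_def)
    show "degree [1, (-2) mod int p, 1] \<le> degree q"
    proof (rule ccontr)
      assume "\<not> ?thesis"
      then have "length q < 3" by simp
      then consider b where "q = [b]" | a b where "q = [a, b]"
        using q2 by (cases q; cases "tl q"; auto)
      then show False
      proof cases
        case (1 b)
        then have b: "b \<in> {0..int p - 1}" "b \<noteq> 0" using qR by auto
        have "0 \<odot>\<^bsub>V\<^esub> T v \<oplus>\<^bsub>V\<^esub> b \<odot>\<^bsub>V\<^esub> v = \<zero>\<^bsub>V\<^esub>" if "v \<in> carrier V" for v
          using an[OF that] that sc[OF b(1)] T zero by (simp add: 1)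
        then show False using min[of 0 b] b p1 by auto
      next
        case (2 a b)
        then have ab: "a \<in> {0..int p - 1}" "a \<noteq> 0" "b \<in> {0..int p - 1}" using qR by auto
        have "a \<odot>\<^bsub>V\<^esub> T v \<oplus>\<^bsub>V\<^esub> b \<odot>\<^bsub>V\<^esub> v = \<zero>\<^bsub>V\<^esub>" if "v \<in> carrier V" for v
          using an[OF that] that sc[OF ab(3)] T by (simp add: 2)
        then show False using min[of a b] ab by blast
      qed
    qed
  qed simp
qed

section \<open>Conclusion\<close>

lemma (in group) lower_central_series_subgroup: "subgroup (lower_central_series G k) G"
proof (induction k)
  case 0
  then show ?case by (simp add: subgroup_self)
next
  case (Suc k)
  then show ?case using subgroup.subset[OF Suc] by (auto intro!: generate_is_subgroup)
qed

lemma (in group) lower_central_series_decreasing: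
  "lower_central_series G (Suc k) \<subseteq> lower_central_series G k"
proof (induction k)
  case 0
  then show ?case using subgroup.subset[OF lower_central_series_subgroup[of "Suc 0"]] by simp
next
  case (Suc k)
  show ?case
    unfolding lower_central_series.simps(2)[of G "Suc k"] lower_central_series.simps(2)[of G k]
    by (rule mono_generate) (use Suc in auto)
qed

text \<open>The ring \<open>'k\<close> only serves to provide coordinates; its choice depends on \<open>p\<close>. The group and the module are replaced by their images \<open>G'\<close> and \<open>V'\<close>,
where the preceding sections yield a central quadratic element; the rest translates this back into the minimal polynomial.\<close>

lemma quadratic_conjecture_over:
  fixes p :: nat and G :: "('g, 'b) monoid_scheme" and V :: "(int, 'v, 'n) module_scheme"
    and \<rho> :: "'g \<Rightarrow> 'v \<Rightarrow> 'v"
  assumes p: "Factorial_Ring.prime p" and p7: "p \<le> 7" and mc: "maximal_class p G"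
    and F: "F_module p G V \<rho>" and ch: "CHAR('k :: comm_ring_1) = p"
  shows "\<exists>z\<in>Omega1_center p G. quadratic_on (residue_ring (int p)) V \<rho> z"
proof -
  let ?lcs = "lower_central_series G"
  let ?S = "{0..int p - 1}"
  have p1: "1 < int p" using prime_gt_1_nat[OF p] by simp
  obtain n where grp: "group G" and n2: "n \<ge> 2" and ord: "order G = p ^ n" and cls: "has_nilpotency_class G (n - 1)"
    using mc by (auto simp: maximal_class_def)
  interpret group G by (rule grp)
  obtain E where fgm: "faithful_group_module (residue_ring (int p)) G V \<rho>" and finV: "finite (carrier V)"
    and E: "elementary_abelian_subgroup p E G" "E \<noteq> {\<one>\<^bsub>G\<^esub>}" "card (carrier V) \<le> card E * card (fixed_vectors V \<rho> E)"
    using F by (auto simp: F_module_def)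
  interpret W: faithful_group_module "residue_ring (int p)" G V \<rho> by (rule fgm)
  have M: "module (residue_ring (int p)) V" by (rule W.V.module_axioms)
  have finG: "finite (carrier G)" using ord prime_gt_0_nat[OF p] by (intro order_gt_0_iff_finite[THEN iffD1]) simp
  have \<rho>V: "\<rho> g v \<in> carrier V" if "g \<in> carrier G" "v \<in> carrier V" for g v
    using W.act.element_image[OF that refl] .
  have \<rho>1: "\<rho> \<one>\<^bsub>G\<^esub> v = v" if "v \<in> carrier V" for v using W.act.id_eq_one that by (metis restrict_apply')
  have \<rho>m: "\<rho> (g \<otimes>\<^bsub>G\<^esub> h) v = \<rho> g (\<rho> h v)" if "g \<in> carrier G" "h \<in> carrier G" "v \<in> carrier V" for g h v
    using W.act.composition_rule[OF that(3,1,2)] .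
  have \<rho>f: "g = \<one>\<^bsub>G\<^esub>" if g: "g \<in> carrier G" and fixed: "\<And>v. v \<in> carrier V \<Longrightarrow> \<rho> g v = v" for g
  proof -
    have "\<rho> g = \<rho> \<one>\<^bsub>G\<^esub>"
    proof (rule extensionalityI)
      show "\<rho> g \<in> extensional (carrier V)" "\<rho> \<one>\<^bsub>G\<^esub> \<in> extensional (carrier V)"
        using W.act.bij_prop0 g by (auto simp: Bij_def)
    qed (use fixed \<rho>1 in simp)
    then show ?thesis using W.faithful g by (auto dest: inj_onD)
  qed
  obtain e :: "'g \<Rightarrow> 'g perm" where e: "inj_on e (carrier G)"
    and em: "\<And>x y. x \<in> carrier G \<Longrightarrow> y \<in> carrier G \<Longrightarrow> e (x \<otimes>\<^bsub>G\<^esub> y) = e x * e y"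
    using cayley by blast
  obtain \<iota> :: "'v \<Rightarrow> 'v \<Rightarrow> 'k" where \<iota>a: "\<And>u v. u \<in> carrier V \<Longrightarrow> v \<in> carrier V \<Longrightarrow> \<iota> (u \<oplus>\<^bsub>V\<^esub> v) = \<iota> u + \<iota> v"
    and \<iota>s: "\<And>a v. a \<in> ?S \<Longrightarrow> v \<in> carrier V \<Longrightarrow> \<iota> (a \<odot>\<^bsub>V\<^esub> v) = of_nat (nat a) * \<iota> v"
    and \<iota>: "inj_on \<iota> (carrier V)"
    using coordinates[OF p M finV ch] by blast
  have e1: "e \<one>\<^bsub>G\<^esub> = 1" using em[of "\<one>\<^bsub>G\<^esub>" "\<one>\<^bsub>G\<^esub>"] mg_left_mult_cancel[of "e \<one>\<^bsub>G\<^esub>" "e \<one>\<^bsub>G\<^esub>" 1] by simp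
  have ei: "e (inv\<^bsub>G\<^esub> x) = inverse (e x)" if "x \<in> carrier G" for x
    using em[OF that inv_closed[OF that]] mg_inverse_unique[of "e x" "e (inv\<^bsub>G\<^esub> x)"] that e1 by simp
  have ep: "e (x [^]\<^bsub>G\<^esub> k) = e x ^ k" if "x \<in> carrier G" for x and k :: nat
    using that by (induction k) (simp_all add: e1 em power_commutes)
  have img: "sgrp (e ` H)" if H: "subgroup H G" for H
    unfolding sgrp_def
  proof (intro conjI ballI)
    have HG: "\<And>x. x \<in> H \<Longrightarrow> x \<in> carrier G" using subgroup.subset[OF H] by blast
    show "1 \<in> e ` H" using subgroup.one_closed[OF H] e1 by (metis imageI)
    fix a assume "a \<in> e ` H"
    then obtain x where x: "a = e x" "x \<in> H" by blast
    show "inverse a \<in> e ` H" using x HG ei subgroup.m_inv_closed[OF H] by (metis imageI)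
    fix b assume "b \<in> e ` H"
    then obtain y where y: "b = e y" "y \<in> H" by blast
    show "a * b \<in> e ` H" using x y HG em subgroup.m_closed[OF H] by (metis imageI)
  qed
  have pre: "subgroup {x \<in> carrier G. e x \<in> K} G" if K: "sgrp K" for K
    by (rule subgroupI) (use sgrpD[OF K] e1 ei em one_closed in auto)
  have inve: "inv_into (carrier G) e (e x) = x" if "x \<in> carrier G" for x using e that by simp
  have inv\<iota>: "inv_into (carrier V) \<iota> (\<iota> v) = v" if "v \<in> carrier V" for v using \<iota> that by simp
  define G' where "G' = e ` carrier G"
  define V' where "V' = \<iota> ` carrier V"
  define act where "act g w = \<iota> (\<rho> (inv_into (carrier G) e g) (inv_into (carrier V) \<iota> w))" for g w
  have act: "act (e x) (\<iota> v) = \<iota> (\<rho> x v)" if "x \<in> carrier G" "v \<in> carrier V" for x v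
    using that by (simp add: act_def inve inv\<iota>)
  have \<iota>0: "\<iota> \<zero>\<^bsub>V\<^esub> = 0" using \<iota>a[of "\<zero>\<^bsub>V\<^esub>" "\<zero>\<^bsub>V\<^esub>"] by simp
  have \<iota>eq: "u = v \<longleftrightarrow> \<iota> u = \<iota> v" if "u \<in> carrier V" "v \<in> carrier V" for u v using \<iota> that by (auto dest: inj_onD)
  have \<iota>neg: "\<iota> u - \<iota> v = \<iota> (u \<ominus>\<^bsub>V\<^esub> v)" if "u \<in> carrier V" "v \<in> carrier V" for u v
  proof -
    have "u \<ominus>\<^bsub>V\<^esub> v \<in> carrier V" "(u \<ominus>\<^bsub>V\<^esub> v) \<oplus>\<^bsub>V\<^esub> v = u"
      using that by (simp_all add: W.V.M.minus_eq W.V.M.a_assoc W.V.M.l_neg)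
    then show ?thesis using \<iota>a[of "u \<ominus>\<^bsub>V\<^esub> v" v] that by (simp add: diff_eq_eq)
  qed
  have ofp: "of_nat p * f = 0" for f :: "'v \<Rightarrow> 'k"
    using of_nat_CHAR[where 'a = 'k] unfolding ch by (simp add: fun_eq_iff)
  interpret M: faithful_module G' V' act p
  proof
    show "sgrp G'" unfolding G'_def by (rule img[OF subgroup_self])
    show "add_subgroup V'" unfolding add_subgroup_def V'_def
    proof (intro conjI ballI)
      show "0 \<in> \<iota> ` carrier V" using \<iota>0 by (metis W.V.M.zero_closed imageI)
      show "x - y \<in> \<iota> ` carrier V" if "x \<in> \<iota> ` carrier V" "y \<in> \<iota> ` carrier V" for x y
        using that \<iota>neg by (metis (no_types, lifting) W.V.M.minus_closed imageE imageI)
    qed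
    show "of_nat p * v = 0" for v :: "'v \<Rightarrow> 'k" by (rule ofp)
    show "finite G'" "finite V'" using finG finV by (simp_all add: G'_def V'_def)
    show "act g v \<in> V'" if "g \<in> G'" "v \<in> V'" for g v
      using that act \<rho>V by (auto simp: G'_def V'_def)
    show "act g (v + w) = act g v + act g w" if gvw: "g \<in> G'" "v \<in> V'" "w \<in> V'" for g v w
    proof -
      obtain x a b where x: "g = e x" "v = \<iota> a" "w = \<iota> b" "x \<in> carrier G" "a \<in> carrier V" "b \<in> carrier V"
        using gvw by (auto simp: G'_def V'_def)
      have "act g (v + w) = \<iota> (\<rho> x (a \<oplus>\<^bsub>V\<^esub> b))" using x act \<iota>a[symmetric] by simp
      also have "\<dots> = act g v + act g w" using x act \<iota>a \<rho>V W.act_add by simp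
      finally show ?thesis .
    qed
    show "act (g * h) v = act g (act h v)" if "g \<in> G'" "h \<in> G'" "v \<in> V'" for g h v
      using that act \<rho>V \<rho>m by (auto simp: G'_def V'_def em[symmetric])
    show "act 1 v = v" if "v \<in> V'" for v
      using that act[OF one_closed] \<rho>1 by (auto simp: V'_def e1)
    show "g = 1" if g: "g \<in> G'" and fixed: "\<And>v. v \<in> V' \<Longrightarrow> act g v = v" for g
    proof -
      obtain x where x: "g = e x" "x \<in> carrier G" using g by (auto simp: G'_def)
      have "\<rho> x v = v" if v: "v \<in> carrier V" for v
        using fixed[of "\<iota> v"] act[OF x(2) v] x v \<iota>eq[OF \<rho>V[OF x(2) v] v] by (simp add: V'_def)
      then show ?thesis using \<rho>f[OF x(2)] x e1 by simp
    qed
  qed (rule p)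
  have EG: "subgroup E G" and Eab: "\<And>x y. x \<in> E \<Longrightarrow> y \<in> E \<Longrightarrow> x \<otimes>\<^bsub>G\<^esub> y = y \<otimes>\<^bsub>G\<^esub> x"
    and Ep: "\<And>x. x \<in> E \<Longrightarrow> x [^]\<^bsub>G\<^esub> p = \<one>\<^bsub>G\<^esub>"
    using E(1) comm_monoid.m_comm[of "G\<lparr>carrier := E\<rparr>"]
    by (auto simp: elementary_abelian_subgroup_def comm_group_def)
  have Ec: "x \<in> carrier G" if "x \<in> E" for x using subgroup.subset[OF EG] that by blast
  define E' where "E' = e ` E"
  have E': "sgrp E'" "E' \<subseteq> G'" using img[OF EG] Ec by (auto simp: E'_def G'_def)
  have E'1: "E' \<noteq> {1}"
  proof
    assume "E' = {1}"
    then have "e x = e \<one>\<^bsub>G\<^esub>" if "x \<in> E" for x using that e1 by (auto simp: E'_def)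
    then have "E \<subseteq> {\<one>\<^bsub>G\<^esub>}" using e Ec by (auto dest: inj_onD)
    then show False using E(2) subgroup.one_closed[OF EG] by auto
  qed
  have E'ab: "x * y = y * x" if "x \<in> E'" "y \<in> E'" for x y
    using that Eab Ec by (auto simp: E'_def em[symmetric])
  have E'p: "x ^ p = 1" if "x \<in> E'" for x
    using that Ep Ec by (auto simp: E'_def ep[symmetric] e1)
  have "card V' \<le> M.meas E'"
  proof -
    have "M.fixv E' = \<iota> ` fixed_vectors V \<rho> E"
      unfolding M.fixv_def unfolding V'_def E'_def fixed_vectors_def
      using act Ec \<rho>V \<iota>eq by (auto simp: image_iff)
    moreover have "fixed_vectors V \<rho> E \<subseteq> carrier V" by (auto simp: fixed_vectors_def)
    ultimately have "card (M.fixv E') = card (fixed_vectors V \<rho> E)"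
      using \<iota> by (metis card_image inj_on_subset)
    moreover have "card E' = card E" "card V' = card (carrier V)"
      using e \<iota> Ec by (auto simp: E'_def V'_def intro!: card_image intro: inj_on_subset)
    ultimately show ?thesis using E(3) by (simp add: M.meas_def)
  qed
  note off = E' E'1 this
  have com_e: "com (e x) (e y) = e (inv\<^bsub>G\<^esub> x \<otimes>\<^bsub>G\<^esub> inv\<^bsub>G\<^esub> y \<otimes>\<^bsub>G\<^esub> x \<otimes>\<^bsub>G\<^esub> y)" if "x \<in> carrier G" "y \<in> carrier G" for x y
    using that by (simp add: com_def em ei)
  have lc: "?lcs k \<subseteq> carrier G" for k using subgroup.subset[OF lower_central_series_subgroup] .
  have lcom: "inv\<^bsub>G\<^esub> x \<otimes>\<^bsub>G\<^esub> inv\<^bsub>G\<^esub> y \<otimes>\<^bsub>G\<^esub> x \<otimes>\<^bsub>G\<^esub> y \<in> ?lcs (Suc k)" if x: "x \<in> ?lcs k" and y: "y \<in> carrier G" for x y k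
  proof -
    have xi: "inv\<^bsub>G\<^esub> x \<in> ?lcs k" by (rule subgroup.m_inv_closed[OF lower_central_series_subgroup x])
    have xG: "x \<in> carrier G" using x lc by blast
    have "inv\<^bsub>G\<^esub> x \<otimes>\<^bsub>G\<^esub> inv\<^bsub>G\<^esub> y \<otimes>\<^bsub>G\<^esub> inv\<^bsub>G\<^esub> (inv\<^bsub>G\<^esub> x) \<otimes>\<^bsub>G\<^esub> inv\<^bsub>G\<^esub> (inv\<^bsub>G\<^esub> y) \<in> ?lcs (Suc k)"
      unfolding lower_central_series.simps(2) by (rule generate.incl) (use xi inv_closed[OF y] in blast)
    then show ?thesis using xG y by simp
  qed
  have top: "?lcs (n - 1) = {\<one>\<^bsub>G\<^esub>}" using cls by (simp add: has_nilpotency_class_def)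
  have nontop: "?lcs k \<noteq> {\<one>\<^bsub>G\<^esub>}" if "k < n - 1" for k
    using cls that by (simp add: has_nilpotency_class_def)
  have "\<exists>z\<in>G'. z \<noteq> 1 \<and> M.quad z \<and> (\<forall>g\<in>G'. z * g = g * z)"
  proof (cases "n = 2")
    case True
    \<comment> \<open>here the nilpotency class is 1, so \<open>G\<close> is abelian\<close>
    have comm: "a * b = b * a" if ab: "a \<in> G'" "b \<in> G'" for a b
    proof -
      obtain x y where xy: "a = e x" "b = e y" "x \<in> carrier G" "y \<in> carrier G" using ab by (auto simp: G'_def)
      have "inv\<^bsub>G\<^esub> x \<otimes>\<^bsub>G\<^esub> inv\<^bsub>G\<^esub> y \<otimes>\<^bsub>G\<^esub> x \<otimes>\<^bsub>G\<^esub> y \<in> ?lcs (Suc 0)" by (rule lcom) (use xy in auto)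
      then have "com a b = 1" using top True xy com_e e1 by simp
      then show ?thesis by (simp add: com_eq_1_iff)
    qed
    have "normalised G' E'" unfolding normalised_def
    proof (intro ballI)
      fix x g assume x: "x \<in> E'" and g: "g \<in> G'"
      have "cj x g = x" using comm[of x g] x g E'(2) by (auto simp: cj_def mult.assoc)
      then show "cj x g \<in> E'" using x by simp
    qed
    then obtain F where F: "sgrp F" "F \<subseteq> E'" "F \<noteq> {1}" "\<And>f. f \<in> F \<Longrightarrow> M.quad f"
      using M.offender_in_abelian_normal[OF E' _ E'ab E'p E'(1) order.refl off(3,4)] by metis
    then obtain z where "z \<in> F" "z \<noteq> 1" using sgrpD(1)[OF F(1)] by blast
    then show ?thesis using F E'(2) comm by blast
  next
    case False
    \<comment> \<open>the given series is numbered from 0; truncated subtraction gives \<open>L 0 = L 1\<close>\<close>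
    define L where "L j = e ` ?lcs (j - 1)" for j
    interpret C: max_class_module G' p n L V' act
    proof
      show "card G' = p ^ n" using ord card_image[OF e] by (simp add: G'_def order_def)
      show "L 0 = G'" "L 1 = G'" by (simp_all add: L_def G'_def)
      show "sgrp (L j)" for j unfolding L_def by (rule img[OF lower_central_series_subgroup])
      show "L (Suc j) \<subseteq> L j" for j
        using lower_central_series_decreasing[of "j - 1"] by (cases j) (auto simp: L_def)
      show "com x g \<in> L (Suc j)" if j: "j \<ge> 1" and xg: "x \<in> L j" "g \<in> G'" for x g j
      proof -
        obtain u y where u: "x = e u" "u \<in> ?lcs (j - 1)" "g = e y" "y \<in> carrier G"
          using xg by (auto simp: L_def G'_def)
        have "u \<in> carrier G" using u(2) lc by blast
        then have "com x g \<in> e ` ?lcs (Suc (j - 1))" using lcom[OF u(2,4)] com_e[of u y] u by blast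
        then show ?thesis using j by (simp add: L_def del: lower_central_series.simps)
      qed
      show "L (Suc j) \<subseteq> K" if j: "j \<ge> 1" and K: "sgrp K" and c: "\<And>x g. x \<in> L j \<Longrightarrow> g \<in> G' \<Longrightarrow> com x g \<in> K" for j K
      proof -
        have "?lcs (Suc (j - 1)) \<subseteq> {x \<in> carrier G. e x \<in> K}"
          unfolding lower_central_series.simps
        proof (rule generate_subgroup_incl[OF _ pre[OF K]], safe)
          fix x y assume x: "x \<in> ?lcs (j - 1)" and y: "y \<in> carrier G"
          have xG: "x \<in> carrier G" using x lc by blast
          show "x \<otimes>\<^bsub>G\<^esub> y \<otimes>\<^bsub>G\<^esub> inv\<^bsub>G\<^esub> x \<otimes>\<^bsub>G\<^esub> inv\<^bsub>G\<^esub> y \<in> carrier G" using xG y by simp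
          have "inv\<^bsub>G\<^esub> x \<in> ?lcs (j - 1)" by (rule subgroup.m_inv_closed[OF lower_central_series_subgroup x])
          then have "com (e (inv\<^bsub>G\<^esub> x)) (e (inv\<^bsub>G\<^esub> y)) \<in> K" using y by (intro c) (auto simp: L_def G'_def)
          then show "e (x \<otimes>\<^bsub>G\<^esub> y \<otimes>\<^bsub>G\<^esub> inv\<^bsub>G\<^esub> x \<otimes>\<^bsub>G\<^esub> inv\<^bsub>G\<^esub> y) \<in> K" using com_e[of "inv\<^bsub>G\<^esub> x" "inv\<^bsub>G\<^esub> y"] xG y by simp
        qed
        then show ?thesis using j by (auto simp: L_def)
      qed
      show "3 \<le> n" using n2 False by simp
      show "L n = {1}" using top nontop e1 n2 by (simp add: L_def)
      show "L (n - 1) \<noteq> {1}"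
      proof
        assume 1: "L (n - 1) = {1}"
        have "?lcs (n - 2) \<subseteq> {\<one>\<^bsub>G\<^esub>}"
        proof
          fix x assume x: "x \<in> ?lcs (n - 2)"
          then have "e x \<in> L (n - 1)" by (simp add: L_def numeral_2_eq_2)
          then have "e x = e \<one>\<^bsub>G\<^esub>" using 1 e1 by simp
          then show "x \<in> {\<one>\<^bsub>G\<^esub>}" using x lc e by (auto dest!: inj_onD)
        qed
        then have "?lcs (n - 2) = {\<one>\<^bsub>G\<^esub>}" using subgroup.one_closed[OF lower_central_series_subgroup] by blast
        then show False using nontop[of "n - 2"] n2 False by simp
      qed
    qed (use p M.finG M.sgrpG in auto)
    show ?thesis by (rule C.central_quadratic_any_prime[OF p7 off E'ab E'p])
  qed
  then obtain z where z: "z \<in> carrier G" "e z \<noteq> 1" "M.quad (e z)" "\<And>g. g \<in> carrier G \<Longrightarrow> e z * e g = e g * e z"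
    by (auto simp: G'_def)
  have zG': "e z \<in> G'" using z by (simp add: G'_def)
  have "z \<in> center G"
    using z(1,4) e by (auto simp: center_def em[symmetric] dest: inj_onD)
  moreover have "group.ord G z = p"
  proof -
    have "e (z [^]\<^bsub>G\<^esub> p) = e \<one>\<^bsub>G\<^esub>" using M.quad_power_p[OF z(3) zG'] by (simp add: ep[OF z(1)] e1)
    then have "z [^]\<^bsub>G\<^esub> p = \<one>\<^bsub>G\<^esub>" using e z(1) by (auto dest!: inj_onD)
    then have "ord z dvd p" using z(1) by (simp add: pow_eq_id)
    moreover have "ord z \<noteq> 1" using z(1,2) e1 ord_eq_1 by auto
    ultimately show ?thesis using p by (auto simp: prime_nat_iff)
  qed
  ultimately have \<Omega>: "z \<in> Omega1_center p G" by (auto simp: Omega1_center_def intro: generate.incl)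
  have m2: "(-2) mod int p \<in> ?S" using p1 by auto
  have sc: "a \<odot>\<^bsub>V\<^esub> v \<in> carrier V" if "a \<in> ?S" "v \<in> carrier V" for a v
    using W.V.smult_closed[of a v] that by (simp add: residue_simps)
  have "quadratic_on (residue_ring (int p)) V \<rho> z"
    unfolding quadratic_on_def X_minus_one_squared[OF p]
  proof (rule minimal_polynomialI[OF p M])
    show "\<rho> z v \<in> carrier V" if "v \<in> carrier V" for v by (rule \<rho>V[OF z(1) that])
    show "\<rho> z (\<rho> z v) \<oplus>\<^bsub>V\<^esub> (((-2) mod int p) \<odot>\<^bsub>V\<^esub> \<rho> z v \<oplus>\<^bsub>V\<^esub> v) = \<zero>\<^bsub>V\<^esub>" if v: "v \<in> carrier V" for v
    proof -
      have V: "\<rho> z v \<in> carrier V" "\<rho> z (\<rho> z v) \<in> carrier V" using v z(1) \<rho>V by auto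
      have a: "act (e z) (\<iota> v) = \<iota> (\<rho> z v)" "act (e z) (\<iota> (\<rho> z v)) = \<iota> (\<rho> z (\<rho> z v))" using act v V z(1) by auto
      have "M.D (e z) (M.D (e z) (\<iota> v)) = 0" using z(3)[unfolded M.quad_def] v unfolding V'_def by blast
      then have q: "\<iota> (\<rho> z (\<rho> z v)) - \<iota> (\<rho> z v) - (\<iota> (\<rho> z v) - \<iota> v) = 0"
        using M.act_diff[OF zG', of "\<iota> (\<rho> z v)" "\<iota> v"] v V by (simp add: M.D_def a V'_def)
      have c: "of_nat (nat ((-2) mod int p)) * f = - 2 * f" for f :: "'v \<Rightarrow> 'k"
      proof -
        have "\<exists>k. (-2) mod int p = int p * k - 2" by (metis add_uminus_conv_diff minus_mult_div_eq_mod mult_minus_right uminus_add_conv_diff)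
        then obtain k where k: "(-2) mod int p = int p * k - 2" by blast
        have "nat ((-2) mod int p) + 2 = p * nat k"
        proof -
          have "0 \<le> int p * k - 2" using k p1 by (metis m2 atLeastAtMost_iff)
          then have "0 < int p * k" by simp
          then have "0 \<le> k" using p1 by (simp add: zero_less_mult_iff)
          then have "int (nat ((-2) mod int p) + 2) = int (p * nat k)" using k \<open>0 \<le> int p * k - 2\<close> by simp
          then show ?thesis by (simp only: of_nat_eq_iff)
        qed
        then have "of_nat (nat ((-2) mod int p) + 2) * f = of_nat (p * nat k) * f" by simp
        also have "\<dots> = of_nat p * (of_nat (nat k) * f)" by (simp add: mult.assoc)
        also have "\<dots> = 0" by (rule ofp)
        finally have "of_nat (nat ((-2) mod int p)) * f + 2 * f = 0"
          unfolding of_nat_add distrib_right by simp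
        then show ?thesis by (simp add: eq_neg_iff_add_eq_0)
      qed
      have "\<iota> (\<rho> z (\<rho> z v) \<oplus>\<^bsub>V\<^esub> (((-2) mod int p) \<odot>\<^bsub>V\<^esub> \<rho> z v \<oplus>\<^bsub>V\<^esub> v))
        = \<iota> (\<rho> z (\<rho> z v)) + (- 2 * \<iota> (\<rho> z v) + \<iota> v)"
        using v V sc[OF m2 V(1)] \<iota>a \<iota>s[OF m2 V(1)] c by simp
      also have "\<dots> = \<iota> \<zero>\<^bsub>V\<^esub>" using q \<iota>0 by (simp add: algebra_simps)
      finally show ?thesis using \<iota>eq v V sc[OF m2 V(1)] by simp
    qed
    fix a b assume ab: "a \<in> ?S" "b \<in> ?S" and z0: "\<And>v. v \<in> carrier V \<Longrightarrow> a \<odot>\<^bsub>V\<^esub> \<rho> z v \<oplus>\<^bsub>V\<^esub> b \<odot>\<^bsub>V\<^esub> v = \<zero>\<^bsub>V\<^esub>"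
    have "of_nat (nat a) * act (e z) w + of_nat (nat b) * w = 0" if w: "w \<in> V'" for w
    proof -
      obtain v where v: "w = \<iota> v" "v \<in> carrier V" using w by (auto simp: V'_def)
      have V: "\<rho> z v \<in> carrier V" using v \<rho>V z(1) by simp
      have "of_nat (nat a) * act (e z) w + of_nat (nat b) * w = \<iota> (a \<odot>\<^bsub>V\<^esub> \<rho> z v \<oplus>\<^bsub>V\<^esub> b \<odot>\<^bsub>V\<^esub> v)"
        using v V z(1) ab \<iota>a[OF sc[OF ab(1) V] sc[OF ab(2) v(2)]] \<iota>s act by simp
      then show ?thesis using z0[OF v(2)] \<iota>0 by simp
    qed
    then have "p dvd nat a" "p dvd nat b" using M.degree_at_least_2[OF zG' z(2,3)] by blast+
    moreover have "nat a < p" "nat b < p" using ab by auto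
    ultimately have "nat a = 0" "nat b = 0" using nat_dvd_not_less gr0I by blast+
    then show "a = 0 \<and> b = 0" using ab by simp
  qed
  then show ?thesis using \<Omega> by blast
qed

theorem mainTheorem2:
  fixes p :: nat
    and G :: "('g, 'b) monoid_scheme"
    and V :: "(int, 'v, 'n) module_scheme"
    and \<rho> :: "'g \<Rightarrow> 'v \<Rightarrow> 'v"
  assumes "Factorial_Ring.prime p" and "p \<le> 7"
    and "maximal_class p G"
    and "F_module p G V \<rho>"
  shows "\<exists>z\<in>Omega1_center p G. quadratic_on (residue_ring (int p)) V \<rho> z"
proof -
  have "p \<in> {2, 3, 5, 7}"
  proof -
    have "p \<noteq> 4" "p \<noteq> 6" using assms(1) prime_odd_nat[of p] by auto
    moreover have "2 \<le> p" using prime_ge_2_nat[OF assms(1)] .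
    ultimately show ?thesis using assms(2) by auto
  qed
  then consider "CHAR(2) = p" | "CHAR(3) = p" | "CHAR(5) = p" | "CHAR(7) = p" by auto
  then show ?thesis by cases (rule quadratic_conjecture_over[OF assms], assumption)+
qed

end
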